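(* Let $(X,f)$ be a unipotent $SL_{n+1}(\mathbb C)$-crystal, where $f:X\to B^-$ is a $U$-morphism, and assume that none of the rational functions $\varepsilon_i$ ($i\in I$) on $X$ is identically zero. Let $\mathbb X=(X,\{e_i\},\{\gamma_i\},\{\varepsilon_i\})$ be the induced geometric crystal. For $1\le s\le t\le n$ put $$\varepsilon^{\mathbb X}_{[s,t]}(x):=\varepsilon^{B^-}_{[s,t]}(f(x)),\qquad \varepsilon^{*\,\mathbb X}_{[s,t]}(x):=\sum_{P\in\mathcal P_{[s,t]}}(-1)^{(t-s+1)-l(P)}\varepsilon^{\mathbb X}_P(x).$$ Then $E_{\mathbb X}:=\{\varepsilon^{\mathbb X}_{[s,t]},\varepsilon^{*\,\mathbb X}_{[s,t]}\mid 1\le s\le t\le n\}$ is an epsilon system on $\mathbb X$; in particular $\mathbb X$ is an $\varepsilon$-geometric crystal (a geometric crystal equipped with an epsilon system).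
   Context: Let $n\ge1$, $I=\{1,\dots,n\}$, $B^-\subset SL_{n+1}(\mathbb C)$ the group of lower triangular matrices, $U$ the group of upper unitriangular matrices, $x_i(z)=\mathrm{Id}_{n+1}+zE_{i,i+1}\in U$. The multiplication $B^-\times U\to SL_{n+1}(\mathbb C)$ is an open embedding; its birational inverse followed by projection gives a rational map $\pi^-:SL_{n+1}(\mathbb C)\to B^-$. The rational $U$-action on $B^-$ is $(u,b)\mapsto\pi^-(ub)$. A $U$-variety is an ind-variety $X$ over $\mathbb C$ with a rational $U$-action $\alpha:U\times X\to X$ defined on $\{e\}\times X$, where $e$ is the identity; a $U$-morphism is a rational map commuting with the $U$-actions. A unipotent $SL_{n+1}(\mathbb C)$-crystal is a pair $(X,f)$ of a $U$-variety $X$ and a $U$-morphism $f:X\to B^-$. For $b\in B^-$ write $b=b_-b_0$ with $b_-$ lower unitriangular and $b_0=\mathrm{diag}(t_1,\dots,t_{n+1})$. Put $\gamma_i^{B^-}(b)=t_i/t_{i+1}$, $\varepsilon_i^{B^-}(b)=(b_-)_{i+1,i}$, and, for $1\le s\le t\le n$, $\varepsilon^{B^-}_{[s,t]}(b)=(b_-)_{t+1,s}$. The induced geometric crystal structure on $X$ (of type $A_n$) is: $\varepsilon_i(x)=\varepsilon_i^{B^-}(f(x))$, $\gamma_i(x)=\gamma_i^{B^-}(f(x))$, and $e_i^c(x)=\alpha\big(x_i(\tfrac{c-1}{\varepsilon_i(x)}),x\big)$ for $c\in\mathbb C^\times$. It is known that this is a geometric crystal. Intervals: $[s,t]=\{s,s+1,\dots,t\}$;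 $\mathcal J$ is the set of nonempty intervals contained in $I$. A partition of an interval $J$ is a set $P=\{I_1,\dots,I_k\}$ of disjoint (nonempty) intervals with $I_1\sqcup\cdots\sqcup I_k=J$ and $\max(I_j)<\min(I_{j+1})$; $l(P)=k$; $\mathcal P_J$ is the set of partitions of $J$. Put $\varepsilon_P:=\varepsilon_{I_1}\cdots\varepsilon_{I_k}$. An epsilon system of a geometric crystal $(X,\{e_i\},\{\gamma_i\},\{\varepsilon_i\})$ of type $A_n$ is a set of rational functions $\{\varepsilon_J,\varepsilon^*_J\mid J\in\mathcal J\}$ on $X$ with $\varepsilon_{\{i\}}=\varepsilon_i$ (the given function) such that, for every $J=[s,t]\in\mathcal J$ and $i\in I$ (as identities of rational functions): (a) $\varepsilon_J(e_i^cx)=c^{-1}\varepsilon_J(x)$ if $i=s$, and $\varepsilon_J(e_i^cx)=\varepsilon_J(x)$ if $i\ne s-1,s,t+1$; (b) $\varepsilon^*_J(e_i^cx)=c^{-1}\varepsilon^*_J(x)$ if $i=t$, and $\varepsilon^*_J(e_i^cx)=\varepsilon^*_J(x)$ if $i\neq s-1,t,t+1$; (c) $\varepsilon^*_J=\sum_{P\in\mathcal P_J}(-1)^{|J|-l(P)}\varepsilon_P$. *)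

theory Defs
  imports
    "HOL-Analysis.Abstract_Topology"
    "HOL-Library.Disjoint_Sets"
    "Jordan_Normal_Form.Determinant"
begin

section \<open>Varieties over the complex numbers as spaces with functions\<close>

text \<open>
  A variety is given by its closed points, its Zariski topology and, for every open set
  \<open>W\<close>, the set \<open>reg W\<close> of regular functions on \<open>W\<close>.  Since HOL functions are total, an element
  of \<open>reg W\<close> is a function whose values outside \<open>W\<close> are irrelevant.
\<close>

record 'a fspace =
  ztop :: "'a topology"
  reg :: "'a set \<Rightarrow> ('a \<Rightarrow> complex) set"

abbreviation pts :: "'a fspace \<Rightarrow> 'a set" where
  "pts X \<equiv> topspace (ztop X)"

definition space_with_functions :: "'a fspace \<Rightarrow> bool" where
  "space_with_functions X \<longleftrightarrow>
     (\<forall>W. openin (ztop X) W \<longrightarrow>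
        (\<forall>c. (\<lambda>_. c) \<in> reg X W) \<and>
        (\<forall>g\<in>reg X W. \<forall>h\<in>reg X W. (\<lambda>x. g x + h x) \<in> reg X W \<and> (\<lambda>x. g x * h x) \<in> reg X W) \<and>
        (\<forall>g\<in>reg X W. \<forall>h. (\<forall>x\<in>W. h x = g x) \<longrightarrow> h \<in> reg X W) \<and>
        (\<forall>V g. openin (ztop X) V \<and> V \<subseteq> W \<and> g \<in> reg X W \<longrightarrow> g \<in> reg X V) \<and>
        (\<forall>\<V> g. (\<forall>V\<in>\<V>. openin (ztop X) V \<and> g \<in> reg X V) \<and> \<Union>\<V> = W \<longrightarrow> g \<in> reg X W))"

definition fs_morph :: "'a fspace \<Rightarrow> 'b fspace \<Rightarrow> ('a \<Rightarrow> 'b) \<Rightarrow> bool" where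
  "fs_morph X Y \<phi> \<longleftrightarrow>
     continuous_map (ztop X) (ztop Y) \<phi> \<and>
     (\<forall>V g. openin (ztop Y) V \<and> g \<in> reg Y V \<longrightarrow> g \<circ> \<phi> \<in> reg X {x \<in> pts X. \<phi> x \<in> V})"

definition fs_iso :: "'a fspace \<Rightarrow> 'b fspace \<Rightarrow> ('a \<Rightarrow> 'b) \<Rightarrow> bool" where
  "fs_iso X Y \<phi> \<longleftrightarrow>
     fs_morph X Y \<phi> \<and>
     (\<exists>\<psi>. fs_morph Y X \<psi> \<and> (\<forall>x\<in>pts X. \<psi> (\<phi> x) = x) \<and> (\<forall>y\<in>pts Y. \<phi> (\<psi> y) = y))"

text \<open>
  The structure induced on a subset (used for open and for closed subsets): regular functions
  are those that locally extend to regular functions of the ambient space.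
\<close>

definition fs_sub :: "'a fspace \<Rightarrow> 'a set \<Rightarrow> 'a fspace" where
  "fs_sub X S =
     \<lparr> ztop = subtopology (ztop X) S,
       reg = (\<lambda>V. {g. \<forall>x\<in>V. \<exists>W h. openin (ztop X) W \<and> x \<in> W \<and> h \<in> reg X W \<and>
                         (\<forall>y\<in>W \<inter> V. g y = h y)}) \<rparr>"

text \<open>
  The categorical product.  If \<open>A\<close>, \<open>B\<close> are open, the functions
  \<open>(x, y) \<mapsto> \<Sum>i. f\<^sub>i x * g\<^sub>i y\<close> with \<open>f\<^sub>i\<close>, \<open>g\<^sub>i\<close> regular on \<open>A\<close>, \<open>B\<close> are regular on \<open>A \<times> B\<close>;
  their nonvanishing sets generate the Zariski topology of the product (which is finer than the
  product topology), and their quotients are locally all regular functions.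
\<close>

definition tensor_funs ::
  "'a fspace \<Rightarrow> 'b fspace \<Rightarrow> 'a set \<Rightarrow> 'b set \<Rightarrow> ('a \<times> 'b \<Rightarrow> complex) set" where
  "tensor_funs X Y A B =
     {h. \<exists>(k::nat) f g. (\<forall>i<k. f i \<in> reg X A \<and> g i \<in> reg Y B) \<and>
                        h = (\<lambda>(x, y). \<Sum>i<k. f i x * g i y)}"

definition fs_prod :: "'a fspace \<Rightarrow> 'b fspace \<Rightarrow> ('a \<times> 'b) fspace" where
  "fs_prod X Y =
     (let T = topology (arbitrary union_of (finite intersection_of
                (\<lambda>D. \<exists>A B. openin (ztop X) A \<and> openin (ztop Y) B \<and>
                       (\<exists>h\<in>tensor_funs X Y A B. D = {p \<in> A \<times> B. h p \<noteq> 0}))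
                relative_to (pts X \<times> pts Y)))
      in \<lparr> ztop = T,
           reg = (\<lambda>W. {g. \<forall>p\<in>W. \<exists>A B V.
                    openin (ztop X) A \<and> openin (ztop Y) B \<and> openin T V \<and>
                    p \<in> V \<and> V \<subseteq> W \<and> V \<subseteq> A \<times> B \<and>
                    (\<exists>a\<in>tensor_funs X Y A B. \<exists>b\<in>tensor_funs X Y A B.
                       \<forall>q\<in>V. b q \<noteq> 0 \<and> g q = a q / b q)}) \<rparr>)"

inductive_set polys :: "('a \<Rightarrow> complex) set \<Rightarrow> ('a \<Rightarrow> complex) set"
  for C :: "('a \<Rightarrow> complex) set" where
  const: "(\<lambda>_. c) \<in> polys C"
| coord: "g \<in> C \<Longrightarrow> g \<in> polys C"
| add: "g \<in> polys C \<Longrightarrow> h \<in> polys C \<Longrightarrow> (\<lambda>x. g x + h x) \<in> polys C"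
| mult: "g \<in> polys C \<Longrightarrow> h \<in> polys C \<Longrightarrow> (\<lambda>x. g x * h x) \<in> polys C"

text \<open>
  The structure of a quasi-affine variety on a set \<open>S\<close> of points, given a set \<open>C\<close> of coordinate
  functions that separates the points of \<open>S\<close>: open sets are generated by the nonvanishing sets
  of polynomials in the coordinates, and regular functions are locally quotients of such
  polynomials.
\<close>

definition coord_space :: "'a set \<Rightarrow> ('a \<Rightarrow> complex) set \<Rightarrow> 'a fspace" where
  "coord_space S C =
     (let T = topology (arbitrary union_of (finite intersection_of
                (\<lambda>D. \<exists>q\<in>polys C. D = {x. q x \<noteq> 0}) relative_to S))
      in \<lparr> ztop = T,
           reg = (\<lambda>W. {g. \<forall>x\<in>W. \<exists>V. openin T V \<and> x \<in> V \<and> V \<subseteq> W \<and>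
                    (\<exists>p\<in>polys C. \<exists>q\<in>polys C. \<forall>y\<in>V. q y \<noteq> 0 \<and> g y = p y / q y)}) \<rparr>)"

text \<open>Points of affine \<open>m\<close>-space are sequences vanishing from index \<open>m\<close> on.\<close>

definition affine_coords :: "nat \<Rightarrow> ((nat \<Rightarrow> complex) \<Rightarrow> complex) set" where
  "affine_coords m = {(\<lambda>x. x i) | i. i < m}"

definition algebraic_set :: "nat \<Rightarrow> (nat \<Rightarrow> complex) set \<Rightarrow> bool" where
  "algebraic_set m S \<longleftrightarrow>
     (\<exists>Q \<subseteq> polys (affine_coords m). S = {x. (\<forall>i\<ge>m. x i = 0) \<and> (\<forall>q\<in>Q. q x = 0)})"

definition variety :: "'a fspace \<Rightarrow> bool" where
  "variety X \<longleftrightarrow>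
     space_with_functions X \<and>
     (\<exists>\<U>. finite \<U> \<and> \<Union>\<U> = pts X \<and>
        (\<forall>U\<in>\<U>. openin (ztop X) U \<and>
           (\<exists>m S \<phi>. algebraic_set m S \<and>
              fs_iso (fs_sub X U) (coord_space S (affine_coords m)) \<phi>))) \<and>
     closedin (ztop (fs_prod X X)) {(x, x) | x. x \<in> pts X}"


section \<open>Ind-varieties and rational maps\<close>

text \<open>
  An ind-variety is a set with an exhaustive filtration by varieties such that each inclusion
  is a closed embedding; a variety is regarded as an ind-variety with constant filtration.
  No irreducibility is imposed.
\<close>

definition ind_variety :: "(nat \<Rightarrow> 'a fspace) \<Rightarrow> bool" where
  "ind_variety X \<longleftrightarrow>
     (\<forall>k. variety (X k) \<and> closedin (ztop (X (Suc k))) (pts (X k)) \<and>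
          fs_iso (X k) (fs_sub (X (Suc k)) (pts (X k))) id)"

definition ind_prod :: "(nat \<Rightarrow> 'a fspace) \<Rightarrow> (nat \<Rightarrow> 'b fspace) \<Rightarrow> nat \<Rightarrow> ('a \<times> 'b) fspace" where
  "ind_prod X Y = (\<lambda>k. fs_prod (X k) (Y k))"

definition ind_pts :: "(nat \<Rightarrow> 'a fspace) \<Rightarrow> 'a set" where
  "ind_pts X = (\<Union>k. pts (X k))"

definition ind_top :: "(nat \<Rightarrow> 'a fspace) \<Rightarrow> 'a topology" where
  "ind_top X = topology (\<lambda>W. W \<subseteq> ind_pts X \<and> (\<forall>k. openin (ztop (X k)) (W \<inter> pts (X k))))"

lemma openin_ind_top:
  "openin (ind_top X) W \<longleftrightarrow> W \<subseteq> ind_pts X \<and> (\<forall>k. openin (ztop (X k)) (W \<inter> pts (X k)))"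
proof -
  have "istopology (\<lambda>W. W \<subseteq> ind_pts X \<and> (\<forall>k. openin (ztop (X k)) (W \<inter> pts (X k))))"
    unfolding istopology_def
  proof (intro conjI allI impI)
    fix S T k
    assume S: "S \<subseteq> ind_pts X \<and> (\<forall>k. openin (ztop (X k)) (S \<inter> pts (X k)))"
      and T: "T \<subseteq> ind_pts X \<and> (\<forall>k. openin (ztop (X k)) (T \<inter> pts (X k)))"
    show "S \<inter> T \<subseteq> ind_pts X" using S by blast
    have "S \<inter> T \<inter> pts (X k) = (S \<inter> pts (X k)) \<inter> (T \<inter> pts (X k))" by blast
    then show "openin (ztop (X k)) (S \<inter> T \<inter> pts (X k))" using S T by auto
  next
    fix \<K> k
    assume K: "\<forall>S\<in>\<K>. S \<subseteq> ind_pts X \<and> (\<forall>k. openin (ztop (X k)) (S \<inter> pts (X k)))"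
    show "\<Union>\<K> \<subseteq> ind_pts X" using K by blast
    have eq: "\<Union>\<K> \<inter> pts (X k) = (\<Union>S\<in>\<K>. S \<inter> pts (X k))" by blast
    show "openin (ztop (X k)) (\<Union>\<K> \<inter> pts (X k))"
      unfolding eq using K by (intro openin_Union) blast
  qed
  then show ?thesis by (simp add: ind_top_def topology_inverse')
qed

lemma topspace_ind_top [simp]: "topspace (ind_top X) = ind_pts X"
proof (rule equalityI)
  show "topspace (ind_top X) \<subseteq> ind_pts X" by (auto simp: topspace_def openin_ind_top)
  have "ind_pts X \<inter> pts (X k) = pts (X k)" for k by (auto simp: ind_pts_def)
  then have "openin (ind_top X) (ind_pts X)" by (simp add: openin_ind_top)
  then show "ind_pts X \<subseteq> topspace (ind_top X)" by (rule openin_subset)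
qed

definition open_dense :: "(nat \<Rightarrow> 'a fspace) \<Rightarrow> 'a set \<Rightarrow> bool" where
  "open_dense X W \<longleftrightarrow> openin (ind_top X) W \<and> ind_top X closure_of W = ind_pts X"

definition ind_morph_on ::
  "(nat \<Rightarrow> 'a fspace) \<Rightarrow> 'a set \<Rightarrow> (nat \<Rightarrow> 'b fspace) \<Rightarrow> ('a \<Rightarrow> 'b) \<Rightarrow> bool" where
  "ind_morph_on X W Y \<phi> \<longleftrightarrow> (\<forall>k. \<exists>m. fs_morph (fs_sub (X k) (W \<inter> pts (X k))) (Y m) \<phi>)"

text \<open>
  A rational map is an equivalence class of morphisms defined on dense open subsets.  It is
  handled through a representative, a partial function; \<open>rat_eq\<close> is equality of rational
  maps.  Composites are composites of partial functions, so an equation \<open>rat_eq\<close> between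
  composites also asserts that these are defined on a dense open set.
\<close>

definition rat_map :: "(nat \<Rightarrow> 'a fspace) \<Rightarrow> (nat \<Rightarrow> 'b fspace) \<Rightarrow> ('a \<rightharpoonup> 'b) \<Rightarrow> bool" where
  "rat_map X Y \<phi> \<longleftrightarrow> open_dense X (dom \<phi>) \<and> ind_morph_on X (dom \<phi>) Y (\<lambda>x. the (\<phi> x))"

definition rat_eq :: "(nat \<Rightarrow> 'a fspace) \<Rightarrow> ('a \<rightharpoonup> 'b) \<Rightarrow> ('a \<rightharpoonup> 'b) \<Rightarrow> bool" where
  "rat_eq X \<phi> \<psi> \<longleftrightarrow> (\<exists>W. open_dense X W \<and> W \<subseteq> dom \<phi> \<inter> dom \<psi> \<and> (\<forall>x\<in>W. \<phi> x = \<psi> x))"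

definition affine_line :: "complex fspace" where
  "affine_line = coord_space UNIV {\<lambda>z. z}"

definition rat_fun :: "(nat \<Rightarrow> 'a fspace) \<Rightarrow> ('a \<rightharpoonup> complex) \<Rightarrow> bool" where
  "rat_fun X \<phi> \<longleftrightarrow> rat_map X (\<lambda>_. affine_line) \<phi>"

text \<open>
  ``Not identically zero'', for a rational function on a possibly reducible \<open>X\<close>: it does not
  vanish identically on any (nonempty open) part of \<open>X\<close>, so that its inverse is again a rational
  function.  On irreducible \<open>X\<close> this just says that it is not the zero rational function, see
  \<open>rat_nonzero_iff\<close> below.
\<close>

definition rat_nonzero :: "(nat \<Rightarrow> 'a fspace) \<Rightarrow> ('a \<rightharpoonup> complex) \<Rightarrow> bool" where
  "rat_nonzero X \<phi> \<longleftrightarrow>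
     (\<forall>V. openin (ind_top X) V \<and> V \<noteq> {} \<longrightarrow> (\<exists>x\<in>V. \<exists>r. \<phi> x = Some r \<and> r \<noteq> 0))"

definition ind_irreducible :: "(nat \<Rightarrow> 'a fspace) \<Rightarrow> bool" where
  "ind_irreducible X \<longleftrightarrow>
     ind_pts X \<noteq> {} \<and>
     (\<forall>V W. openin (ind_top X) V \<and> V \<noteq> {} \<and> openin (ind_top X) W \<and> W \<noteq> {} \<longrightarrow> V \<inter> W \<noteq> {})"

lemma openin_affine_line_nonzero: "openin (ztop affine_line) (UNIV - {0})"
proof -
  let ?P = "\<lambda>D. \<exists>q\<in>polys {\<lambda>z. z}. D = {x. q x \<noteq> (0::complex)}"
  have "(\<lambda>z. z) \<in> polys {\<lambda>z::complex. z}" by (rule polys.coord) simp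
  then have "?P (UNIV - {0})" by (intro bexI[of _ "\<lambda>z. z"]) auto
  then have "(finite intersection_of ?P relative_to UNIV) (UNIV - {0})"
    unfolding relative_to_def
    by (intro exI[of _ "UNIV - {0}"] conjI finite_intersection_of_inc) simp_all
  then show ?thesis
    by (simp add: affine_line_def coord_space_def openin_subbase arbitrary_union_of_inc)
qed

lemma rat_fun_nonvanishing_open:
  assumes "rat_fun X \<phi>"
  shows "openin (ind_top X) {x \<in> dom \<phi>. the (\<phi> x) \<noteq> 0}" (is "openin _ ?W")
proof -
  have D: "openin (ind_top X) (dom \<phi>)"
    and M: "ind_morph_on X (dom \<phi>) (\<lambda>_. affine_line) (\<lambda>x. the (\<phi> x))"
    using assms by (auto simp: rat_fun_def rat_map_def open_dense_def)
  have "openin (ztop (X k)) (?W \<inter> pts (X k))" for k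
  proof -
    let ?D = "dom \<phi> \<inter> pts (X k)"
    have "continuous_map (subtopology (ztop (X k)) ?D) (ztop affine_line) (\<lambda>x. the (\<phi> x))"
      using M by (auto simp: ind_morph_on_def fs_morph_def fs_sub_def)
    then have "openin (subtopology (ztop (X k)) ?D)
                 {x \<in> topspace (subtopology (ztop (X k)) ?D). the (\<phi> x) \<in> UNIV - {0}}"
      using openin_affine_line_nonzero by (rule openin_continuous_map_preimage)
    moreover have "openin (ztop (X k)) ?D" using D by (simp add: openin_ind_top)
    ultimately have "openin (ztop (X k))
        {x \<in> topspace (subtopology (ztop (X k)) ?D). the (\<phi> x) \<in> UNIV - {0}}"
      using openin_trans_full by blast
    moreover have "{x \<in> topspace (subtopology (ztop (X k)) ?D). the (\<phi> x) \<in> UNIV - {0}}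
        = ?W \<inter> pts (X k)" by auto
    ultimately show ?thesis by simp
  qed
  moreover have "?W \<subseteq> ind_pts X" using D by (auto simp: openin_ind_top)
  ultimately show ?thesis by (simp add: openin_ind_top)
qed

lemma rat_nonzero_iff:
  assumes "ind_irreducible X" "rat_fun X \<phi>"
  shows "rat_nonzero X \<phi> \<longleftrightarrow> \<not> rat_eq X \<phi> (\<lambda>_. Some 0)"
proof
  assume nz: "rat_nonzero X \<phi>"
  show "\<not> rat_eq X \<phi> (\<lambda>_. Some 0)"
  proof
    assume "rat_eq X \<phi> (\<lambda>_. Some 0)"
    then obtain W where W: "open_dense X W" "\<forall>x\<in>W. \<phi> x = Some 0"
      by (auto simp: rat_eq_def)
    then have "W \<noteq> {}" using assms(1) by (auto simp: open_dense_def ind_irreducible_def)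
    moreover have "openin (ind_top X) W" using W(1) by (simp add: open_dense_def)
    ultimately obtain x r where "x \<in> W" "\<phi> x = Some r" "r \<noteq> 0"
      using nz unfolding rat_nonzero_def by blast
    then show False using W(2) by simp
  qed
next
  assume ne: "\<not> rat_eq X \<phi> (\<lambda>_. Some 0)"
  let ?W = "{x \<in> dom \<phi>. the (\<phi> x) \<noteq> 0}"
  have "?W \<noteq> {}"
  proof
    assume "?W = {}"
    then have "\<forall>x\<in>dom \<phi>. \<phi> x = Some 0" by auto
    moreover have "open_dense X (dom \<phi>)" using assms(2) by (auto simp: rat_fun_def rat_map_def)
    ultimately have "rat_eq X \<phi> (\<lambda>_. Some 0)" unfolding rat_eq_def by (intro exI[of _ "dom \<phi>"]) auto
    then show False using ne by simp
  qed
  then have *: "V \<inter> ?W \<noteq> {}" if "openin (ind_top X) V" "V \<noteq> {}" for V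
    using assms(1) rat_fun_nonvanishing_open[OF assms(2)] that
    unfolding ind_irreducible_def by blast
  show "rat_nonzero X \<phi>"
    unfolding rat_nonzero_def
  proof (intro allI impI)
    fix V assume "openin (ind_top X) V \<and> V \<noteq> {}"
    then obtain x where "x \<in> V" "x \<in> ?W" using * by blast
    then show "\<exists>x\<in>V. \<exists>r. \<phi> x = Some r \<and> r \<noteq> 0" by (intro bexI[of _ x]) auto
  qed
qed

text \<open>A rational action of an algebraic group \<open>G\<close>, given by its multiplication and unit.\<close>

definition rational_action ::
  "'g fspace \<Rightarrow> ('g \<Rightarrow> 'g \<Rightarrow> 'g) \<Rightarrow> 'g \<Rightarrow> (nat \<Rightarrow> 'a fspace) \<Rightarrow> ('g \<times> 'a \<rightharpoonup> 'a) \<Rightarrow> bool" where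
  "rational_action G mul e X \<alpha> \<longleftrightarrow>
     rat_map (ind_prod (\<lambda>_. G) X) X \<alpha> \<and>
     rat_eq X (\<lambda>x. \<alpha> (e, x)) Some \<and>
     rat_eq (ind_prod (\<lambda>_. G) (ind_prod (\<lambda>_. G) X))
       (\<lambda>(g, h, x). Option.bind (\<alpha> (h, x)) (\<lambda>y. \<alpha> (g, y)))
       (\<lambda>(g, h, x). \<alpha> (mul g h, x))"


section \<open>The groups\<close>

text \<open>Matrices are 0-based in the library; \<open>ent\<close> gives the 1-based entries used here.\<close>

definition ent :: "complex mat \<Rightarrow> nat \<Rightarrow> nat \<Rightarrow> complex" where
  "ent A i j = A $$ (i - 1, j - 1)"

definition SL :: "nat \<Rightarrow> complex mat set" where
  "SL n = {g \<in> carrier_mat (n + 1) (n + 1). det g = 1}"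

definition Bminus :: "nat \<Rightarrow> complex mat set" where
  "Bminus n = {b \<in> SL n. \<forall>i<n+1. \<forall>j<n+1. i < j \<longrightarrow> b $$ (i, j) = 0}"

definition Uplus :: "nat \<Rightarrow> complex mat set" where
  "Uplus n = {u \<in> SL n. upper_triangular u \<and> (\<forall>i<n+1. u $$ (i, i) = 1)}"

definition Uminus :: "nat \<Rightarrow> complex mat set" where
  "Uminus n = {u \<in> Bminus n. \<forall>i<n+1. u $$ (i, i) = 1}"

definition Tdiag :: "nat \<Rightarrow> complex mat set" where
  "Tdiag n = {t \<in> SL n. diagonal_mat t}"

definition xgen :: "nat \<Rightarrow> nat \<Rightarrow> complex \<Rightarrow> complex mat" where
  "xgen n i z = 1\<^sub>m (n + 1) + z \<cdot>\<^sub>m mat (n + 1) (n + 1) (\<lambda>(a, b). if a = i - 1 \<and> b = i then 1 else 0)"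

definition mat_coords :: "nat \<Rightarrow> (complex mat \<Rightarrow> complex) set" where
  "mat_coords n = {(\<lambda>A. A $$ (i, j)) | i j. i < n + 1 \<and> j < n + 1}"

definition U_var :: "nat \<Rightarrow> complex mat fspace" where
  "U_var n = coord_space (Uplus n) (mat_coords n)"

definition Bminus_var :: "nat \<Rightarrow> complex mat fspace" where
  "Bminus_var n = coord_space (Bminus n) (mat_coords n)"

definition Cx_var :: "complex fspace" where
  "Cx_var = coord_space (UNIV - {0}) {\<lambda>z. z}"

text \<open>
  The birational inverse of \<open>(b, u) \<mapsto> b * u\<close>, followed by projection.  It is defined on the image
  \<open>Bminus n * Uplus n\<close>, where the factorization is unique.
\<close>

definition pi_minus :: "nat \<Rightarrow> complex mat \<rightharpoonup> complex mat" where
  "pi_minus n g =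
     (if \<exists>b\<in>Bminus n. \<exists>u\<in>Uplus n. g = b * u
      then Some (THE b. b \<in> Bminus n \<and> (\<exists>u\<in>Uplus n. g = b * u)) else None)"

definition Bminus_action :: "nat \<Rightarrow> complex mat \<times> complex mat \<rightharpoonup> complex mat" where
  "Bminus_action n = (\<lambda>(u, b). pi_minus n (u * b))"

definition minus_part :: "nat \<Rightarrow> complex mat \<Rightarrow> complex mat" where
  "minus_part n b = (THE l. l \<in> Uminus n \<and> (\<exists>t\<in>Tdiag n. b = l * t))"

definition zero_part :: "nat \<Rightarrow> complex mat \<Rightarrow> complex mat" where
  "zero_part n b = (THE t. t \<in> Tdiag n \<and> (\<exists>l\<in>Uminus n. b = l * t))"

definition gamma_B :: "nat \<Rightarrow> nat \<Rightarrow> complex mat \<Rightarrow> complex" where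
  "gamma_B n i b = ent (zero_part n b) i i / ent (zero_part n b) (i + 1) (i + 1)"

definition epsilon_B :: "nat \<Rightarrow> nat \<Rightarrow> complex mat \<Rightarrow> complex" where
  "epsilon_B n i b = ent (minus_part n b) (i + 1) i"

text \<open>Intervals are sets of naturals; for \<open>J = {s..t}\<close> this is \<open>(b\<^sub>-)\<close> at row \<open>t + 1\<close>, column \<open>s\<close>.\<close>

definition epsilon_B_int :: "nat \<Rightarrow> nat set \<Rightarrow> complex mat \<Rightarrow> complex" where
  "epsilon_B_int n J b = ent (minus_part n b) (Max J + 1) (Min J)"


section \<open>Unipotent crystals\<close>

definition U_variety :: "nat \<Rightarrow> (nat \<Rightarrow> 'a fspace) \<Rightarrow> (complex mat \<times> 'a \<rightharpoonup> 'a) \<Rightarrow> bool" where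
  "U_variety n X \<alpha> \<longleftrightarrow>
     ind_variety X \<and>
     rational_action (U_var n) (*) (1\<^sub>m (n + 1)) X \<alpha> \<and>
     {1\<^sub>m (n + 1)} \<times> ind_pts X \<subseteq> dom \<alpha>"

definition U_morphism ::
  "nat \<Rightarrow> (nat \<Rightarrow> 'a fspace) \<Rightarrow> (complex mat \<times> 'a \<rightharpoonup> 'a) \<Rightarrow>
   (nat \<Rightarrow> 'b fspace) \<Rightarrow> (complex mat \<times> 'b \<rightharpoonup> 'b) \<Rightarrow> ('a \<rightharpoonup> 'b) \<Rightarrow> bool" where
  "U_morphism n X \<alpha> Y \<beta> f \<longleftrightarrow>
     rat_map X Y f \<and>
     rat_eq (ind_prod (\<lambda>_. U_var n) X)
       (\<lambda>(u, x). Option.bind (\<alpha> (u, x)) f)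
       (\<lambda>(u, x). Option.bind (f x) (\<lambda>y. \<beta> (u, y)))"

definition unipotent_crystal ::
  "nat \<Rightarrow> (nat \<Rightarrow> 'a fspace) \<Rightarrow> (complex mat \<times> 'a \<rightharpoonup> 'a) \<Rightarrow> ('a \<rightharpoonup> complex mat) \<Rightarrow> bool" where
  "unipotent_crystal n X \<alpha> f \<longleftrightarrow>
     U_variety n X \<alpha> \<and> U_morphism n X \<alpha> (\<lambda>_. Bminus_var n) (Bminus_action n) f"


section \<open>Geometric crystals and epsilon systems of type A\<close>

definition cartan_A :: "nat \<Rightarrow> nat \<Rightarrow> int" where
  "cartan_A i j = (if i = j then 2 else if i = j + 1 \<or> j = i + 1 then -1 else 0)"

text \<open>
  The standard definition of a geometric crystal for the Cartan matrix of type \<open>A\<^sub>n\<close>; the map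
  \<open>e i\<close> sends \<open>(c, x)\<close> to \<open>e\<^sub>i\<^sup>c x\<close>.
\<close>

definition geometric_crystal ::
  "nat \<Rightarrow> (nat \<Rightarrow> 'a fspace) \<Rightarrow> (nat \<Rightarrow> complex \<times> 'a \<rightharpoonup> 'a) \<Rightarrow> (nat \<Rightarrow> 'a \<rightharpoonup> complex) \<Rightarrow>
   (nat \<Rightarrow> 'a \<rightharpoonup> complex) \<Rightarrow> bool" where
  "geometric_crystal n X e \<gamma> \<epsilon> \<longleftrightarrow>
     ind_variety X \<and>
     (\<forall>i\<in>{1..n}. rat_fun X (\<gamma> i) \<and> rat_fun X (\<epsilon> i) \<and>
        rational_action Cx_var (*) 1 X (e i) \<and> open_dense X {x. (1, x) \<in> dom (e i)}) \<and>
     (\<forall>i\<in>{1..n}. \<forall>j\<in>{1..n}.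
        rat_eq (ind_prod (\<lambda>_. Cx_var) X)
          (\<lambda>(c, x). Option.bind (e i (c, x)) (\<gamma> j))
          (\<lambda>(c, x). map_option (\<lambda>r. c powi cartan_A i j * r) (\<gamma> j x))) \<and>
     (\<forall>i\<in>{1..n}. \<forall>j\<in>{1..n}. cartan_A i j = 0 \<longrightarrow>
        rat_eq (ind_prod (\<lambda>_. Cx_var) (ind_prod (\<lambda>_. Cx_var) X))
          (\<lambda>(c, d, x). Option.bind (e j (d, x)) (\<lambda>y. e i (c, y)))
          (\<lambda>(c, d, x). Option.bind (e i (c, x)) (\<lambda>y. e j (d, y)))) \<and>
     (\<forall>i\<in>{1..n}. \<forall>j\<in>{1..n}. cartan_A i j = -1 \<longrightarrow>
        rat_eq (ind_prod (\<lambda>_. Cx_var) (ind_prod (\<lambda>_. Cx_var) X))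
          (\<lambda>(c, d, x). Option.bind (e i (d, x)) (\<lambda>y. Option.bind (e j (c * d, y)) (\<lambda>z. e i (c, z))))
          (\<lambda>(c, d, x). Option.bind (e j (c, x)) (\<lambda>y. Option.bind (e i (c * d, y)) (\<lambda>z. e j (d, z))))) \<and>
     (\<forall>i\<in>{1..n}.
        rat_eq (ind_prod (\<lambda>_. Cx_var) X)
          (\<lambda>(c, x). Option.bind (e i (c, x)) (\<epsilon> i))
          (\<lambda>(c, x). map_option (\<lambda>r. inverse c * r) (\<epsilon> i x))) \<and>
     (\<forall>i\<in>{1..n}. \<forall>j\<in>{1..n}. cartan_A i j = 0 \<longrightarrow>
        rat_eq (ind_prod (\<lambda>_. Cx_var) X)
          (\<lambda>(c, x). Option.bind (e j (c, x)) (\<epsilon> i))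
          (\<lambda>(c, x). \<epsilon> i x))"

text \<open>
  Disjoint nonempty intervals are linearly ordered by position, so a partition
  \<open>{I\<^sub>1, ..., I\<^sub>k}\<close> with \<open>max I\<^sub>j < min I\<^sub>j\<^sub>+\<^sub>1\<close> is just a set partition into intervals.
\<close>

definition interval_partitions :: "nat set \<Rightarrow> nat set set set" where
  "interval_partitions J = {P. partition_on J P \<and> (\<forall>K\<in>P. \<exists>s t. s \<le> t \<and> K = {s..t})}"

definition eps_prod :: "(nat set \<Rightarrow> 'a \<rightharpoonup> complex) \<Rightarrow> nat set set \<Rightarrow> 'a \<rightharpoonup> complex" where
  "eps_prod E P x =
     (if \<forall>K\<in>P. x \<in> dom (E K) then Some (\<Prod>K\<in>P. the (E K x)) else None)"

definition eps_alternating_sum :: "(nat set \<Rightarrow> 'a \<rightharpoonup> complex) \<Rightarrow> nat set \<Rightarrow> 'a \<rightharpoonup> complex" where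
  "eps_alternating_sum E J x =
     (if \<forall>P\<in>interval_partitions J. x \<in> dom (eps_prod E P)
      then Some (\<Sum>P\<in>interval_partitions J. (-1) ^ (card J - card P) * the (eps_prod E P x))
      else None)"

definition epsilon_system ::
  "nat \<Rightarrow> (nat \<Rightarrow> 'a fspace) \<Rightarrow> (nat \<Rightarrow> complex \<times> 'a \<rightharpoonup> 'a) \<Rightarrow> (nat \<Rightarrow> 'a \<rightharpoonup> complex) \<Rightarrow>
   (nat set \<Rightarrow> 'a \<rightharpoonup> complex) \<Rightarrow> (nat set \<Rightarrow> 'a \<rightharpoonup> complex) \<Rightarrow> bool" where
  "epsilon_system n X e \<epsilon> E Es \<longleftrightarrow>
     (\<forall>i\<in>{1..n}. rat_eq X (E {i}) (\<epsilon> i)) \<and>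
     (\<forall>s t. 1 \<le> s \<and> s \<le> t \<and> t \<le> n \<longrightarrow>
        rat_fun X (E {s..t}) \<and> rat_fun X (Es {s..t}) \<and>
        (\<forall>i\<in>{1..n}.
           (i = s \<longrightarrow>
              rat_eq (ind_prod (\<lambda>_. Cx_var) X)
                (\<lambda>(c, x). Option.bind (e i (c, x)) (E {s..t}))
                (\<lambda>(c, x). map_option (\<lambda>r. inverse c * r) (E {s..t} x))) \<and>
           (i \<notin> {s - 1, s, t + 1} \<longrightarrow>
              rat_eq (ind_prod (\<lambda>_. Cx_var) X)
                (\<lambda>(c, x). Option.bind (e i (c, x)) (E {s..t}))
                (\<lambda>(c, x). E {s..t} x)) \<and>
           (i = t \<longrightarrow>
              rat_eq (ind_prod (\<lambda>_. Cx_var) X)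
                (\<lambda>(c, x). Option.bind (e i (c, x)) (Es {s..t}))
                (\<lambda>(c, x). map_option (\<lambda>r. inverse c * r) (Es {s..t} x))) \<and>
           (i \<notin> {s - 1, t, t + 1} \<longrightarrow>
              rat_eq (ind_prod (\<lambda>_. Cx_var) X)
                (\<lambda>(c, x). Option.bind (e i (c, x)) (Es {s..t}))
                (\<lambda>(c, x). Es {s..t} x))) \<and>
        rat_eq X (Es {s..t}) (eps_alternating_sum E {s..t}))"

definition eps_geometric_crystal ::
  "nat \<Rightarrow> (nat \<Rightarrow> 'a fspace) \<Rightarrow> (nat \<Rightarrow> complex \<times> 'a \<rightharpoonup> 'a) \<Rightarrow> (nat \<Rightarrow> 'a \<rightharpoonup> complex) \<Rightarrow>
   (nat \<Rightarrow> 'a \<rightharpoonup> complex) \<Rightarrow> bool" where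
  "eps_geometric_crystal n X e \<gamma> \<epsilon> \<longleftrightarrow>
     geometric_crystal n X e \<gamma> \<epsilon> \<and> (\<exists>E Es. epsilon_system n X e \<epsilon> E Es)"


section \<open>The structures induced by a unipotent crystal\<close>

definition induced_gamma :: "nat \<Rightarrow> ('a \<rightharpoonup> complex mat) \<Rightarrow> nat \<Rightarrow> 'a \<rightharpoonup> complex" where
  "induced_gamma n f i x = map_option (gamma_B n i) (f x)"

definition induced_epsilon :: "nat \<Rightarrow> ('a \<rightharpoonup> complex mat) \<Rightarrow> nat \<Rightarrow> 'a \<rightharpoonup> complex" where
  "induced_epsilon n f i x = map_option (epsilon_B n i) (f x)"

definition induced_e ::
  "nat \<Rightarrow> (complex mat \<times> 'a \<rightharpoonup> 'a) \<Rightarrow> ('a \<rightharpoonup> complex mat) \<Rightarrow> nat \<Rightarrow> complex \<times> 'a \<rightharpoonup> 'a" where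
  "induced_e n \<alpha> f i = (\<lambda>(c, x).
     if c = 0 then None
     else Option.bind (induced_epsilon n f i x)
            (\<lambda>r. if r = 0 then None else \<alpha> (xgen n i ((c - 1) / r), x)))"

definition induced_eps_int :: "nat \<Rightarrow> ('a \<rightharpoonup> complex mat) \<Rightarrow> nat set \<Rightarrow> 'a \<rightharpoonup> complex" where
  "induced_eps_int n f J x = map_option (epsilon_B_int n J) (f x)"

definition induced_eps_star :: "nat \<Rightarrow> ('a \<rightharpoonup> complex mat) \<Rightarrow> nat set \<Rightarrow> 'a \<rightharpoonup> complex" where
  "induced_eps_star n f = eps_alternating_sum (induced_eps_int n f)"

end

theory Submission
  imports Defs "HOL-Computational_Algebra.Polynomial"
begin

text \<open>
  A U-morphism \<open>f\<close> carries the action of \<open>U\<close> on \<open>X\<close> to the one on \<open>B\<^sup>-\<close>.  Hence along \<open>e\<^sub>i\<^sup>c\<close> the value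
  \<open>b\<close> of \<open>f\<close> is replaced by the lower triangular matrix \<open>b'\<close> with \<open>x\<^sub>i(z) b \<in> b' U\<close>, where
  \<open>z = (c - 1) / \<epsilon>\<^sub>i(b)\<close>.  As \<open>1 + z \<epsilon>\<^sub>i(b) = c\<close> does not vanish, \<open>b' = x\<^sub>i(z) b x\<^sub>i(-w)\<close> for an explicit \<open>w\<close>
  (\<open>step_entry\<close>): only row \<open>i\<close> and column \<open>i + 1\<close> of \<open>b\<close> are altered.  The functions
  \<open>\<gamma>\<^sub>j\<close> and \<open>\<epsilon>\<^sub>J\<close> are quotients of entries of \<open>b\<close>, so their behaviour under \<open>e\<^sub>i\<^sup>c\<close> is read off.
  The alternating sum \<open>\<epsilon>\<^sup>*\<^sub>J\<close> is of the same kind: the inverse of a lower unitriangular matrix is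
  the signed sum over chains \<open>s = k\<^sub>0 < \<dots> < k\<^sub>l = t + 1\<close> of products of entries, and chains are
  interval partitions of \<open>{s..t}\<close>.  So \<open>\<epsilon>\<^sup>*\<^sub>J\<close> is, up to sign, an entry of the inverse of \<open>b\<^sub>-\<close>
  (\<open>interval_sum_adj\<close>), and \<open>b'\<^sup>-\<^sup>1 = x\<^sub>i(w) b\<^sup>-\<^sup>1 x\<^sub>i(-z)\<close> again changes one row and one column
  (\<open>step_adj\<close>).  The Verma relations reduce to
  \<open>x\<^sub>i(p) x\<^sub>i\<^sub>+\<^sub>1(q) x\<^sub>i(r) = x\<^sub>i\<^sub>+\<^sub>1(p') x\<^sub>i(q') x\<^sub>i\<^sub>+\<^sub>1(r')\<close> for the parameters that occur (\<open>braid_chain\<close>).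

  What has to be justified besides is the calculation with rational maps.  The axioms of an action
  and of a U-morphism are identities on some dense open subset of \<open>U \<times> U \<times> X\<close> or \<open>U \<times> X\<close>, and
  this subset could miss the smaller set of all \<open>(x\<^sub>i(z), x)\<close> on which the crystal operators are
  evaluated.  However, such identities hold wherever both sides are defined: the target \<open>X\<close> is
  separated (\<open>mor_on_agree\<close>), and membership in \<open>b' U\<close> is a closed condition (\<open>Bminus_Uplus_iff_adj\<close>).
  And both sides are defined often enough: the action is defined on \<open>{1} \<times> X\<close>, where it is the
  identity, so the domain of every composite of crystal operators is an open set that contains
  the points with all \<open>c = 1\<close> and \<open>x\<close> in the dense open set \<open>D\<close> where \<open>f\<close> is defined and no \<open>\<epsilon>\<^sub>i\<close> vanishes.
  Every nonempty open set of parameters \<open>c\<close> being cofinite, such a domain is dense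
  (\<open>open_dense_Cx_prod\<close>).

  To talk about these open sets and maps, a calculus of morphisms on open subsets of
  ind-varieties is set up; it rests on the universal properties of products
  (\<open>fs_morph_pair\<close>) and of coordinate spaces (\<open>fs_morph_into_coord_space\<close>).
\<close>

section \<open>Spaces with functions that behave like varieties\<close>

lemma
  assumes "space_with_functions X" "openin (ztop X) W"
  shows swf_const: "(\<lambda>_. c) \<in> reg X W"
    and swf_add: "g \<in> reg X W \<Longrightarrow> h \<in> reg X W \<Longrightarrow> (\<lambda>x. g x + h x) \<in> reg X W"
    and swf_mult: "g \<in> reg X W \<Longrightarrow> h \<in> reg X W \<Longrightarrow> (\<lambda>x. g x * h x) \<in> reg X W"
    and swf_cong: "g \<in> reg X W \<Longrightarrow> (\<And>x. x \<in> W \<Longrightarrow> h x = g x) \<Longrightarrow> h \<in> reg X W"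
    and swf_restrict: "g \<in> reg X W \<Longrightarrow> openin (ztop X) V \<Longrightarrow> V \<subseteq> W \<Longrightarrow> g \<in> reg X V"
    and swf_Union: "(\<And>V. V \<in> \<V> \<Longrightarrow> openin (ztop X) V \<and> g \<in> reg X V) \<Longrightarrow> \<Union>\<V> = W \<Longrightarrow> g \<in> reg X W"
proof -
  note * = assms(1)[unfolded space_with_functions_def, THEN spec, THEN mp, OF assms(2)]
  note 1 = *[THEN conjunct1] and 2 = *[THEN conjunct2]
  note 3 = 2[THEN conjunct1, rule_format] and 4 = 2[THEN conjunct2]
  note 5 = 4[THEN conjunct1, rule_format] and 6 = 4[THEN conjunct2]
  note 7 = 6[THEN conjunct1, rule_format] and 8 = 6[THEN conjunct2, rule_format]
  show "(\<lambda>_. c) \<in> reg X W" by (rule 1[THEN spec])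
  show "(\<lambda>x. g x + h x) \<in> reg X W" "(\<lambda>x. g x * h x) \<in> reg X W" if "g \<in> reg X W" "h \<in> reg X W"
    by (rule 3[OF that, THEN conjunct1], rule 3[OF that, THEN conjunct2])
  show "h \<in> reg X W" if "g \<in> reg X W" "\<And>x. x \<in> W \<Longrightarrow> h x = g x" by (rule 5[OF that])
  show "g \<in> reg X V" if "g \<in> reg X W" "openin (ztop X) V" "V \<subseteq> W" by (rule 7[of V g]) (use that in simp)
  show "g \<in> reg X W" if "\<And>V. V \<in> \<V> \<Longrightarrow> openin (ztop X) V \<and> g \<in> reg X V" "\<Union>\<V> = W" by (rule 8[of \<V> g]) (use that in simp)
qed

lemma swf_glue:
  assumes "space_with_functions X"
    and loc: "\<And>x. x \<in> W \<Longrightarrow> \<exists>V. openin (ztop X) V \<and> x \<in> V \<and> V \<subseteq> W \<and> g \<in> reg X V"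
  shows "g \<in> reg X W"
proof -
  define \<V> where "\<V> = {V. openin (ztop X) V \<and> V \<subseteq> W \<and> g \<in> reg X V}"
  have U: "\<Union>\<V> = W" using loc by (fastforce simp: \<V>_def)
  have "openin (ztop X) W" unfolding U[symmetric] by (rule openin_Union) (simp add: \<V>_def)
  moreover have "\<forall>V\<in>\<V>. openin (ztop X) V \<and> g \<in> reg X V" by (simp add: \<V>_def)
  ultimately show ?thesis using swf_Union[OF assms(1) _ _ U] by blast
qed

lemma swf_sum:
  assumes "space_with_functions X" "openin (ztop X) W" "\<And>i. i \<in> I \<Longrightarrow> g i \<in> reg X W"
  shows "(\<lambda>x. \<Sum>i\<in>I. g i x) \<in> reg X W"
  using assms(3)
  by (induction I rule: infinite_finite_induct) (auto intro: swf_const swf_add assms(1,2))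

lemma swf_prod:
  assumes "space_with_functions X" "openin (ztop X) W" "\<And>i. i \<in> I \<Longrightarrow> g i \<in> reg X W"
  shows "(\<lambda>x. \<Prod>i\<in>I. g i x) \<in> reg X W"
  using assms(3)
  by (induction I rule: infinite_finite_induct) (auto intro: swf_const swf_mult assms(1,2))

text \<open>
  Universal properties of products and coordinate spaces need more of the source than the sheaf
  axioms: a nowhere vanishing regular function must be invertible, and vanishing loci must be closed.
\<close>

definition zariski_space :: "'a fspace \<Rightarrow> bool" where
  "zariski_space X \<longleftrightarrow> space_with_functions X \<and>
     (\<forall>W g. openin (ztop X) W \<and> g \<in> reg X W \<longrightarrow>
        openin (ztop X) {x \<in> W. g x \<noteq> 0} \<and> (\<lambda>x. inverse (g x)) \<in> reg X {x \<in> W. g x \<noteq> 0})"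

lemma zariski_swf: "zariski_space X \<Longrightarrow> space_with_functions X"
  by (simp add: zariski_space_def)

lemma zariski_nonzero:
  "zariski_space X \<Longrightarrow> openin (ztop X) W \<Longrightarrow> g \<in> reg X W \<Longrightarrow> openin (ztop X) {x \<in> W. g x \<noteq> 0}"
  by (simp add: zariski_space_def)

lemma zariski_inverse_nonzero:
  "zariski_space X \<Longrightarrow> openin (ztop X) W \<Longrightarrow> g \<in> reg X W \<Longrightarrow> (\<lambda>x. inverse (g x)) \<in> reg X {x \<in> W. g x \<noteq> 0}"
  by (simp add: zariski_space_def)

lemma zariski_inverse:
  assumes "zariski_space X" "openin (ztop X) W" "g \<in> reg X W" "\<And>x. x \<in> W \<Longrightarrow> g x \<noteq> 0"
  shows "(\<lambda>x. inverse (g x)) \<in> reg X W"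
proof -
  have "{x \<in> W. g x \<noteq> 0} = W" using assms(4) by blast
  then show ?thesis using assms(1-3) unfolding zariski_space_def by metis
qed

lemma zariski_divide:
  assumes "zariski_space X" "openin (ztop X) W" "g \<in> reg X W" "h \<in> reg X W" "\<And>x. x \<in> W \<Longrightarrow> h x \<noteq> 0"
  shows "(\<lambda>x. g x / h x) \<in> reg X W"
  unfolding divide_inverse
  by (intro swf_mult zariski_inverse assms zariski_swf)

text \<open>
  Coordinate spaces and products have regular functions of the same kind: local quotients of
  numerators, where \<open>Num D\<close> is the set of functions admitted as numerators and denominators on the
  open set \<open>D\<close> (polynomials in the one case, tensors in the other).
\<close>

definition fraction_at ::
  "'a fspace \<Rightarrow> ('a set \<Rightarrow> ('a \<Rightarrow> complex) set) \<Rightarrow> 'a set \<Rightarrow> ('a \<Rightarrow> complex) \<Rightarrow> 'a \<Rightarrow> bool" where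
  "fraction_at X Num W g x \<longleftrightarrow> (\<exists>V D a b. openin (ztop X) V \<and> x \<in> V \<and> V \<subseteq> W \<and> V \<subseteq> D \<and>
     a \<in> Num D \<and> b \<in> Num D \<and> (\<forall>y\<in>V. b y \<noteq> 0 \<and> g y = a y / b y))"

lemma fraction_atI:
  assumes "openin (ztop X) V" "x \<in> V" "V \<subseteq> W" "V \<subseteq> D" "a \<in> Num D" "b \<in> Num D"
    "\<And>y. y \<in> V \<Longrightarrow> b y \<noteq> 0 \<and> g y = a y / b y"
  shows "fraction_at X Num W g x"
  unfolding fraction_at_def
  by (rule exI[of _ V], rule exI[of _ D], rule exI[of _ a], rule exI[of _ b]) (use assms in auto)

lemma fraction_atE:
  assumes "fraction_at X Num W g x"
  obtains V D a b where "openin (ztop X) V" "x \<in> V" "V \<subseteq> W" "V \<subseteq> D" "a \<in> Num D" "b \<in> Num D"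
    "\<forall>y\<in>V. b y \<noteq> 0 \<and> g y = a y / b y"
  using assms unfolding fraction_at_def by blast

text \<open>
  The numerators on \<open>D\<close> form a ring that contains the constants and is compatible with
  intersections, so sums, products and inverses of local quotients are again local quotients.
\<close>

lemma fraction_zariski:
  fixes X :: "'a fspace" and Num :: "'a set \<Rightarrow> ('a \<Rightarrow> complex) set"
  assumes reg: "\<And>W g. g \<in> reg X W \<longleftrightarrow> (\<forall>x\<in>W. fraction_at X Num W g x)"
    and const: "\<And>c. (\<lambda>_. c) \<in> Num (pts X)"
    and add: "\<And>D D' a a'. a \<in> Num D \<Longrightarrow> a' \<in> Num D' \<Longrightarrow> (\<lambda>x. a x + a' x) \<in> Num (D \<inter> D')"
    and mult: "\<And>D D' a a'. a \<in> Num D \<Longrightarrow> a' \<in> Num D' \<Longrightarrow> (\<lambda>x. a x * a' x) \<in> Num (D \<inter> D')"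
    and nonzero: "\<And>D a. a \<in> Num D \<Longrightarrow> openin (ztop X) {x \<in> D. a x \<noteq> 0}"
  shows "zariski_space X"
proof -
  have regD: "fraction_at X Num W g x" if "g \<in> reg X W" "x \<in> W" for W g x using that unfolding reg by blast
  have swf: "space_with_functions X"
    unfolding space_with_functions_def
  proof (intro allI impI conjI ballI)
    fix W assume W: "openin (ztop X) W"
    show "(\<lambda>_. c) \<in> reg X W" for c
      unfolding reg
    proof
      fix x assume x: "x \<in> W"
      show "fraction_at X Num W (\<lambda>_. c) x"
        by (rule fraction_atI[where Num = Num, OF W x _ openin_subset[OF W], where a = "\<lambda>_. c" and b = "\<lambda>_. 1"]) (auto simp: const)
    qed
    fix g h assume g: "g \<in> reg X W" and h: "h \<in> reg X W"
    have "fraction_at X Num W (\<lambda>x. g x + h x) x \<and> fraction_at X Num W (\<lambda>x. g x * h x) x"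
      if x: "x \<in> W" for x
    proof -
      obtain V D a b where 1: "openin (ztop X) V" "x \<in> V" "V \<subseteq> W" "V \<subseteq> D" "a \<in> Num D" "b \<in> Num D"
        "\<forall>y\<in>V. b y \<noteq> 0 \<and> g y = a y / b y" using regD[OF g x] by (rule fraction_atE)
      obtain V' D' a' b' where 2: "openin (ztop X) V'" "x \<in> V'" "V' \<subseteq> W" "V' \<subseteq> D'" "a' \<in> Num D'" "b' \<in> Num D'"
        "\<forall>y\<in>V'. b' y \<noteq> 0 \<and> h y = a' y / b' y" using regD[OF h x] by (rule fraction_atE)
      have o: "openin (ztop X) (V \<inter> V')" "x \<in> V \<inter> V'" "V \<inter> V' \<subseteq> W" "V \<inter> V' \<subseteq> D \<inter> D'" using 1 2 by auto
      have n: "(\<lambda>x. a x * b' x + b x * a' x) \<in> Num (D \<inter> D')"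
        using add[OF mult[OF 1(5) 2(6)] mult[OF 1(6) 2(5)]] by simp
      note m = mult[OF 1(5) 2(5)] mult[OF 1(6) 2(6)]
      show ?thesis
      proof
        show "fraction_at X Num W (\<lambda>x. g x + h x) x"
          by (rule fraction_atI[where Num = Num, OF o n m(2)]) (use 1(7) 2(7) in \<open>auto simp: field_simps\<close>)
        show "fraction_at X Num W (\<lambda>x. g x * h x) x"
          by (rule fraction_atI[where Num = Num, OF o m]) (use 1(7) 2(7) in auto)
      qed
    qed
    then show "(\<lambda>x. g x + h x) \<in> reg X W" "(\<lambda>x. g x * h x) \<in> reg X W" unfolding reg by blast+
  next
    fix W g h assume g: "g \<in> reg X W" and eq: "\<forall>x\<in>W. h x = g x"
    have "fraction_at X Num W h x" if x: "x \<in> W" for x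
    proof -
      obtain V D a b where 1: "openin (ztop X) V" "x \<in> V" "V \<subseteq> W" "V \<subseteq> D" "a \<in> Num D" "b \<in> Num D"
        "\<forall>y\<in>V. b y \<noteq> 0 \<and> g y = a y / b y" using regD[OF g x] by (rule fraction_atE)
      show ?thesis by (rule fraction_atI[where Num = Num, OF 1(1-6)]) (use 1(3,7) eq in auto)
    qed
    then show "h \<in> reg X W" unfolding reg by blast
  next
    fix W V g assume *: "openin (ztop X) V \<and> V \<subseteq> W \<and> g \<in> reg X W"
    have "fraction_at X Num V g x" if x: "x \<in> V" for x
    proof -
      have "fraction_at X Num W g x" using regD * x by blast
      then obtain V' D a b where 1: "openin (ztop X) V'" "x \<in> V'" "V' \<subseteq> W" "V' \<subseteq> D" "a \<in> Num D" "b \<in> Num D"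
        "\<forall>y\<in>V'. b y \<noteq> 0 \<and> g y = a y / b y" by (rule fraction_atE)
      show ?thesis by (rule fraction_atI[of X "V \<inter> V'" x V D a Num b]) (use 1 * x in auto)
    qed
    then show "g \<in> reg X V" unfolding reg by blast
  next
    fix W \<V> g assume *: "(\<forall>V\<in>\<V>. openin (ztop X) V \<and> g \<in> reg X V) \<and> \<Union>\<V> = W"
    have "fraction_at X Num W g x" if x: "x \<in> W" for x
    proof -
      obtain V where V: "V \<in> \<V>" "x \<in> V" using * x by blast
      then have "fraction_at X Num V g x" using regD * by blast
      then obtain V' D a b where 1: "openin (ztop X) V'" "x \<in> V'" "V' \<subseteq> V" "V' \<subseteq> D" "a \<in> Num D" "b \<in> Num D"
        "\<forall>y\<in>V'. b y \<noteq> 0 \<and> g y = a y / b y" by (rule fraction_atE)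
      show ?thesis by (rule fraction_atI[where Num = Num, OF 1(1,2) _ 1(4-6)]) (use 1 * V in auto)
    qed
    then show "g \<in> reg X W" unfolding reg by blast
  qed
  show ?thesis
    unfolding zariski_space_def
  proof (intro conjI allI impI swf)
    fix W g assume *: "openin (ztop X) W \<and> g \<in> reg X W"
    let ?N = "{x \<in> W. g x \<noteq> 0}"
    \<comment> \<open>Near a point where \<open>g = a / b\<close> does not vanish, both \<open>{a \<noteq> 0}\<close> and the regularity of \<open>b / a\<close> are visible.\<close>
    have ex: "(\<exists>V. openin (ztop X) V \<and> x \<in> V \<and> V \<subseteq> ?N) \<and> fraction_at X Num ?N (\<lambda>x. inverse (g x)) x"
      if x: "x \<in> ?N" for x
    proof -
      have "fraction_at X Num W g x" using regD * x by blast
      then obtain V D a b where 1: "openin (ztop X) V" "x \<in> V" "V \<subseteq> W" "V \<subseteq> D" "a \<in> Num D" "b \<in> Num D"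
        "\<forall>y\<in>V. b y \<noteq> 0 \<and> g y = a y / b y" by (rule fraction_atE)
      let ?V = "V \<inter> {x \<in> D. a x \<noteq> 0}"
      have o: "openin (ztop X) ?V" "x \<in> ?V" "?V \<subseteq> ?N" "?V \<subseteq> D" using 1 nonzero x by auto
      have "fraction_at X Num ?N (\<lambda>x. inverse (g x)) x"
        by (rule fraction_atI[where Num = Num, OF o 1(6,5)]) (use 1(7) in auto)
      then show ?thesis using o by blast
    qed
    show "openin (ztop X) ?N" by (subst openin_subopen) (use ex in blast)
    show "(\<lambda>x. inverse (g x)) \<in> reg X ?N" unfolding reg using ex by blast
  qed
qed

section \<open>Spaces given by coordinates\<close>

lemma pts_coord_space [simp]: "pts (coord_space S C) = S"
  by (simp add: coord_space_def Let_def)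

lemma openin_coord_space_nonzero:
  assumes "q \<in> polys C"
  shows "openin (ztop (coord_space S C)) {x \<in> S. q x \<noteq> 0}"
proof -
  let ?P = "\<lambda>D. \<exists>q\<in>polys C. D = {x. q x \<noteq> (0::complex)}"
  have "(finite intersection_of ?P) {x. q x \<noteq> 0}" using assms by (blast intro: finite_intersection_of_inc)
  then have "(finite intersection_of ?P relative_to S) {x \<in> S. q x \<noteq> 0}"
    unfolding relative_to_def by (intro exI[of _ "{x. q x \<noteq> 0}"]) auto
  then show ?thesis
    by (simp add: coord_space_def Let_def openin_subbase arbitrary_union_of_inc)
qed

lemma reg_coord_space:
  "g \<in> reg (coord_space S C) W \<longleftrightarrow>
     (\<forall>x\<in>W. \<exists>V. openin (ztop (coord_space S C)) V \<and> x \<in> V \<and> V \<subseteq> W \<and>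
        (\<exists>p\<in>polys C. \<exists>q\<in>polys C. \<forall>y\<in>V. q y \<noteq> 0 \<and> g y = p y / q y))"
  by (simp add: coord_space_def Let_def)

lemma zariski_coord_space: "zariski_space (coord_space S C)"
proof (rule fraction_zariski[where Num = "\<lambda>D. if D = S then polys C else {}"])
  fix W g
  let ?X = "coord_space S C" and ?Num = "\<lambda>D. if D = S then polys C else {}"
  have sub: "V \<subseteq> S" if "openin (ztop ?X) V" for V using openin_subset[OF that] by simp
  show "g \<in> reg ?X W \<longleftrightarrow> (\<forall>x\<in>W. fraction_at ?X ?Num W g x)"
    unfolding reg_coord_space
  proof (rule ball_cong[OF refl])
    fix x
    show "(\<exists>V. openin (ztop ?X) V \<and> x \<in> V \<and> V \<subseteq> W \<and>
        (\<exists>p\<in>polys C. \<exists>q\<in>polys C. \<forall>y\<in>V. q y \<noteq> 0 \<and> g y = p y / q y)) \<longleftrightarrow> fraction_at ?X ?Num W g x" (is "?L \<longleftrightarrow> ?R")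
    proof
      assume ?L
      then obtain V p q where *: "openin (ztop ?X) V" "x \<in> V" "V \<subseteq> W" "p \<in> polys C" "q \<in> polys C"
        "\<forall>y\<in>V. q y \<noteq> 0 \<and> g y = p y / q y" by blast
      show ?R by (rule fraction_atI[OF *(1-3) sub[OF *(1)], of p _ q]) (use * in auto)
    next
      assume ?R
      then show ?L by (rule fraction_atE) (auto split: if_splits)
    qed
  qed
qed (auto split: if_splits intro: polys.intros openin_coord_space_nonzero)

lemma coord_regular: "g \<in> polys C \<Longrightarrow> g \<in> reg (coord_space S C) S"
  unfolding reg_coord_space
  by (intro ballI exI[of _ S] conjI bexI[of _ g] bexI[of _ "\<lambda>_. 1"])
    (auto intro: polys.intros openin_topspace[of "ztop (coord_space S C)", simplified])

section \<open>Morphisms\<close>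

lemma fs_morph_pts: "fs_morph X Y \<phi> \<Longrightarrow> x \<in> pts X \<Longrightarrow> \<phi> x \<in> pts Y"
  by (auto simp: fs_morph_def continuous_map_def)

lemma fs_morph_open: "fs_morph X Y \<phi> \<Longrightarrow> openin (ztop Y) V \<Longrightarrow> openin (ztop X) {x \<in> pts X. \<phi> x \<in> V}"
  by (auto simp: fs_morph_def continuous_map_def)

lemma fs_morph_reg:
  "fs_morph X Y \<phi> \<Longrightarrow> openin (ztop Y) V \<Longrightarrow> g \<in> reg Y V \<Longrightarrow> (\<lambda>x. g (\<phi> x)) \<in> reg X {x \<in> pts X. \<phi> x \<in> V}"
  unfolding fs_morph_def comp_def by blast

lemma fs_morphI:
  assumes "\<And>x. x \<in> pts X \<Longrightarrow> \<phi> x \<in> pts Y"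
    and "\<And>V. openin (ztop Y) V \<Longrightarrow> openin (ztop X) {x \<in> pts X. \<phi> x \<in> V}"
    and "\<And>V g. openin (ztop Y) V \<Longrightarrow> g \<in> reg Y V \<Longrightarrow> (\<lambda>x. g (\<phi> x)) \<in> reg X {x \<in> pts X. \<phi> x \<in> V}"
  shows "fs_morph X Y \<phi>"
  using assms by (auto simp: fs_morph_def continuous_map_def comp_def)

lemma fs_morph_comp:
  assumes "fs_morph X Y \<phi>" "fs_morph Y Z \<psi>"
  shows "fs_morph X Z (\<lambda>x. \<psi> (\<phi> x))"
proof (rule fs_morphI)
  fix V assume V: "openin (ztop Z) V"
  have eq: "{x \<in> pts X. \<phi> x \<in> {y \<in> pts Y. \<psi> y \<in> V}} = {x \<in> pts X. \<psi> (\<phi> x) \<in> V}"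
    using fs_morph_pts[OF assms(1)] by auto
  show "openin (ztop X) {x \<in> pts X. \<psi> (\<phi> x) \<in> V}"
    using fs_morph_open[OF assms(1) fs_morph_open[OF assms(2) V]] unfolding eq .
  fix g assume "g \<in> reg Z V"
  then show "(\<lambda>x. g (\<psi> (\<phi> x))) \<in> reg X {x \<in> pts X. \<psi> (\<phi> x) \<in> V}"
    using fs_morph_reg[OF assms(1) fs_morph_open[OF assms(2) V] fs_morph_reg[OF assms(2) V]]
    unfolding eq by simp
qed (use assms fs_morph_pts in metis)

lemma fs_morph_id: "fs_morph X X (\<lambda>x. x)"
proof (rule fs_morphI)
  fix V g assume "openin (ztop X) V"
  moreover from openin_subset[OF this] have "{x \<in> pts X. x \<in> V} = V" by auto
  ultimately show "openin (ztop X) {x \<in> pts X. x \<in> V}" "g \<in> reg X V \<Longrightarrow> g \<in> reg X {x \<in> pts X. x \<in> V}"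
    by simp_all
qed

text \<open>
  The values of a morphism outside the points of its source are arbitrary, as HOL functions are total.
\<close>

lemma fs_morph_cong:
  assumes "space_with_functions X" "fs_morph X Y \<phi>" "\<And>x. x \<in> pts X \<Longrightarrow> \<phi> x = \<psi> x"
  shows "fs_morph X Y \<psi>"
proof (rule fs_morphI)
  fix V assume V: "openin (ztop Y) V"
  have eq: "{x \<in> pts X. \<phi> x \<in> V} = {x \<in> pts X. \<psi> x \<in> V}" using assms(3) by auto
  show *: "openin (ztop X) {x \<in> pts X. \<psi> x \<in> V}" using fs_morph_open[OF assms(2) V] unfolding eq .
  fix g assume g: "g \<in> reg Y V"
  show "(\<lambda>x. g (\<psi> x)) \<in> reg X {x \<in> pts X. \<psi> x \<in> V}"
    by (rule swf_cong[OF assms(1) * fs_morph_reg[OF assms(2) V g, unfolded eq]]) (use assms(3) in auto)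
qed (use assms fs_morph_pts in metis)

lemma fs_morph_const:
  assumes "space_with_functions X" "c \<in> pts Y"
  shows "fs_morph X Y (\<lambda>_. c)"
proof (rule fs_morphI)
  fix V g
  have "{x \<in> pts X. c \<in> V} = (if c \<in> V then pts X else {})" by auto
  then show *: "openin (ztop X) {x \<in> pts X. c \<in> V}" by simp
  then show "(\<lambda>x. g c) \<in> reg X {x \<in> pts X. c \<in> V}" by (rule swf_const[OF assms(1)])
qed (use assms in auto)

lemma polys_regular:
  assumes X: "space_with_functions X" and C: "\<And>c. c \<in> C \<Longrightarrow> (\<lambda>x. c (\<phi> x)) \<in> reg X (pts X)"
    and "q \<in> polys C"
  shows "(\<lambda>x. q (\<phi> x)) \<in> reg X (pts X)"
  using assms(3) by induction (auto intro: swf_const[OF X] swf_add[OF X] swf_mult[OF X] C)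

text \<open>
  Pulling back polynomials in the coordinates gives polynomials in regular functions.  The
  preimage of a basic open set is therefore a nonvanishing locus, and local quotients pull back to
  local quotients.
\<close>

lemma fs_morph_into_coord_space:
  assumes X: "zariski_space X" and S: "\<And>x. x \<in> pts X \<Longrightarrow> \<phi> x \<in> S"
    and C: "\<And>c. c \<in> C \<Longrightarrow> (\<lambda>x. c (\<phi> x)) \<in> reg X (pts X)"
  shows "fs_morph X (coord_space S C) \<phi>"
proof -
  note swf = zariski_swf[OF X]
  have poly: "(\<lambda>x. q (\<phi> x)) \<in> reg X (pts X)" if "q \<in> polys C" for q
    using polys_regular[OF swf C that] .
  have cont: "continuous_map (ztop X) (ztop (coord_space S C)) \<phi>"
    unfolding coord_space_def Let_def fspace.simps
    by (rule continuous_map_into_topology_subbase)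
      (use S zariski_nonzero[OF X openin_topspace poly] in auto)
  show ?thesis
  proof (rule fs_morphI)
    fix V assume V: "openin (ztop (coord_space S C)) V"
    show "openin (ztop X) {x \<in> pts X. \<phi> x \<in> V}" using cont V by (rule openin_continuous_map_preimage)
    fix g assume g: "g \<in> reg (coord_space S C) V"
    show "(\<lambda>x. g (\<phi> x)) \<in> reg X {x \<in> pts X. \<phi> x \<in> V}"
    proof (rule swf_glue[OF swf])
      fix x assume "x \<in> {x \<in> pts X. \<phi> x \<in> V}"
      then have x: "x \<in> pts X" and "\<phi> x \<in> V" by simp_all
      from g[unfolded reg_coord_space, rule_format, OF this(2)] obtain V' p q where V': "openin (ztop (coord_space S C)) V'" "\<phi> x \<in> V'" "V' \<subseteq> V"
        and pq: "p \<in> polys C" "q \<in> polys C" and y: "\<forall>y\<in>V'. q y \<noteq> 0 \<and> g y = p y / q y"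
        by blast
      let ?W = "{x \<in> pts X. \<phi> x \<in> V'}"
      have W: "openin (ztop X) ?W" using cont V'(1) by (rule openin_continuous_map_preimage)
      have "(\<lambda>x. p (\<phi> x) / q (\<phi> x)) \<in> reg X ?W"
        by (rule zariski_divide[OF X W]; (rule swf_restrict[OF swf openin_topspace poly W])?)
          (use pq y in auto)
      then have "(\<lambda>x. g (\<phi> x)) \<in> reg X ?W" by (rule swf_cong[OF swf W]) (use y in auto)
      then show "\<exists>V'. openin (ztop X) V' \<and> x \<in> V' \<and> V' \<subseteq> {x \<in> pts X. \<phi> x \<in> V} \<and> (\<lambda>x. g (\<phi> x)) \<in> reg X V'"
        using W V' x by (intro exI[of _ ?W]) auto
    qed
  qed (use S in simp)
qed

lemma pts_affine_line [simp]: "pts affine_line = UNIV"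
  by (simp add: affine_line_def)

lemma fs_morph_affine_line_iff:
  assumes X: "zariski_space X"
  shows "fs_morph X affine_line g \<longleftrightarrow> g \<in> reg X (pts X)"
proof
  assume "fs_morph X affine_line g"
  moreover have "(\<lambda>z. z) \<in> reg affine_line UNIV"
    unfolding affine_line_def by (intro coord_regular polys.coord) simp
  ultimately show "g \<in> reg X (pts X)"
    using fs_morph_reg[of X affine_line g UNIV "\<lambda>z. z"] openin_topspace[of "ztop affine_line"] by simp
next
  assume "g \<in> reg X (pts X)"
  then show "fs_morph X affine_line g"
    unfolding affine_line_def by (intro fs_morph_into_coord_space[OF X]) auto
qed

section \<open>Subspaces\<close>

lemma pts_fs_sub [simp]: "pts (fs_sub X S) = pts X \<inter> S"
  by (simp add: fs_sub_def)

lemma reg_fs_sub: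
  "g \<in> reg (fs_sub X S) V \<longleftrightarrow> (\<forall>x\<in>V. \<exists>W h. openin (ztop X) W \<and> x \<in> W \<and> h \<in> reg X W \<and> (\<forall>y\<in>W \<inter> V. g y = h y))"
  by (simp add: fs_sub_def)

lemma openin_fs_sub: "openin (ztop (fs_sub X S)) V \<longleftrightarrow> (\<exists>W. openin (ztop X) W \<and> V = W \<inter> S)"
  by (simp add: fs_sub_def openin_subtopology)

lemma openin_fs_sub_open:
  "openin (ztop X) S \<Longrightarrow> openin (ztop (fs_sub X S)) V \<longleftrightarrow> openin (ztop X) V \<and> V \<subseteq> S"
  by (simp add: fs_sub_def openin_open_subtopology)

lemma fs_sub_incl: "fs_morph (fs_sub X S) X (\<lambda>x. x)"
proof (rule fs_morphI)
  fix V assume V: "openin (ztop X) V"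
  have eq: "{x \<in> pts (fs_sub X S). x \<in> V} = V \<inter> S" using openin_subset[OF V] by auto
  show "openin (ztop (fs_sub X S)) {x \<in> pts (fs_sub X S). x \<in> V}"
    unfolding eq openin_fs_sub using V by blast
  show "g \<in> reg (fs_sub X S) {x \<in> pts (fs_sub X S). x \<in> V}" if "g \<in> reg X V" for g
    unfolding eq reg_fs_sub using V that by blast
qed auto

text \<open>
  Maps are restricted in the source by composing with these inclusions, and in the target by
  \<open>fs_morph_corestrict\<close>.
\<close>

lemma fs_sub_mono:
  assumes "T \<subseteq> S"
  shows "fs_morph (fs_sub X T) (fs_sub X S) (\<lambda>x. x)"
proof (rule fs_morphI)
  fix V assume "openin (ztop (fs_sub X S)) V"
  then obtain W where W: "openin (ztop X) W" "V = W \<inter> S" by (auto simp: openin_fs_sub)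
  have eq: "{x \<in> pts (fs_sub X T). x \<in> V} = W \<inter> T" using openin_subset[OF W(1)] W(2) assms by auto
  show "openin (ztop (fs_sub X T)) {x \<in> pts (fs_sub X T). x \<in> V}"
    unfolding eq openin_fs_sub using W by blast
  show "g \<in> reg (fs_sub X T) {x \<in> pts (fs_sub X T). x \<in> V}" if "g \<in> reg (fs_sub X S) V" for g
    using that W assms unfolding eq reg_fs_sub by blast
qed (use assms in auto)

lemma reg_fs_sub_open:
  assumes X: "space_with_functions X" and W: "openin (ztop X) W"
  shows "g \<in> reg (fs_sub X S) W \<longleftrightarrow> g \<in> reg X W"
proof
  assume "g \<in> reg X W" then show "g \<in> reg (fs_sub X S) W" unfolding reg_fs_sub using W by blast
next
  assume g: "g \<in> reg (fs_sub X S) W"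
  show "g \<in> reg X W"
  proof (rule swf_glue[OF X])
    fix x assume x: "x \<in> W"
    then obtain V h where V: "openin (ztop X) V" "x \<in> V" "h \<in> reg X V" "\<forall>y\<in>V \<inter> W. g y = h y"
      using g unfolding reg_fs_sub by blast
    have o: "openin (ztop X) (V \<inter> W)" using V(1) W by blast
    have "h \<in> reg X (V \<inter> W)" by (rule swf_restrict[OF X V(1,3) o]) blast
    then have "g \<in> reg X (V \<inter> W)" by (rule swf_cong[OF X o]) (use V in auto)
    then show "\<exists>V. openin (ztop X) V \<and> x \<in> V \<and> V \<subseteq> W \<and> g \<in> reg X V" using o x V by blast
  qed
qed

lemma swf_fs_sub:
  assumes swf: "space_with_functions X" and S: "openin (ztop X) S"
  shows "space_with_functions (fs_sub X S)"
proof -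
  note r = reg_fs_sub_open[OF swf]
  note o = openin_fs_sub_open[OF S]
  show "space_with_functions (fs_sub X S)"
    unfolding space_with_functions_def o
  proof (intro allI impI conjI ballI)
    fix W assume "openin (ztop X) W \<and> W \<subseteq> S"
    then have W: "openin (ztop X) W" by simp
    show "(\<lambda>_. c) \<in> reg (fs_sub X S) W" for c using swf_const[OF swf W] by (simp add: r W)
    fix g h assume "g \<in> reg (fs_sub X S) W" "h \<in> reg (fs_sub X S) W"
    then show "(\<lambda>x. g x + h x) \<in> reg (fs_sub X S) W" "(\<lambda>x. g x * h x) \<in> reg (fs_sub X S) W"
      using swf_add[OF swf W] swf_mult[OF swf W] by (auto simp: r W)
  next
    fix W g h assume "openin (ztop X) W \<and> W \<subseteq> S" "g \<in> reg (fs_sub X S) W" "\<forall>x\<in>W. h x = g x"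
    then show "h \<in> reg (fs_sub X S) W" using swf_cong[OF swf, of W g h] by (auto simp: r)
  next
    fix W V g assume "openin (ztop X) W \<and> W \<subseteq> S" "(openin (ztop X) V \<and> V \<subseteq> S) \<and> V \<subseteq> W \<and> g \<in> reg (fs_sub X S) W"
    then show "g \<in> reg (fs_sub X S) V" using swf_restrict[OF swf, of W g V] by (auto simp: r)
  next
    fix W \<V> g assume W: "openin (ztop X) W \<and> W \<subseteq> S"
      and *: "(\<forall>V\<in>\<V>. (openin (ztop X) V \<and> V \<subseteq> S) \<and> g \<in> reg (fs_sub X S) V) \<and> \<Union>\<V> = W"
    have "g \<in> reg X W" using * by (intro swf_Union[OF swf, of W \<V>]) (use W r in blast)+
    then show "g \<in> reg (fs_sub X S) W" using W by (simp add: r)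
  qed
qed

lemma zariski_fs_sub:
  assumes X: "zariski_space X" and S: "openin (ztop X) S"
  shows "zariski_space (fs_sub X S)"
  using zariski_nonzero[OF X] X swf_fs_sub[OF zariski_swf[OF X] S]
  unfolding zariski_space_def openin_fs_sub_open[OF S]
  by (auto simp: reg_fs_sub_open[OF zariski_swf[OF X]])

lemma fs_morph_restrict:
  "fs_morph (fs_sub X S) Y \<phi> \<Longrightarrow> T \<subseteq> S \<Longrightarrow> fs_morph (fs_sub X T) Y \<phi>"
  using fs_morph_comp[OF fs_sub_mono] by blast

lemma fs_morph_corestrict:
  assumes X: "space_with_functions X" and Y: "space_with_functions Y" and \<phi>: "fs_morph X Y \<phi>"
    and T: "openin (ztop Y) T" and im: "\<And>x. x \<in> pts X \<Longrightarrow> \<phi> x \<in> T"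
  shows "fs_morph X (fs_sub Y T) \<phi>"
proof (rule fs_morphI)
  show "\<phi> x \<in> pts (fs_sub Y T)" if "x \<in> pts X" for x using that im fs_morph_pts[OF \<phi>] by simp
  fix V assume "openin (ztop (fs_sub Y T)) V"
  then have V: "openin (ztop Y) V" by (simp add: openin_fs_sub_open[OF T])
  show "openin (ztop X) {x \<in> pts X. \<phi> x \<in> V}" using fs_morph_open[OF \<phi> V] .
  show "(\<lambda>x. g (\<phi> x)) \<in> reg X {x \<in> pts X. \<phi> x \<in> V}" if "g \<in> reg (fs_sub Y T) V" for g
    using that fs_morph_reg[OF \<phi> V] by (simp add: reg_fs_sub_open[OF Y V])
qed

section \<open>Varieties\<close>

text \<open>
  The property is transported along the inverse isomorphism.
\<close>

lemma zariski_iso: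
  assumes X: "space_with_functions X" and Y: "zariski_space Y" and iso: "fs_iso X Y \<phi>"
  shows "zariski_space X"
proof -
  obtain \<psi> where \<phi>: "fs_morph X Y \<phi>" and \<psi>: "fs_morph Y X \<psi>"
    and inv: "\<And>x. x \<in> pts X \<Longrightarrow> \<psi> (\<phi> x) = x" using iso unfolding fs_iso_def by blast
  show ?thesis
    unfolding zariski_space_def
  proof (intro conjI allI impI X)
    fix W g assume *: "openin (ztop X) W \<and> g \<in> reg X W"
    let ?W = "{y \<in> pts Y. \<psi> y \<in> W}" and ?g = "\<lambda>y. g (\<psi> y)"
    let ?N = "{y \<in> ?W. ?g y \<noteq> 0}"
    have o: "openin (ztop Y) ?W" and r: "?g \<in> reg Y ?W"
      using fs_morph_open[OF \<psi>] fs_morph_reg[OF \<psi>] * by auto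
    have N: "openin (ztop Y) ?N" and i: "(\<lambda>y. inverse (?g y)) \<in> reg Y ?N"
      using zariski_nonzero[OF Y o r] zariski_inverse_nonzero[OF Y o r] by simp_all
    have "W \<subseteq> pts X" using * openin_subset by blast
    then have eq: "{x \<in> pts X. \<phi> x \<in> ?N} = {x \<in> W. g x \<noteq> 0}"
      using inv fs_morph_pts[OF \<phi>] by auto
    show o': "openin (ztop X) {x \<in> W. g x \<noteq> 0}" using fs_morph_open[OF \<phi> N] unfolding eq .
    show "(\<lambda>x. inverse (g x)) \<in> reg X {x \<in> W. g x \<noteq> 0}"
      by (rule swf_cong[OF X o' fs_morph_reg[OF \<phi> N i, unfolded eq]]) (use inv \<open>W \<subseteq> pts X\<close> in auto)
  qed
qed

text \<open>
  Openness and regularity are local, so it suffices to know the property on an open cover; for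
  a variety this reduces it to the affine pieces.
\<close>

lemma zariski_local:
  assumes X: "space_with_functions X" and U: "\<And>U. U \<in> \<U> \<Longrightarrow> openin (ztop X) U"
    and Z: "\<And>U. U \<in> \<U> \<Longrightarrow> zariski_space (fs_sub X U)" and cov: "\<Union>\<U> = pts X"
  shows "zariski_space X"
  unfolding zariski_space_def
proof (intro conjI allI impI X)
  fix W g assume *: "openin (ztop X) W \<and> g \<in> reg X W"
  have loc: "openin (ztop X) {x \<in> W \<inter> U. g x \<noteq> 0} \<and> (\<lambda>x. inverse (g x)) \<in> reg X {x \<in> W \<inter> U. g x \<noteq> 0}"
    if "U \<in> \<U>" for U
  proof -
    have WU: "openin (ztop X) (W \<inter> U)" using * U[OF that] by blast
    have g: "g \<in> reg (fs_sub X U) (W \<inter> U)" and o: "openin (ztop (fs_sub X U)) (W \<inter> U)"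
      using swf_restrict[OF X _ _ WU] * WU by (auto simp: reg_fs_sub_open[OF X WU] openin_fs_sub_open[OF U[OF that]])
    have 1: "openin (ztop X) {x \<in> W \<inter> U. g x \<noteq> 0}"
      using zariski_nonzero[OF Z[OF that] o g] by (simp add: openin_fs_sub_open[OF U[OF that]])
    have "(\<lambda>x. inverse (g x)) \<in> reg (fs_sub X U) {x \<in> W \<inter> U. g x \<noteq> 0}"
      using zariski_inverse_nonzero[OF Z[OF that] o g] .
    then show ?thesis using 1 unfolding reg_fs_sub_open[OF X 1] by blast
  qed
  have "W \<subseteq> pts X" using * openin_subset by blast
  then have ex: "\<exists>U\<in>\<U>. x \<in> U" if "x \<in> W" for x using that cov by blast
  show "openin (ztop X) {x \<in> W. g x \<noteq> 0}"
  proof (subst openin_subopen, intro ballI)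
    fix x assume x: "x \<in> {x \<in> W. g x \<noteq> 0}"
    then obtain U where "U \<in> \<U>" "x \<in> U" using ex by blast
    then show "\<exists>T. openin (ztop X) T \<and> x \<in> T \<and> T \<subseteq> {x \<in> W. g x \<noteq> 0}"
      using loc[of U] x by (intro exI[of _ "{x \<in> W \<inter> U. g x \<noteq> 0}"]) auto
  qed
  show "(\<lambda>x. inverse (g x)) \<in> reg X {x \<in> W. g x \<noteq> 0}"
  proof (rule swf_glue[OF X])
    fix x assume x: "x \<in> {x \<in> W. g x \<noteq> 0}"
    then obtain U where "U \<in> \<U>" "x \<in> U" using ex by blast
    then show "\<exists>V. openin (ztop X) V \<and> x \<in> V \<and> V \<subseteq> {x \<in> W. g x \<noteq> 0} \<and> (\<lambda>x. inverse (g x)) \<in> reg X V"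
      using loc[of U] x by (intro exI[of _ "{x \<in> W \<inter> U. g x \<noteq> 0}"]) auto
  qed
qed

lemma zariski_variety:
  assumes "variety X"
  shows "zariski_space X"
proof -
  have X: "space_with_functions X" using assms by (simp add: variety_def)
  obtain \<U> where 1: "\<Union>\<U> = pts X" "\<forall>U\<in>\<U>. openin (ztop X) U \<and>
           (\<exists>m S \<phi>. algebraic_set m S \<and> fs_iso (fs_sub X U) (coord_space S (affine_coords m)) \<phi>)"
    using assms unfolding variety_def by blast
  show ?thesis
  proof (rule zariski_local[OF X _ _ 1(1)])
    fix U assume "U \<in> \<U>"
    then show "openin (ztop X) U" "zariski_space (fs_sub X U)"
      using 1(2) zariski_iso[OF swf_fs_sub[OF X] zariski_coord_space] by blast+
  qed
qed

section \<open>Products\<close>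

lemma ztop_fs_prod:
  "ztop (fs_prod X Y) = topology (arbitrary union_of (finite intersection_of
      (\<lambda>D. \<exists>A B. openin (ztop X) A \<and> openin (ztop Y) B \<and> (\<exists>h\<in>tensor_funs X Y A B. D = {p \<in> A \<times> B. h p \<noteq> 0}))
      relative_to (pts X \<times> pts Y)))"
  by (simp add: fs_prod_def Let_def)

lemma pts_fs_prod [simp]: "pts (fs_prod X Y) = pts X \<times> pts Y"
  by (simp add: ztop_fs_prod)

lemma openin_fs_prod_nonzero:
  assumes "openin (ztop X) A" "openin (ztop Y) B" "h \<in> tensor_funs X Y A B"
  shows "openin (ztop (fs_prod X Y)) {p \<in> A \<times> B. h p \<noteq> 0}"
proof -
  let ?P = "\<lambda>D. \<exists>A B. openin (ztop X) A \<and> openin (ztop Y) B \<and> (\<exists>h\<in>tensor_funs X Y A B. D = {p \<in> A \<times> B. h p \<noteq> 0})"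
  have "(finite intersection_of ?P) {p \<in> A \<times> B. h p \<noteq> 0}" using assms by (blast intro: finite_intersection_of_inc)
  then have "(finite intersection_of ?P relative_to (pts X \<times> pts Y)) {p \<in> A \<times> B. h p \<noteq> 0}"
    unfolding relative_to_def
    by (intro exI[of _ "{p \<in> A \<times> B. h p \<noteq> 0}"]) (use openin_subset[OF assms(1)] openin_subset[OF assms(2)] in auto)
  then show ?thesis
    by (simp add: ztop_fs_prod openin_subbase arbitrary_union_of_inc)
qed

lemma reg_fs_prod:
  "g \<in> reg (fs_prod X Y) W \<longleftrightarrow> (\<forall>p\<in>W. \<exists>A B V.
      openin (ztop X) A \<and> openin (ztop Y) B \<and> openin (ztop (fs_prod X Y)) V \<and>
      p \<in> V \<and> V \<subseteq> W \<and> V \<subseteq> A \<times> B \<and>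
      (\<exists>a\<in>tensor_funs X Y A B. \<exists>b\<in>tensor_funs X Y A B. \<forall>q\<in>V. b q \<noteq> 0 \<and> g q = a q / b q))"
  by (simp add: fs_prod_def Let_def)

lemma tensor_funsI:
  "(\<And>i. i < (k::nat) \<Longrightarrow> f i \<in> reg X A) \<Longrightarrow> (\<And>i. i < k \<Longrightarrow> g i \<in> reg Y B) \<Longrightarrow>
   h = (\<lambda>(x, y). \<Sum>i<k. f i x * g i y) \<Longrightarrow> h \<in> tensor_funs X Y A B"
  unfolding tensor_funs_def by blast

lemma tensor_pure:
  "f \<in> reg X A \<Longrightarrow> g \<in> reg Y B \<Longrightarrow> (\<lambda>p. f (fst p) * g (snd p)) \<in> tensor_funs X Y A B"
  by (rule tensor_funsI[of 1 "\<lambda>_. f" _ _ "\<lambda>_. g"]) auto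

lemma tensor_restrict:
  assumes "space_with_functions X" "space_with_functions Y" "openin (ztop X) A" "openin (ztop Y) B"
    "openin (ztop X) A'" "openin (ztop Y) B'" "A' \<subseteq> A" "B' \<subseteq> B" "h \<in> tensor_funs X Y A B"
  shows "h \<in> tensor_funs X Y A' B'"
proof -
  obtain k :: nat and f g where "\<forall>i<k. f i \<in> reg X A \<and> g i \<in> reg Y B" "h = (\<lambda>(x, y). \<Sum>i<k. f i x * g i y)"
    using assms(9) unfolding tensor_funs_def by blast
  then show ?thesis
    using assms by (intro tensor_funsI[of k f _ _ g]) (auto intro: swf_restrict)
qed

text \<open>
  Two representations are concatenated.
\<close>

lemma tensor_add:
  assumes "a \<in> tensor_funs X Y A B" "b \<in> tensor_funs X Y A B"
  shows "(\<lambda>p. a p + b p) \<in> tensor_funs X Y A B"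
proof -
  obtain k :: nat and f g where 1: "\<forall>i<k. f i \<in> reg X A \<and> g i \<in> reg Y B" "a = (\<lambda>(x, y). \<Sum>i<k. f i x * g i y)"
    using assms(1) unfolding tensor_funs_def by blast
  obtain k' :: nat and f' g' where 2: "\<forall>i<k'. f' i \<in> reg X A \<and> g' i \<in> reg Y B" "b = (\<lambda>(x, y). \<Sum>i<k'. f' i x * g' i y)"
    using assms(2) unfolding tensor_funs_def by blast
  have *: "(\<Sum>i<k + k'. h i) = (\<Sum>i<k. h i) + (\<Sum>i<k'. h (k + i))" for h :: "nat \<Rightarrow> complex"
    by (induction k') (auto simp: add.assoc)
  show ?thesis
    by (rule tensor_funsI[of "k + k'" "\<lambda>i. if i < k then f i else f' (i - k)" _ _
          "\<lambda>i. if i < k then g i else g' (i - k)"])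
      (use 1 2 in \<open>auto simp: * fun_eq_iff\<close>)
qed

lemma tensor_sum:
  assumes "space_with_functions X" "openin (ztop X) A" "space_with_functions Y" "openin (ztop Y) B"
   "\<And>i. i \<in> I \<Longrightarrow> a i \<in> tensor_funs X Y A B"
  shows "(\<lambda>p. \<Sum>i\<in>I. a i p) \<in> tensor_funs X Y A B"
proof -
  have 0: "(\<lambda>p. 0) \<in> tensor_funs X Y A B"
    using tensor_pure[OF swf_const[OF assms(1,2), of 0] swf_const[OF assms(3,4), of 0]] by simp
  show ?thesis
    using assms(5) by (induction I rule: infinite_finite_induct) (auto intro: 0 tensor_add)
qed

lemma tensor_mult:
  assumes X: "space_with_functions X" "openin (ztop X) A" and Y: "space_with_functions Y" "openin (ztop Y) B"
    and "a \<in> tensor_funs X Y A B" "b \<in> tensor_funs X Y A B"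
  shows "(\<lambda>p. a p * b p) \<in> tensor_funs X Y A B"
proof -
  obtain k :: nat and f g where 1: "\<forall>i<k. f i \<in> reg X A \<and> g i \<in> reg Y B" "a = (\<lambda>(x, y). \<Sum>i<k. f i x * g i y)"
    using assms(5) unfolding tensor_funs_def by blast
  obtain k' :: nat and f' g' where 2: "\<forall>i<k'. f' i \<in> reg X A \<and> g' i \<in> reg Y B" "b = (\<lambda>(x, y). \<Sum>i<k'. f' i x * g' i y)"
    using assms(6) unfolding tensor_funs_def by blast
  have "(\<lambda>p. a p * b p) = (\<lambda>p. \<Sum>i<k. \<Sum>j<k'. (f i (fst p) * f' j (fst p)) * (g i (snd p) * g' j (snd p)))"
    by (auto simp: 1(2) 2(2) fun_eq_iff sum_product intro!: sum.cong)
  moreover have "\<dots> \<in> tensor_funs X Y A B"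
    using 1(1) 2(1) by (intro tensor_sum[OF X Y] tensor_pure swf_mult[OF X] swf_mult[OF Y]) auto
  ultimately show ?thesis by simp
qed

lemma tensor_regular:
  assumes X: "space_with_functions X" "openin (ztop X) A" and Y: "space_with_functions Y" "openin (ztop Y) B"
    and Z: "space_with_functions Z" "openin (ztop Z) W"
    and \<phi>: "\<And>g. g \<in> reg X A \<Longrightarrow> (\<lambda>z. g (\<phi> z)) \<in> reg Z W"
    and \<psi>: "\<And>g. g \<in> reg Y B \<Longrightarrow> (\<lambda>z. g (\<psi> z)) \<in> reg Z W"
    and "a \<in> tensor_funs X Y A B"
  shows "(\<lambda>z. a (\<phi> z, \<psi> z)) \<in> reg Z W"
proof -
  obtain k :: nat and f g where 1: "\<forall>i<k. f i \<in> reg X A \<and> g i \<in> reg Y B" "a = (\<lambda>(x, y). \<Sum>i<k. f i x * g i y)"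
    using assms(9) unfolding tensor_funs_def by blast
  then have "(\<lambda>z. \<Sum>i<k. f i (\<phi> z) * g i (\<psi> z)) \<in> reg Z W"
    by (intro swf_sum swf_mult Z \<phi> \<psi>) auto
  then show ?thesis by (simp add: 1)
qed

text \<open>
  The numerators for the product structure live on open boxes only.
\<close>

definition prod_num :: "'a fspace \<Rightarrow> 'b fspace \<Rightarrow> ('a \<times> 'b) set \<Rightarrow> ('a \<times> 'b \<Rightarrow> complex) set" where
  "prod_num X Y D = {a. \<exists>A B. D = A \<times> B \<and> openin (ztop X) A \<and> openin (ztop Y) B \<and> a \<in> tensor_funs X Y A B}"

text \<open>
  A box determines its two factors unless it is empty, and the boxes that occur contain a point;
  thus numerator and denominator belong to the same pair of open sets.
\<close>

lemma zariski_fs_prod: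
  assumes X: "space_with_functions X" and Y: "space_with_functions Y"
  shows "zariski_space (fs_prod X Y)"
proof (rule fraction_zariski[where Num = "prod_num X Y"])
  fix W g
  let ?X = "fs_prod X Y"
  show "g \<in> reg ?X W \<longleftrightarrow> (\<forall>p\<in>W. fraction_at ?X (prod_num X Y) W g p)"
    unfolding reg_fs_prod
  proof (rule ball_cong[OF refl])
    fix p
    show "(\<exists>A B V. openin (ztop X) A \<and> openin (ztop Y) B \<and> openin (ztop ?X) V \<and> p \<in> V \<and> V \<subseteq> W \<and> V \<subseteq> A \<times> B \<and>
      (\<exists>a\<in>tensor_funs X Y A B. \<exists>b\<in>tensor_funs X Y A B. \<forall>q\<in>V. b q \<noteq> 0 \<and> g q = a q / b q)) \<longleftrightarrow>
      fraction_at ?X (prod_num X Y) W g p" (is "?L \<longleftrightarrow> ?R")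
    proof
      assume ?L
      then obtain A B V a b where *: "openin (ztop X) A" "openin (ztop Y) B" "openin (ztop ?X) V"
        "p \<in> V" "V \<subseteq> W" "V \<subseteq> A \<times> B" "a \<in> tensor_funs X Y A B" "b \<in> tensor_funs X Y A B"
        "\<forall>q\<in>V. b q \<noteq> 0 \<and> g q = a q / b q" by auto
      have "a \<in> prod_num X Y (A \<times> B)" "b \<in> prod_num X Y (A \<times> B)"
        unfolding prod_num_def using *(1,2,7,8) by blast+
      then show ?R by (rule fraction_atI[OF *(3-6)]) (use *(9) in auto)
    next
      assume ?R
      then obtain V D a b where *: "openin (ztop ?X) V" "p \<in> V" "V \<subseteq> W" "V \<subseteq> D"
        "a \<in> prod_num X Y D" "b \<in> prod_num X Y D" "\<forall>y\<in>V. b y \<noteq> 0 \<and> g y = a y / b y" by (rule fraction_atE)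
      obtain A B where A: "D = A \<times> B" "openin (ztop X) A" "openin (ztop Y) B" "a \<in> tensor_funs X Y A B"
        using *(5) by (auto simp: prod_num_def)
      obtain A' B' where B: "D = A' \<times> B'" "b \<in> tensor_funs X Y A' B'" using *(6) by (auto simp: prod_num_def)
      have "A \<noteq> {}" "B \<noteq> {}" using *(2,4) A(1) by auto
      then have "A = A' \<and> B = B'" using trans[OF A(1)[symmetric] B(1)] unfolding times_eq_iff by blast
      then have b: "b \<in> tensor_funs X Y A B" using B(2) by simp
      show ?L
        by (rule exI[of _ A], rule exI[of _ B], rule exI[of _ V], intro conjI A(2,3) *(1-3) *(4)[unfolded A(1)],
            rule bexI[OF _ A(4)], rule bexI[OF _ b], rule *(7))
    qed
  qed
next
  show "(\<lambda>_. c) \<in> prod_num X Y (pts (fs_prod X Y))" for c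
    using tensor_pure[OF swf_const[OF X openin_topspace, of c] swf_const[OF Y openin_topspace, of 1]]
    by (auto simp: prod_num_def)
next
  fix D D' a a'
  assume "a \<in> prod_num X Y D" "a' \<in> prod_num X Y D'"
  then obtain A B A' B' where *: "D = A \<times> B" "D' = A' \<times> B'" "openin (ztop X) A" "openin (ztop Y) B"
    "openin (ztop X) A'" "openin (ztop Y) B'" "a \<in> tensor_funs X Y A B" "a' \<in> tensor_funs X Y A' B'"
    unfolding prod_num_def by blast
  have D: "D \<inter> D' = (A \<inter> A') \<times> (B \<inter> B')" using * by auto
  have o: "openin (ztop X) (A \<inter> A')" "openin (ztop Y) (B \<inter> B')" using * by auto
  have "a \<in> tensor_funs X Y (A \<inter> A') (B \<inter> B')" "a' \<in> tensor_funs X Y (A \<inter> A') (B \<inter> B')"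
    using * o tensor_restrict[OF X Y] by (meson inf_le1 inf_le2)+
  then show "(\<lambda>x. a x + a' x) \<in> prod_num X Y (D \<inter> D')" "(\<lambda>x. a x * a' x) \<in> prod_num X Y (D \<inter> D')"
    unfolding prod_num_def using D o tensor_add tensor_mult[OF X o(1) Y o(2)] by blast+
next
  show "openin (ztop (fs_prod X Y)) {x \<in> D. a x \<noteq> 0}" if "a \<in> prod_num X Y D" for D a
    using that openin_fs_prod_nonzero unfolding prod_num_def by blast
qed

lemma fs_morph_fst:
  assumes X: "space_with_functions X" and Y: "space_with_functions Y"
  shows "fs_morph (fs_prod X Y) X fst"
proof (rule fs_morphI)
  fix V assume V: "openin (ztop X) V"
  have eq: "{p \<in> pts (fs_prod X Y). fst p \<in> V} = V \<times> pts Y" using openin_subset[OF V] by auto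
  have t: "(\<lambda>p. g (fst p)) \<in> tensor_funs X Y V (pts Y)" if "g \<in> reg X V" for g
    using tensor_pure[OF that swf_const[OF Y openin_topspace, of 1]] by simp
  from openin_fs_prod_nonzero[OF V openin_topspace t[OF swf_const[OF X V, of 1]]]
  show o: "openin (ztop (fs_prod X Y)) {p \<in> pts (fs_prod X Y). fst p \<in> V}" unfolding eq by simp
  show "(\<lambda>p. g (fst p)) \<in> reg (fs_prod X Y) {p \<in> pts (fs_prod X Y). fst p \<in> V}" if "g \<in> reg X V" for g
    unfolding reg_fs_prod
    by (intro ballI exI[of _ V] exI[of _ "pts Y"] exI[of _ "V \<times> pts Y"] conjI
        bexI[of _ "\<lambda>p. g (fst p)"] bexI[of _ "\<lambda>p. 1"] t[OF that] t[OF swf_const[OF X V, of 1]] V openin_topspace)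
      (use o eq in auto)
qed auto

lemma fs_morph_snd:
  assumes X: "space_with_functions X" and Y: "space_with_functions Y"
  shows "fs_morph (fs_prod X Y) Y snd"
proof (rule fs_morphI)
  fix V assume V: "openin (ztop Y) V"
  have eq: "{p \<in> pts (fs_prod X Y). snd p \<in> V} = pts X \<times> V" using openin_subset[OF V] by auto
  have t: "(\<lambda>p. g (snd p)) \<in> tensor_funs X Y (pts X) V" if "g \<in> reg Y V" for g
    using tensor_pure[OF swf_const[OF X openin_topspace, of 1] that] by simp
  from openin_fs_prod_nonzero[OF openin_topspace V t[OF swf_const[OF Y V, of 1]]]
  show o: "openin (ztop (fs_prod X Y)) {p \<in> pts (fs_prod X Y). snd p \<in> V}" unfolding eq by simp
  show "(\<lambda>p. g (snd p)) \<in> reg (fs_prod X Y) {p \<in> pts (fs_prod X Y). snd p \<in> V}" if "g \<in> reg Y V" for g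
    unfolding reg_fs_prod
    by (intro ballI exI[of _ V] exI[of _ "pts X"] exI[of _ "pts X \<times> V"] conjI
        bexI[of _ "\<lambda>p. g (snd p)"] bexI[of _ "\<lambda>p. 1"] t[OF that] t[OF swf_const[OF Y V, of 1]] V openin_topspace)
      (use o eq in auto)
qed auto

text \<open>
  The universal property of the product.  A tensor pulls back to a sum of products of regular
  functions; this yields continuity on the subbasis and regularity of local quotients.
\<close>

lemma fs_morph_pair:
  assumes Z: "zariski_space Z" and X: "space_with_functions X" and Y: "space_with_functions Y"
    and \<phi>: "fs_morph Z X \<phi>" and \<psi>: "fs_morph Z Y \<psi>"
  shows "fs_morph Z (fs_prod X Y) (\<lambda>z. (\<phi> z, \<psi> z))"
proof -
  note swf = zariski_swf[OF Z]
  have pre: "openin (ztop Z) {z \<in> pts Z. \<phi> z \<in> A \<and> \<psi> z \<in> B} \<and>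
     (\<lambda>z. a (\<phi> z, \<psi> z)) \<in> reg Z {z \<in> pts Z. \<phi> z \<in> A \<and> \<psi> z \<in> B}"
    if A: "openin (ztop X) A" and B: "openin (ztop Y) B" and a: "a \<in> tensor_funs X Y A B" for A B a
  proof -
    have eq: "{z \<in> pts Z. \<phi> z \<in> A \<and> \<psi> z \<in> B} = {z \<in> pts Z. \<phi> z \<in> A} \<inter> {z \<in> pts Z. \<psi> z \<in> B}" by auto
    have 1: "openin (ztop Z) {z \<in> pts Z. \<phi> z \<in> A}" and 2: "openin (ztop Z) {z \<in> pts Z. \<psi> z \<in> B}"
      using fs_morph_open[OF \<phi> A] fs_morph_open[OF \<psi> B] .
    then have o: "openin (ztop Z) {z \<in> pts Z. \<phi> z \<in> A \<and> \<psi> z \<in> B}" unfolding eq by blast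
    have "(\<lambda>z. a (\<phi> z, \<psi> z)) \<in> reg Z {z \<in> pts Z. \<phi> z \<in> A \<and> \<psi> z \<in> B}"
    proof (rule tensor_regular[OF X A Y B swf o _ _ a])
      show "(\<lambda>z. g (\<phi> z)) \<in> reg Z {z \<in> pts Z. \<phi> z \<in> A \<and> \<psi> z \<in> B}" if "g \<in> reg X A" for g
        by (rule swf_restrict[OF swf 1 fs_morph_reg[OF \<phi> A that] o]) auto
      show "(\<lambda>z. g (\<psi> z)) \<in> reg Z {z \<in> pts Z. \<phi> z \<in> A \<and> \<psi> z \<in> B}" if "g \<in> reg Y B" for g
        by (rule swf_restrict[OF swf 2 fs_morph_reg[OF \<psi> B that] o]) auto
    qed
    then show ?thesis using o by blast
  qed
  have cont: "continuous_map (ztop Z) (ztop (fs_prod X Y)) (\<lambda>z. (\<phi> z, \<psi> z))"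
    unfolding ztop_fs_prod
  proof (rule continuous_map_into_topology_subbase, goal_cases)
    case (1 x) then show ?case using fs_morph_pts[OF \<phi>] fs_morph_pts[OF \<psi>] by simp
  next
    case (2 D)
    then obtain A B h where D: "openin (ztop X) A" "openin (ztop Y) B" "h \<in> tensor_funs X Y A B"
       "D = {p \<in> A \<times> B. h p \<noteq> 0}" by blast
    have "{z \<in> pts Z. (\<phi> z, \<psi> z) \<in> D} = {z \<in> {z \<in> pts Z. \<phi> z \<in> A \<and> \<psi> z \<in> B}. h (\<phi> z, \<psi> z) \<noteq> 0}"
      by (auto simp: D)
    then show ?case
      using zariski_nonzero[OF Z pre[OF D(1-3), THEN conjunct1] pre[OF D(1-3), THEN conjunct2]] by simp
  qed
  show ?thesis
  proof (rule fs_morphI)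
    fix V assume V: "openin (ztop (fs_prod X Y)) V"
    show "openin (ztop Z) {z \<in> pts Z. (\<phi> z, \<psi> z) \<in> V}" using cont V by (rule openin_continuous_map_preimage)
    fix g assume g: "g \<in> reg (fs_prod X Y) V"
    show "(\<lambda>z. g (\<phi> z, \<psi> z)) \<in> reg Z {z \<in> pts Z. (\<phi> z, \<psi> z) \<in> V}"
    proof (rule swf_glue[OF swf])
      fix z assume z: "z \<in> {z \<in> pts Z. (\<phi> z, \<psi> z) \<in> V}"
      then have "(\<phi> z, \<psi> z) \<in> V" by simp
      from g[unfolded reg_fs_prod, rule_format, OF this] obtain A B V' a b where *: "openin (ztop X) A" "openin (ztop Y) B" "openin (ztop (fs_prod X Y)) V'"
        "(\<phi> z, \<psi> z) \<in> V'" "V' \<subseteq> V" "V' \<subseteq> A \<times> B" "a \<in> tensor_funs X Y A B" "b \<in> tensor_funs X Y A B"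
        "\<forall>q\<in>V'. b q \<noteq> 0 \<and> g q = a q / b q"
        by blast
      let ?W = "{z \<in> pts Z. (\<phi> z, \<psi> z) \<in> V'}"
      have W: "openin (ztop Z) ?W" using cont *(3) by (rule openin_continuous_map_preimage)
      have r: "(\<lambda>z. h (\<phi> z, \<psi> z)) \<in> reg Z ?W" if "h \<in> tensor_funs X Y A B" for h
        using pre[OF *(1,2) that] by (elim conjE swf_restrict[OF swf _ _ W]) (use *(6) in auto)
      have "(\<lambda>z. a (\<phi> z, \<psi> z) / b (\<phi> z, \<psi> z)) \<in> reg Z ?W"
        by (rule zariski_divide[OF Z W r[OF *(7)] r[OF *(8)]]) (use *(9) in auto)
      then have "(\<lambda>z. g (\<phi> z, \<psi> z)) \<in> reg Z ?W" by (rule swf_cong[OF swf W]) (use *(9) in auto)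
      then show "\<exists>V'. openin (ztop Z) V' \<and> z \<in> V' \<and> V' \<subseteq> {z \<in> pts Z. (\<phi> z, \<psi> z) \<in> V} \<and> (\<lambda>z. g (\<phi> z, \<psi> z)) \<in> reg Z V'"
        using W * z by (intro exI[of _ ?W]) auto
    qed
  qed (use fs_morph_pts[OF \<phi>] fs_morph_pts[OF \<psi>] in auto)
qed

section \<open>Morphisms on open subsets of ind-varieties\<close>

text \<open>
  The structure on which the calculus of morphisms rests: ind-varieties, constant families and
  their products all have it.
\<close>

definition ind_space :: "(nat \<Rightarrow> 'a fspace) \<Rightarrow> bool" where
  "ind_space X \<longleftrightarrow> (\<forall>k. zariski_space (X k) \<and> fs_morph (X k) (X (Suc k)) (\<lambda>x. x))"

lemma ind_space_zariski: "ind_space X \<Longrightarrow> zariski_space (X k)"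
  by (simp add: ind_space_def)

lemma ind_space_swf: "ind_space X \<Longrightarrow> space_with_functions (X k)"
  by (simp add: ind_space_def zariski_swf)

lemma ind_space_incl:
  assumes "ind_space X" "k \<le> m"
  shows "fs_morph (X k) (X m) (\<lambda>x. x)"
  using assms(2)
proof (induction m rule: dec_induct)
  case (step m)
  then show ?case using fs_morph_comp[of "X k" "X m" "\<lambda>x. x" "X (Suc m)" "\<lambda>x. x"] assms(1)
    by (simp add: ind_space_def)
qed (rule fs_morph_id)

lemma ind_space_pts_mono: "ind_space X \<Longrightarrow> k \<le> m \<Longrightarrow> pts (X k) \<subseteq> pts (X m)"
  by (rule subsetI) (rule fs_morph_pts[OF ind_space_incl])

lemma ind_space_const: "zariski_space Z \<Longrightarrow> ind_space (\<lambda>_. Z)"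
  by (simp add: ind_space_def fs_morph_id)

lemma ind_variety_ind_space:
  assumes "ind_variety X"
  shows "ind_space X"
  unfolding ind_space_def
proof (intro allI conjI)
  fix k
  show "zariski_space (X k)" using assms by (simp add: ind_variety_def zariski_variety)
  have "fs_morph (X k) (fs_sub (X (Suc k)) (pts (X k))) (\<lambda>x. x)"
    using assms by (auto simp: ind_variety_def fs_iso_def id_def)
  from fs_morph_comp[OF this fs_sub_incl] show "fs_morph (X k) (X (Suc k)) (\<lambda>x. x)" .
qed

lemma ind_space_prod:
  assumes X: "ind_space X" and Y: "ind_space Y"
  shows "ind_space (ind_prod X Y)"
  unfolding ind_space_def ind_prod_def
proof (intro allI conjI)
  fix k
  note sX = ind_space_swf[OF X] and sY = ind_space_swf[OF Y]
  show Z: "zariski_space (fs_prod (X k) (Y k))" by (intro zariski_fs_prod sX sY)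
  have "fs_morph (fs_prod (X k) (Y k)) (fs_prod (X (Suc k)) (Y (Suc k))) (\<lambda>p. (fst p, snd p))"
    by (rule fs_morph_pair[OF Z sX sY fs_morph_comp[OF fs_morph_fst[OF sX sY] ind_space_incl[OF X]]
          fs_morph_comp[OF fs_morph_snd[OF sX sY] ind_space_incl[OF Y]]]) simp_all
  then show "fs_morph (fs_prod (X k) (Y k)) (fs_prod (X (Suc k)) (Y (Suc k))) (\<lambda>p. p)" by simp
qed

lemma ind_pts_const [simp]: "ind_pts (\<lambda>_. Z) = pts Z"
  by (simp add: ind_pts_def)

lemma pts_ind_prod: "pts (ind_prod X Y k) = pts (X k) \<times> pts (Y k)"
  by (simp add: ind_prod_def)

lemma ind_pts_prod:
  assumes X: "ind_space X" and Y: "ind_space Y"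
  shows "ind_pts (ind_prod X Y) = ind_pts X \<times> ind_pts Y"
proof -
  have "(x, y) \<in> pts (X (max k m)) \<times> pts (Y (max k m))" if "x \<in> pts (X k)" "y \<in> pts (Y m)" for x y k m
    using that ind_space_pts_mono[OF X, of k "max k m"] ind_space_pts_mono[OF Y, of m "max k m"] by auto
  then show ?thesis by (fastforce simp: ind_pts_def pts_ind_prod)
qed

lemma open_dense_iff:
  "open_dense X W \<longleftrightarrow> openin (ind_top X) W \<and> (\<forall>V. openin (ind_top X) V \<and> V \<noteq> {} \<longrightarrow> V \<inter> W \<noteq> {})"
  unfolding open_dense_def using dense_intersects_open[of "ind_top X" W] by (auto simp: Int_commute)

text \<open>
  A morphism from the open subset \<open>U\<close> of the ind-variety \<open>Z\<close> to \<open>Y\<close>, as a total function whose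
  values outside \<open>U\<close> are irrelevant.  With total functions, composites and tuples are plain
  HOL terms, while \<open>U\<close> records where they make sense.
\<close>

definition mor_on :: "(nat \<Rightarrow> 'a fspace) \<Rightarrow> 'a set \<Rightarrow> (nat \<Rightarrow> 'b fspace) \<Rightarrow> ('a \<Rightarrow> 'b) \<Rightarrow> bool" where
  "mor_on Z U Y \<phi> \<longleftrightarrow> openin (ind_top Z) U \<and> ind_morph_on Z U Y \<phi>"

lemma rat_map_mor_on: "rat_map X Y \<phi> \<longleftrightarrow> open_dense X (dom \<phi>) \<and> mor_on X (dom \<phi>) Y (\<lambda>x. the (\<phi> x))"
  by (auto simp: rat_map_def mor_on_def open_dense_def)

lemma mor_on_open: "mor_on Z U Y \<phi> \<Longrightarrow> openin (ind_top Z) U"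
  by (simp add: mor_on_def)

lemma openin_ind_top_level: "openin (ind_top Z) U \<Longrightarrow> openin (ztop (Z k)) (U \<inter> pts (Z k))"
  by (simp add: openin_ind_top)

lemma mor_on_level: "mor_on Z U Y \<phi> \<Longrightarrow> \<exists>m. fs_morph (fs_sub (Z k) (U \<inter> pts (Z k))) (Y m) \<phi>"
  by (auto simp: mor_on_def ind_morph_on_def)

text \<open>
  A morphism into some level is also one into all higher levels, so two maps can be brought
  to a common level.
\<close>

lemma mor_on_levels:
  assumes Y: "ind_space Y" and "mor_on Z U Y \<phi>"
  shows "\<exists>m0. \<forall>m\<ge>m0. fs_morph (fs_sub (Z k) (U \<inter> pts (Z k))) (Y m) \<phi>"
  using mor_on_level[OF assms(2), of k] fs_morph_comp[OF _ ind_space_incl[OF Y]] by blast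

lemma mor_onI:
  "openin (ind_top Z) U \<Longrightarrow> (\<And>k. \<exists>m. fs_morph (fs_sub (Z k) (U \<inter> pts (Z k))) (Y m) \<phi>) \<Longrightarrow> mor_on Z U Y \<phi>"
  by (simp add: mor_on_def ind_morph_on_def)

lemma mor_on_pts:
  assumes "mor_on Z U Y \<phi>" "z \<in> U"
  shows "\<phi> z \<in> ind_pts Y"
proof -
  have "z \<in> ind_pts Z" using mor_on_open[OF assms(1)] assms(2) by (auto simp: openin_ind_top)
  then obtain k where "z \<in> pts (Z k)" by (auto simp: ind_pts_def)
  moreover obtain m where "fs_morph (fs_sub (Z k) (U \<inter> pts (Z k))) (Y m) \<phi>" using mor_on_level[OF assms(1)] by blast
  ultimately have "\<phi> z \<in> pts (Y m)" using assms(2) by (auto dest!: fs_morph_pts[of _ _ _ z])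
  then show ?thesis by (auto simp: ind_pts_def)
qed

lemma mor_on_restrict:
  assumes "mor_on Z U Y \<phi>" "openin (ind_top Z) V" "V \<subseteq> U"
  shows "mor_on Z V Y \<phi>"
proof (rule mor_onI[OF assms(2)])
  fix k
  have "V \<inter> pts (Z k) \<subseteq> U \<inter> pts (Z k)" using assms(3) by blast
  then show "\<exists>m. fs_morph (fs_sub (Z k) (V \<inter> pts (Z k))) (Y m) \<phi>"
    using mor_on_level[OF assms(1), of k] fs_morph_restrict by blast
qed

lemma zariski_level:
  "ind_space Z \<Longrightarrow> openin (ind_top Z) U \<Longrightarrow> zariski_space (fs_sub (Z k) (U \<inter> pts (Z k)))"
  by (intro zariski_fs_sub ind_space_zariski openin_ind_top_level)

lemma mor_on_cong:
  assumes Z: "ind_space Z" and "mor_on Z U Y \<phi>" and "\<And>z. z \<in> U \<Longrightarrow> \<phi> z = \<psi> z"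
  shows "mor_on Z U Y \<psi>"
proof (rule mor_onI[OF mor_on_open[OF assms(2)]])
  fix k
  obtain m where "fs_morph (fs_sub (Z k) (U \<inter> pts (Z k))) (Y m) \<phi>" using mor_on_level[OF assms(2)] by blast
  then have "fs_morph (fs_sub (Z k) (U \<inter> pts (Z k))) (Y m) \<psi>"
    by (rule fs_morph_cong[OF zariski_swf[OF zariski_level[OF Z mor_on_open[OF assms(2)]]]]) (use assms(3) in auto)
  then show "\<exists>m. fs_morph (fs_sub (Z k) (U \<inter> pts (Z k))) (Y m) \<psi>" ..
qed

lemma mor_on_preimage_level:
  assumes m: "fs_morph (fs_sub (Z k) (U \<inter> pts (Z k))) Y \<phi>" and U: "openin (ind_top Z) U" and V: "openin (ztop Y) V"
  shows "openin (ztop (Z k)) {z \<in> U \<inter> pts (Z k). \<phi> z \<in> V}"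
proof -
  have "{z \<in> pts (fs_sub (Z k) (U \<inter> pts (Z k))). \<phi> z \<in> V} = {z \<in> U \<inter> pts (Z k). \<phi> z \<in> V}" by auto
  then show ?thesis
    using fs_morph_open[OF m V] by (simp add: openin_fs_sub_open[OF openin_ind_top_level[OF U]])
qed

lemma mor_on_preimage:
  assumes "mor_on Z U Y \<phi>" "openin (ind_top Y) V"
  shows "openin (ind_top Z) {z \<in> U. \<phi> z \<in> V}"
  unfolding openin_ind_top
proof (intro conjI allI)
  note U = mor_on_open[OF assms(1)]
  show "{z \<in> U. \<phi> z \<in> V} \<subseteq> ind_pts Z" using U by (auto simp: openin_ind_top)
  fix k
  obtain m where m: "fs_morph (fs_sub (Z k) (U \<inter> pts (Z k))) (Y m) \<phi>" using mor_on_level[OF assms(1)] by blast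
  have "{z \<in> U. \<phi> z \<in> V} \<inter> pts (Z k) = {z \<in> U \<inter> pts (Z k). \<phi> z \<in> V \<inter> pts (Y m)}"
    using fs_morph_pts[OF m] by auto
  then show "openin (ztop (Z k)) ({z \<in> U. \<phi> z \<in> V} \<inter> pts (Z k))"
    using mor_on_preimage_level[OF m U openin_ind_top_level[OF assms(2)]] by simp
qed

lemma mor_on_comp:
  assumes Z: "ind_space Z" and Y: "ind_space Y"
    and \<phi>: "mor_on Z U Y \<phi>" and \<psi>: "mor_on Y V Y' \<psi>" and sub: "\<And>z. z \<in> U \<Longrightarrow> \<phi> z \<in> V"
  shows "mor_on Z U Y' (\<lambda>z. \<psi> (\<phi> z))"
proof (rule mor_onI[OF mor_on_open[OF \<phi>]])
  fix k
  note U = mor_on_open[OF \<phi>] and V = mor_on_open[OF \<psi>]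
  obtain m where m: "fs_morph (fs_sub (Z k) (U \<inter> pts (Z k))) (Y m) \<phi>" using mor_on_level[OF \<phi>] by blast
  obtain l where l: "fs_morph (fs_sub (Y m) (V \<inter> pts (Y m))) (Y' l) \<psi>" using mor_on_level[OF \<psi>] by blast
  have "fs_morph (fs_sub (Z k) (U \<inter> pts (Z k))) (fs_sub (Y m) (V \<inter> pts (Y m))) \<phi>"
    by (rule fs_morph_corestrict[OF zariski_swf[OF zariski_level[OF Z U]] ind_space_swf[OF Y] m
          openin_ind_top_level[OF V]])
      (use sub fs_morph_pts[OF m] in auto)
  from fs_morph_comp[OF this l]
  show "\<exists>m. fs_morph (fs_sub (Z k) (U \<inter> pts (Z k))) (Y' m) (\<lambda>z. \<psi> (\<phi> z))" by blast
qed

lemma mor_on_pair: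
  assumes Z: "ind_space Z" and X: "ind_space X" and Y: "ind_space Y"
    and \<phi>: "mor_on Z U X \<phi>" and \<psi>: "mor_on Z U Y \<psi>"
  shows "mor_on Z U (ind_prod X Y) (\<lambda>z. (\<phi> z, \<psi> z))"
proof (rule mor_onI[OF mor_on_open[OF \<phi>]])
  fix k
  obtain m l where m: "\<forall>i\<ge>m. fs_morph (fs_sub (Z k) (U \<inter> pts (Z k))) (X i) \<phi>"
     and l: "\<forall>i\<ge>l. fs_morph (fs_sub (Z k) (U \<inter> pts (Z k))) (Y i) \<psi>"
    using mor_on_levels[OF X \<phi>] mor_on_levels[OF Y \<psi>] by meson
  have "fs_morph (fs_sub (Z k) (U \<inter> pts (Z k))) (fs_prod (X (max m l)) (Y (max m l))) (\<lambda>z. (\<phi> z, \<psi> z))"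
    by (rule fs_morph_pair[OF zariski_level[OF Z mor_on_open[OF \<phi>]] ind_space_swf[OF X] ind_space_swf[OF Y]])
      (use m l in auto)
  then show "\<exists>m. fs_morph (fs_sub (Z k) (U \<inter> pts (Z k))) (ind_prod X Y m) (\<lambda>z. (\<phi> z, \<psi> z))"
    unfolding ind_prod_def by blast
qed

lemma mor_on_levelwise:
  assumes "openin (ind_top Z) U" "\<And>k. fs_morph (Z k) (Y k) \<phi>"
  shows "mor_on Z U Y \<phi>"
  using assms(1) fs_morph_comp[OF fs_sub_incl assms(2)] by (intro mor_onI) blast+

lemma mor_on_id: "openin (ind_top Z) U \<Longrightarrow> mor_on Z U Z (\<lambda>z. z)"
  by (rule mor_on_levelwise[OF _ fs_morph_id])

lemma mor_on_const:
  assumes Z: "ind_space Z" and "openin (ind_top Z) U" and "c \<in> ind_pts Y"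
  shows "mor_on Z U Y (\<lambda>_. c)"
proof (rule mor_onI[OF assms(2)])
  fix k
  obtain m where "c \<in> pts (Y m)" using assms(3) by (auto simp: ind_pts_def)
  then show "\<exists>m. fs_morph (fs_sub (Z k) (U \<inter> pts (Z k))) (Y m) (\<lambda>_. c)"
    by (intro exI[of _ m] fs_morph_const zariski_swf zariski_level[OF Z assms(2)])
qed

lemma mor_on_fst:
  assumes Z: "ind_space Z" and X: "ind_space X" and Y: "ind_space Y" and \<phi>: "mor_on Z U (ind_prod X Y) \<phi>"
  shows "mor_on Z U X (\<lambda>z. fst (\<phi> z))"
proof -
  have o: "openin (ind_top (ind_prod X Y)) (ind_pts (ind_prod X Y))"
    using openin_topspace[of "ind_top (ind_prod X Y)"] by simp
  have "mor_on (ind_prod X Y) (ind_pts (ind_prod X Y)) X fst"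
    by (rule mor_on_levelwise[OF o]) (simp add: ind_prod_def fs_morph_fst ind_space_swf[OF X] ind_space_swf[OF Y])
  from mor_on_comp[OF Z ind_space_prod[OF X Y] \<phi> this] show ?thesis using mor_on_pts[OF \<phi>] by blast
qed

lemma mor_on_snd:
  assumes Z: "ind_space Z" and X: "ind_space X" and Y: "ind_space Y" and \<phi>: "mor_on Z U (ind_prod X Y) \<phi>"
  shows "mor_on Z U Y (\<lambda>z. snd (\<phi> z))"
proof -
  have o: "openin (ind_top (ind_prod X Y)) (ind_pts (ind_prod X Y))"
    using openin_topspace[of "ind_top (ind_prod X Y)"] by simp
  have "mor_on (ind_prod X Y) (ind_pts (ind_prod X Y)) Y snd"
    by (rule mor_on_levelwise[OF o]) (simp add: ind_prod_def fs_morph_snd ind_space_swf[OF X] ind_space_swf[OF Y])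
  from mor_on_comp[OF Z ind_space_prod[OF X Y] \<phi> this] show ?thesis using mor_on_pts[OF \<phi>] by blast
qed

section \<open>Regular functions on ind-varieties\<close>

abbreviation regfun :: "(nat \<Rightarrow> 'a fspace) \<Rightarrow> 'a set \<Rightarrow> ('a \<Rightarrow> complex) \<Rightarrow> bool" where
  "regfun Z U g \<equiv> mor_on Z U (\<lambda>_. affine_line) g"

text \<open>
  A function to the affine line is a morphism iff it is regular on each level; the level of the
  target is no issue because the line has a constant filtration.
\<close>

lemma regfun_iff:
  assumes Z: "ind_space Z"
  shows "regfun Z U g \<longleftrightarrow> openin (ind_top Z) U \<and> (\<forall>k. g \<in> reg (Z k) (U \<inter> pts (Z k)))"
proof (cases "openin (ind_top Z) U")
  case True
  have eq: "pts (fs_sub (Z k) (U \<inter> pts (Z k))) = U \<inter> pts (Z k)" for k by auto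
  show ?thesis
    using True unfolding mor_on_def ind_morph_on_def
    by (simp add: fs_morph_affine_line_iff[OF zariski_level[OF Z True]] eq del: pts_fs_sub
        reg_fs_sub_open[OF ind_space_swf[OF Z] openin_ind_top_level[OF True]])
      (simp add: reg_fs_sub_open[OF ind_space_swf[OF Z] openin_ind_top_level[OF True]])
qed (simp add: mor_on_def)

context
  fixes Z :: "nat \<Rightarrow> 'a fspace"
  assumes Z: "ind_space Z"
begin

lemma regfun_const: "openin (ind_top Z) U \<Longrightarrow> regfun Z U (\<lambda>_. c)"
  by (simp add: regfun_iff[OF Z] swf_const[OF ind_space_swf[OF Z]] openin_ind_top_level)

lemma regfun_add: "regfun Z U g \<Longrightarrow> regfun Z U h \<Longrightarrow> regfun Z U (\<lambda>z. g z + h z)"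
  by (simp add: regfun_iff[OF Z] swf_add[OF ind_space_swf[OF Z]] openin_ind_top_level)

lemma regfun_mult: "regfun Z U g \<Longrightarrow> regfun Z U h \<Longrightarrow> regfun Z U (\<lambda>z. g z * h z)"
  by (simp add: regfun_iff[OF Z] swf_mult[OF ind_space_swf[OF Z]] openin_ind_top_level)

lemma regfun_diff: "regfun Z U g \<Longrightarrow> regfun Z U h \<Longrightarrow> regfun Z U (\<lambda>z. g z - h z)"
proof -
  assume g: "regfun Z U g" and h: "regfun Z U h"
  have "regfun Z U (\<lambda>z. g z + - 1 * h z)"
    by (intro regfun_add[OF g] regfun_mult[OF _ h] regfun_const mor_on_open[OF g])
  then show ?thesis by simp
qed

lemma regfun_divide:
  "regfun Z U g \<Longrightarrow> regfun Z U h \<Longrightarrow> (\<And>z. z \<in> U \<Longrightarrow> h z \<noteq> 0) \<Longrightarrow> regfun Z U (\<lambda>z. g z / h z)"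
  unfolding regfun_iff[OF Z]
  by (intro conjI allI zariski_divide ind_space_zariski[OF Z] openin_ind_top_level) auto

lemma regfun_sum:
  "openin (ind_top Z) U \<Longrightarrow> (\<And>i. i \<in> I \<Longrightarrow> regfun Z U (g i)) \<Longrightarrow> regfun Z U (\<lambda>z. \<Sum>i\<in>I. g i z)"
  by (simp add: regfun_iff[OF Z] swf_sum[OF ind_space_swf[OF Z]] openin_ind_top_level)

lemma regfun_prod:
  "openin (ind_top Z) U \<Longrightarrow> (\<And>i. i \<in> I \<Longrightarrow> regfun Z U (g i)) \<Longrightarrow> regfun Z U (\<lambda>z. \<Prod>i\<in>I. g i z)"
  by (simp add: regfun_iff[OF Z] swf_prod[OF ind_space_swf[OF Z]] openin_ind_top_level)

lemma regfun_nonzero: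
  assumes "regfun Z U g"
  shows "openin (ind_top Z) {z \<in> U. g z \<noteq> 0}"
  unfolding openin_ind_top
proof (intro conjI allI)
  show "{z \<in> U. g z \<noteq> 0} \<subseteq> ind_pts Z" using mor_on_open[OF assms] by (auto simp: openin_ind_top)
  fix k
  have "{z \<in> U. g z \<noteq> 0} \<inter> pts (Z k) = {z \<in> U \<inter> pts (Z k). g z \<noteq> 0}" by auto
  then show "openin (ztop (Z k)) ({z \<in> U. g z \<noteq> 0} \<inter> pts (Z k))"
    using assms zariski_nonzero[OF ind_space_zariski[OF Z] openin_ind_top_level[OF mor_on_open[OF assms]]]
    by (simp add: regfun_iff[OF Z])
qed

lemma mor_on_into_coord_space:
  assumes U: "openin (ind_top Z) U" and S: "\<And>z. z \<in> U \<Longrightarrow> \<phi> z \<in> S"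
    and C: "\<And>c. c \<in> C \<Longrightarrow> regfun Z U (\<lambda>z. c (\<phi> z))"
  shows "mor_on Z U (\<lambda>_. coord_space S C) \<phi>"
proof (rule mor_onI[OF U])
  fix k
  have eq: "pts (fs_sub (Z k) (U \<inter> pts (Z k))) = U \<inter> pts (Z k)" by auto
  have "fs_morph (fs_sub (Z k) (U \<inter> pts (Z k))) (coord_space S C) \<phi>"
    by (rule fs_morph_into_coord_space[OF zariski_level[OF Z U]])
      (use S C in \<open>auto simp: eq reg_fs_sub_open[OF ind_space_swf[OF Z] openin_ind_top_level[OF U]]
          regfun_iff[OF Z] simp del: pts_fs_sub\<close>)
  then show "\<exists>m. fs_morph (fs_sub (Z k) (U \<inter> pts (Z k))) (coord_space S C) \<phi>" ..
qed

lemma regfun_coord: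
  assumes "mor_on Z U (\<lambda>_. coord_space S C) \<phi>" "c \<in> C"
  shows "regfun Z U (\<lambda>z. c (\<phi> z))"
proof -
  have "regfun (\<lambda>_. coord_space S C) S c"
    unfolding regfun_iff[OF ind_space_const[OF zariski_coord_space]]
    using openin_topspace[of "ind_top (\<lambda>_. coord_space S C)"] coord_regular[OF polys.coord[OF assms(2)]]
    by simp
  from mor_on_comp[OF Z ind_space_const[OF zariski_coord_space] assms(1) this] mor_on_pts[OF assms(1)]
  show ?thesis by simp
qed

section \<open>Identities between rational maps\<close>

text \<open>
  The locus \<open>g \<noteq> 0\<close> is open and misses a dense set.
\<close>

lemma regfun_agree:
  assumes "regfun Z U g" "open_dense Z W" "\<And>z. z \<in> W \<Longrightarrow> z \<in> U \<Longrightarrow> g z = 0" "z \<in> U"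
  shows "g z = 0"
  using regfun_nonzero[OF assms(1)] assms(2-4) unfolding open_dense_iff by blast

text \<open>
  This is where separatedness enters: the locus where two morphisms differ is the preimage of the
  complement of the diagonal, hence open, and it misses a dense set.
\<close>

lemma mor_on_agree:
  assumes Y: "ind_variety Y" and \<phi>: "mor_on Z U Y \<phi>" and \<psi>: "mor_on Z U Y \<psi>" and W: "open_dense Z W"
    and eq: "\<And>z. z \<in> W \<Longrightarrow> z \<in> U \<Longrightarrow> \<phi> z = \<psi> z" and z: "z \<in> U"
  shows "\<phi> z = \<psi> z"
proof -
  note Yi = ind_variety_ind_space[OF Y] and U = mor_on_open[OF \<phi>]
  have "openin (ind_top Z) {z \<in> U. \<phi> z \<noteq> \<psi> z}"
    unfolding openin_ind_top
  proof (intro conjI allI)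
    show "{z \<in> U. \<phi> z \<noteq> \<psi> z} \<subseteq> ind_pts Z" using U by (auto simp: openin_ind_top)
    fix k
    obtain m where m: "fs_morph (fs_sub (Z k) (U \<inter> pts (Z k))) (ind_prod Y Y m) (\<lambda>z. (\<phi> z, \<psi> z))"
      using mor_on_level[OF mor_on_pair[OF Z Yi Yi \<phi> \<psi>]] by blast
    have "closedin (ztop (fs_prod (Y m) (Y m))) {(y, y) | y. y \<in> pts (Y m)}"
      using Y by (simp add: ind_variety_def variety_def)
    then have o: "openin (ztop (ind_prod Y Y m)) (pts (ind_prod Y Y m) - {(y, y) | y. y \<in> pts (Y m)})"
      by (simp add: ind_prod_def closedin_def)
    have "{z \<in> U. \<phi> z \<noteq> \<psi> z} \<inter> pts (Z k)
        = {z \<in> U \<inter> pts (Z k). (\<phi> z, \<psi> z) \<in> pts (ind_prod Y Y m) - {(y, y) | y. y \<in> pts (Y m)}}"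
      using fs_morph_pts[OF m] by (auto simp: pts_ind_prod)
    then show "openin (ztop (Z k)) ({z \<in> U. \<phi> z \<noteq> \<psi> z} \<inter> pts (Z k))"
      using mor_on_preimage_level[OF m U o] by simp
  qed
  then show ?thesis using W eq z unfolding open_dense_iff by blast
qed

end

lemma open_dense_Int:
  assumes V: "open_dense X V" and W: "open_dense X W"
  shows "open_dense X (V \<inter> W)"
  unfolding open_dense_iff
proof (intro conjI allI impI, goal_cases)
  case 1 then show ?case using V W by (simp add: open_dense_iff openin_Int)
next
  case (2 A)
  then have "openin (ind_top X) (A \<inter> V)" "A \<inter> V \<noteq> {}" using V by (auto simp: open_dense_iff)
  then have "A \<inter> V \<inter> W \<noteq> {}" using W unfolding open_dense_iff by blast
  then show ?case by blast
qed

lemma open_dense_superset: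
  "open_dense X V \<Longrightarrow> openin (ind_top X) W \<Longrightarrow> V \<subseteq> W \<Longrightarrow> open_dense X W"
  unfolding open_dense_iff by blast

section \<open>Density over the punctured line\<close>

lemma polys_poly: "q \<in> polys {\<lambda>z. z} \<Longrightarrow> \<exists>p :: complex poly. q = poly p"
proof (induction rule: polys.induct)
  case (const c) show ?case by (rule exI[of _ "[:c:]"]) (auto simp: fun_eq_iff)
next
  case (coord g) then show ?case by (intro exI[of _ "[:0, 1:]"]) (auto simp: fun_eq_iff)
next
  case (add g h)
  then obtain p p' where "g = poly p" "h = poly p'" by blast
  then show ?case by (intro exI[of _ "p + p'"]) (auto simp: fun_eq_iff)
next
  case (mult g h)
  then obtain p p' where "g = poly p" "h = poly p'" by blast
  then show ?case by (intro exI[of _ "p * p'"]) (auto simp: fun_eq_iff)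
qed

text \<open>
  A basic open set is given by the nonvanishing of finitely many polynomials in one variable that
  do not vanish at a common point, so each of them has finitely many roots.
\<close>

lemma Cx_open_cofinite:
  assumes "openin (ztop Cx_var) V" "V \<noteq> {}"
  shows "finite (- V)"
proof -
  let ?P = "\<lambda>D. \<exists>q\<in>polys {\<lambda>z. z}. D = {x. q x \<noteq> (0::complex)}"
  obtain z where z: "z \<in> V" using assms(2) by blast
  from assms(1) have "(arbitrary union_of (finite intersection_of ?P relative_to (UNIV - {0}))) V"
    by (simp add: Cx_var_def coord_space_def openin_subbase)
  then obtain A where A: "(finite intersection_of ?P relative_to (UNIV - {0})) A" "z \<in> A" "A \<subseteq> V"
    using z unfolding arbitrary_union_of_alt by blast
  then obtain \<D> where D: "finite \<D>" "\<D> \<subseteq> Collect ?P" "A = (UNIV - {0}) \<inter> \<Inter>\<D>"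
    unfolding relative_to_def intersection_of_def by auto
  have fin: "finite (- D)" if "D \<in> \<D>" for D
  proof -
    from D(2) that have "?P D" by (rule subsetD[THEN CollectD])
    then obtain q where q: "q \<in> polys {\<lambda>z. z}" "D = {x. q x \<noteq> 0}" by (rule bexE)
    obtain p where p: "q = poly p" using polys_poly[OF q(1)] by blast
    have "poly p z \<noteq> 0" using A(2) D(3) that q p by auto
    then have "p \<noteq> 0" by auto
    then show ?thesis using poly_roots_finite[of p] q p by (simp add: Compl_eq)
  qed
  have "- V \<subseteq> {0} \<union> (\<Union>D\<in>\<D>. - D)" using A(3) D(3) by blast
  moreover have "finite ({0} \<union> (\<Union>D\<in>\<D>. - D))" using D(1) fin by simp
  ultimately show ?thesis by (rule finite_subset)
qed

lemma ind_space_Cx: "ind_space (\<lambda>_. Cx_var)"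
  unfolding Cx_var_def by (intro ind_space_const zariski_coord_space)

lemma pts_Cx [simp]: "pts Cx_var = UNIV - {0}"
  by (simp add: Cx_var_def)

lemma openin_slice_left:
  assumes X: "ind_space X" and Y: "ind_space Y" and "openin (ind_top (ind_prod X Y)) V" "y \<in> ind_pts Y"
  shows "openin (ind_top X) {x. (x, y) \<in> V}"
proof -
  have o: "openin (ind_top X) (ind_pts X)" using openin_topspace[of "ind_top X"] by simp
  have "{x \<in> ind_pts X. (x, y) \<in> V} = {x. (x, y) \<in> V}"
    using openin_subset[OF assms(3)] by (auto simp: ind_pts_prod[OF X Y])
  then show ?thesis
    using mor_on_preimage[OF mor_on_pair[OF X X Y mor_on_id[OF o] mor_on_const[OF X o assms(4)]] assms(3)] by simp
qed

lemma openin_slice_right: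
  assumes X: "ind_space X" and Y: "ind_space Y" and "openin (ind_top (ind_prod X Y)) V" "x \<in> ind_pts X"
  shows "openin (ind_top Y) {y. (x, y) \<in> V}"
proof -
  have o: "openin (ind_top Y) (ind_pts Y)" using openin_topspace[of "ind_top Y"] by simp
  have "{y \<in> ind_pts Y. (x, y) \<in> V} = {y. (x, y) \<in> V}"
    using openin_subset[OF assms(3)] by (auto simp: ind_pts_prod[OF X Y])
  then show ?thesis
    using mor_on_preimage[OF mor_on_pair[OF Y X Y mor_on_const[OF Y o assms(4)] mor_on_id[OF o]] assms(3)] by simp
qed

text \<open>
  A nonempty open \<open>W\<close> meets the slice over some \<open>y\<close> of \<open>D\<close>: cut \<open>W\<close> at a fixed parameter and use that
  \<open>D\<close> is dense.  In the slice over \<open>y\<close> both \<open>W\<close> and \<open>V\<close> (which contains the parameter 1) are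
  cofinite, and therefore meet.
\<close>

lemma open_dense_Cx_prod:
  assumes X: "ind_space X" and V: "openin (ind_top (ind_prod (\<lambda>_. Cx_var) X)) V"
    and D: "open_dense X D" and sub: "\<And>x. x \<in> D \<Longrightarrow> (1, x) \<in> V"
  shows "open_dense (ind_prod (\<lambda>_. Cx_var) X) V"
  unfolding open_dense_iff
proof (intro conjI allI impI V, elim conjE)
  fix W assume W: "openin (ind_top (ind_prod (\<lambda>_. Cx_var) X)) W" "W \<noteq> {}"
  then obtain c x where cx: "(c, x) \<in> W" by fastforce
  then have "c \<in> ind_pts (\<lambda>_. Cx_var)"
    using openin_subset[OF W(1)] by (auto simp: ind_pts_prod[OF ind_space_Cx X])
  from openin_slice_right[OF ind_space_Cx X W(1) this] obtain y where y: "(c, y) \<in> W" "y \<in> D"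
    using D cx unfolding open_dense_iff by blast
  have yX: "y \<in> ind_pts X" using y(2) D by (auto simp: open_dense_def openin_ind_top)
  have cofin: "finite (- {c. (c, y) \<in> A})"
    if "openin (ind_top (ind_prod (\<lambda>_. Cx_var) X)) A" "{c. (c, y) \<in> A} \<noteq> {}" for A
  proof (rule Cx_open_cofinite[OF _ that(2)])
    from openin_slice_left[OF ind_space_Cx X that(1) yX]
    have *: "openin (ind_top (\<lambda>_. Cx_var)) {c. (c, y) \<in> A}" .
    then have "{c. (c, y) \<in> A} \<subseteq> pts Cx_var" using openin_subset[OF *] by simp
    then have "{c. (c, y) \<in> A} \<inter> pts Cx_var = {c. (c, y) \<in> A}" by blast
    then show "openin (ztop Cx_var) {c. (c, y) \<in> A}"
      using openin_ind_top_level[OF *] by metis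
  qed
  have "finite (- {c. (c, y) \<in> W} \<union> - {c. (c, y) \<in> V})"
    using cofin[OF W(1)] cofin[OF V] y sub by blast
  then have "- {c. (c, y) \<in> W} \<union> - {c. (c, y) \<in> V} \<noteq> (UNIV :: complex set)"
    using infinite_UNIV_char_0[where 'a = complex] by metis
  then show "W \<inter> V \<noteq> {}" by blast
qed

section \<open>Triangular matrices\<close>

lemma mult_entry:
  assumes "A \<in> carrier_mat m m" "B \<in> carrier_mat m m" "i < m" "j < m"
  shows "(A * B) $$ (i, j) = (\<Sum>k<m. A $$ (i, k) * B $$ (k, j))"
  using assms by (auto simp: scalar_prod_def lessThan_atLeast0 intro!: sum.cong)

lemma det_upper_prod:
  "upper_triangular A \<Longrightarrow> A \<in> carrier_mat m m \<Longrightarrow> det A = (\<Prod>i<m. A $$ (i, i))" for A :: "complex mat"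
  by (simp add: det_upper_triangular prod_list_diag_prod lessThan_atLeast0)

lemma det_lower_prod:
  "(\<And>i j. i < j \<Longrightarrow> j < m \<Longrightarrow> A $$ (i, j) = 0) \<Longrightarrow> A \<in> carrier_mat m m \<Longrightarrow>
   det A = (\<Prod>i<m. A $$ (i, i))" for A :: "complex mat"
  using det_lower_triangular[of m A] by (simp add: prod_list_diag_prod lessThan_atLeast0)

lemma BminusD:
  assumes "b \<in> Bminus n"
  shows "b \<in> carrier_mat (n + 1) (n + 1)" "det b = 1"
    and "\<And>i j. i < j \<Longrightarrow> j < n + 1 \<Longrightarrow> b $$ (i, j) = 0"
    and "\<And>i. i < n + 1 \<Longrightarrow> b $$ (i, i) \<noteq> 0"
proof -
  show c: "b \<in> carrier_mat (n + 1) (n + 1)" and d: "det b = 1" using assms by (auto simp: Bminus_def SL_def)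
  show z: "b $$ (i, j) = 0" if "i < j" "j < n + 1" for i j
    using assms that by (auto simp: Bminus_def)
  have "(\<Prod>i<n + 1. b $$ (i, i)) = 1" using det_lower_prod[OF z c] d by simp
  then show "b $$ (i, i) \<noteq> 0" if "i < n + 1" for i
    using that by (metis finite_lessThan lessThan_iff prod_zero zero_neq_one)
qed

lemma UplusD:
  assumes "u \<in> Uplus n"
  shows "u \<in> carrier_mat (n + 1) (n + 1)" "det u = 1"
    and "\<And>i j. j < i \<Longrightarrow> i < n + 1 \<Longrightarrow> u $$ (i, j) = 0"
    and "\<And>i. i < n + 1 \<Longrightarrow> u $$ (i, i) = 1"
proof -
  show "u \<in> carrier_mat (n + 1) (n + 1)" "det u = 1" using assms by (auto simp: Uplus_def SL_def)
  then show "u $$ (i, j) = 0" if "j < i" "i < n + 1" for i j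
    using assms that by (auto simp: Uplus_def)
  show "u $$ (i, i) = 1" if "i < n + 1" for i using assms that by (auto simp: Uplus_def)
qed

lemma UplusI:
  assumes c: "u \<in> carrier_mat (n + 1) (n + 1)" and z: "\<And>i j. j < i \<Longrightarrow> i < n + 1 \<Longrightarrow> u $$ (i, j) = 0"
    and 1: "\<And>i. i < n + 1 \<Longrightarrow> u $$ (i, i) = 1"
  shows "u \<in> Uplus n"
proof -
  have t: "upper_triangular u" using c z by auto
  have "det u = 1" using det_upper_prod[OF t c] 1 by simp
  then show ?thesis using t c 1 by (auto simp: Uplus_def SL_def)
qed

lemma one_Uplus: "1\<^sub>m (n + 1) \<in> Uplus n"
  by (rule UplusI) auto

lemma mult_Uplus:
  assumes u: "u \<in> Uplus n" and v: "v \<in> Uplus n"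
  shows "u * v \<in> Uplus n"
proof (rule UplusI)
  note c = UplusD(1)[OF u] UplusD(1)[OF v]
  show "u * v \<in> carrier_mat (n + 1) (n + 1)" using c by simp
  show "(u * v) $$ (i, j) = 0" if "j < i" "i < n + 1" for i j
  proof -
    have "u $$ (i, k) * v $$ (k, j) = 0" if "k < n + 1" for k
      using UplusD(3)[OF u, of k i] UplusD(3)[OF v, of j k] that \<open>j < i\<close> \<open>i < n + 1\<close> by (cases "k < i") auto
    then show ?thesis using that by (simp add: mult_entry[OF c] sum.neutral del: sum.lessThan_Suc)
  qed
  show "(u * v) $$ (i, i) = 1" if i: "i < n + 1" for i
  proof -
    have "u $$ (i, k) * v $$ (k, i) = (if k = i then 1 else 0)" if "k < n + 1" for k
      using UplusD(3)[OF u, of k i] UplusD(3)[OF v, of i k] UplusD(4)[OF u, of i] UplusD(4)[OF v, of i] that i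
      by (cases k i rule: linorder_cases) auto
    then have "(\<Sum>k<n + 1. u $$ (i, k) * v $$ (k, i)) = (\<Sum>k<n + 1. if k = i then 1 else 0)"
      by (intro sum.cong) auto
    also have "\<dots> = 1" using i by (simp del: sum.lessThan_Suc)
    finally show ?thesis using i by (simp add: mult_entry[OF c] del: sum.lessThan_Suc)
  qed
qed

text \<open>
  Uniqueness of the triangular factorization: column \<open>m\<close> of the lower and row \<open>m\<close> of the
  upper factor are determined by the earlier ones, as the diagonal of the lower factor does not vanish.
\<close>

lemma Bminus_Uplus_unique:
  assumes b: "b \<in> Bminus n" "b' \<in> Bminus n" and u: "u \<in> Uplus n" "u' \<in> Uplus n" and eq: "b * u = b' * u'"
  shows "b = b'"
proof -
  note cb = BminusD(1)[OF b(1)] BminusD(1)[OF b(2)] and cu = UplusD(1)[OF u(1)] UplusD(1)[OF u(2)]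
  have prod: "(\<Sum>k<n + 1. b $$ (i, k) * u $$ (k, j)) = (\<Sum>k<n + 1. b' $$ (i, k) * u' $$ (k, j))"
    if "i < n + 1" "j < n + 1" for i j
    using mult_entry[OF cb(1) cu(1) that] mult_entry[OF cb(2) cu(2) that] eq by simp
  have cut: "(\<Sum>k<n + 1. g k) = (\<Sum>k<m. g k) + g m"
    if "m < n + 1" "\<And>k. m < k \<Longrightarrow> k < n + 1 \<Longrightarrow> g k = 0" for g :: "nat \<Rightarrow> complex" and m
  proof -
    have "(\<Sum>k<n + 1. g k) = (\<Sum>k<Suc m. g k)"
      using that by (intro sum.mono_neutral_right) auto
    then show ?thesis by simp
  qed
  have "(\<forall>i<n + 1. b $$ (i, m) = b' $$ (i, m)) \<and> (\<forall>j<n + 1. u $$ (m, j) = u' $$ (m, j))" if "m < n + 1" for m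
    using that
  proof (induction m rule: less_induct)
    case (less m)
    have col: "b $$ (i, m) = b' $$ (i, m)" if i: "i < n + 1" for i
    proof -
      have "(\<Sum>k<m. b $$ (i, k) * u $$ (k, m)) + b $$ (i, m) = (\<Sum>k<m. b' $$ (i, k) * u' $$ (k, m)) + b' $$ (i, m)"
        using prod[OF i less.prems] UplusD(4)[OF u(1) less.prems] UplusD(4)[OF u(2) less.prems]
          cut[OF less.prems, of "\<lambda>k. b $$ (i, k) * u $$ (k, m)"] cut[OF less.prems, of "\<lambda>k. b' $$ (i, k) * u' $$ (k, m)"]
          UplusD(3)[OF u(1), of m] UplusD(3)[OF u(2), of m]
        by (simp del: sum.lessThan_Suc)
      moreover have "(\<Sum>k<m. b $$ (i, k) * u $$ (k, m)) = (\<Sum>k<m. b' $$ (i, k) * u' $$ (k, m))"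
        using less i by (intro sum.cong) auto
      ultimately show ?thesis by simp
    qed
    have "u $$ (m, j) = u' $$ (m, j)" if j: "j < n + 1" for j
    proof -
      have "(\<Sum>k<m. b $$ (m, k) * u $$ (k, j)) + b $$ (m, m) * u $$ (m, j)
          = (\<Sum>k<m. b' $$ (m, k) * u' $$ (k, j)) + b' $$ (m, m) * u' $$ (m, j)"
        using prod[OF less.prems j] 
          cut[OF less.prems, of "\<lambda>k. b $$ (m, k) * u $$ (k, j)"] cut[OF less.prems, of "\<lambda>k. b' $$ (m, k) * u' $$ (k, j)"]
          BminusD(3)[OF b(1), of m] BminusD(3)[OF b(2), of m]
        by (simp del: sum.lessThan_Suc)
      moreover have "(\<Sum>k<m. b $$ (m, k) * u $$ (k, j)) = (\<Sum>k<m. b' $$ (m, k) * u' $$ (k, j))"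
        using less j by (intro sum.cong) auto
      ultimately show ?thesis using col[OF less.prems] BminusD(4)[OF b(2) less.prems] by simp
    qed
    then show ?case using col by blast
  qed
  then show ?thesis using cb by (intro eq_matI) auto
qed

lemma pi_minus_SomeD:
  assumes "pi_minus n g = Some b"
  shows "b \<in> Bminus n \<and> (\<exists>u\<in>Uplus n. g = b * u)"
proof -
  have ex: "\<exists>b\<in>Bminus n. \<exists>u\<in>Uplus n. g = b * u"
    using assms unfolding pi_minus_def by (metis option.distinct(1))
  then have "\<exists>!b. b \<in> Bminus n \<and> (\<exists>u\<in>Uplus n. g = b * u)" using Bminus_Uplus_unique by blast
  from theI'[OF this] show ?thesis using assms ex unfolding pi_minus_def by (simp split: if_splits)
qed

section \<open>The unipotent and diagonal parts\<close>

lemma Tdiag_entry: "t \<in> Tdiag n \<Longrightarrow> i < n + 1 \<Longrightarrow> j < n + 1 \<Longrightarrow> i \<noteq> j \<Longrightarrow> t $$ (i, j) = 0"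
  by (auto simp: Tdiag_def SL_def diagonal_mat_def)

text \<open>
  The diagonal of \<open>l\<close> is 1, so \<open>t\<close> is the diagonal of \<open>b\<close> and \<open>l\<close> is \<open>b\<close> with normalized columns.
\<close>

lemma minus_zero_unique:
  assumes b: "b \<in> Bminus n" and l: "l \<in> Uminus n" and t: "t \<in> Tdiag n" and eq: "b = l * t"
  shows "t = mat (n + 1) (n + 1) (\<lambda>(i, j). if i = j then b $$ (i, i) else 0)"
    and "l = mat (n + 1) (n + 1) (\<lambda>(i, j). b $$ (i, j) / b $$ (j, j))"
proof -
  have cl: "l \<in> carrier_mat (n + 1) (n + 1)" and ct: "t \<in> carrier_mat (n + 1) (n + 1)"
    using l t by (auto simp: Uminus_def Bminus_def Tdiag_def SL_def)
  have e: "b $$ (i, j) = l $$ (i, j) * t $$ (j, j)" if ij: "i < n + 1" "j < n + 1" for i j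
  proof -
    have "(\<Sum>k<n + 1. l $$ (i, k) * t $$ (k, j)) = (\<Sum>k<n + 1. if k = j then l $$ (i, j) * t $$ (j, j) else 0)"
      using Tdiag_entry[OF t _ ij(2)] by (intro sum.cong) auto
    then show ?thesis using ij unfolding eq by (simp add: mult_entry[OF cl ct] del: sum.lessThan_Suc)
  qed
  have d: "t $$ (i, i) = b $$ (i, i)" if "i < n + 1" for i
    using e[OF that that] l that by (simp add: Uminus_def)
  show "t = mat (n + 1) (n + 1) (\<lambda>(i, j). if i = j then b $$ (i, i) else 0)"
    using ct d Tdiag_entry[OF t] by (intro eq_matI) auto
  show "l = mat (n + 1) (n + 1) (\<lambda>(i, j). b $$ (i, j) / b $$ (j, j))"
  proof (rule eq_matI)
    fix i j assume "i < dim_row (mat (n + 1) (n + 1) (\<lambda>(i, j). b $$ (i, j) / b $$ (j, j)))"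
      "j < dim_col (mat (n + 1) (n + 1) (\<lambda>(i, j). b $$ (i, j) / b $$ (j, j)))"
    then have ij: "i < n + 1" "j < n + 1" by simp_all
    then show "l $$ (i, j) = mat (n + 1) (n + 1) (\<lambda>(i, j). b $$ (i, j) / b $$ (j, j)) $$ (i, j)"
      using e[OF ij] d[OF ij(2)] BminusD(4)[OF b ij(2)] by simp
  qed (use cl in auto)
qed

lemma minus_zero_exists:
  assumes b: "b \<in> Bminus n"
  shows "\<exists>l\<in>Uminus n. \<exists>t\<in>Tdiag n. b = l * t"
proof -
  let ?t = "mat (n + 1) (n + 1) (\<lambda>(i, j). if i = j then b $$ (i, i) else 0)"
  let ?l = "mat (n + 1) (n + 1) (\<lambda>(i, j). b $$ (i, j) / b $$ (j, j))"
  have ct: "?t \<in> carrier_mat (n + 1) (n + 1)" and cl: "?l \<in> carrier_mat (n + 1) (n + 1)" by auto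
  have "det b = (\<Prod>i<n + 1. b $$ (i, i))" using det_lower_prod[OF BminusD(3)[OF b] BminusD(1)[OF b]] .
  moreover have "det ?t = (\<Prod>i<n + 1. ?t $$ (i, i))" by (rule det_lower_prod[OF _ ct]) auto
  ultimately have dt: "det ?t = 1" using BminusD(2)[OF b] by (simp del: prod.lessThan_Suc)
  have "det ?l = (\<Prod>i<n + 1. ?l $$ (i, i))" by (rule det_lower_prod[OF _ cl]) (auto simp: BminusD[OF b])
  also have "\<dots> = 1" by (rule prod.neutral) (auto simp: BminusD(4)[OF b])
  finally have dl: "det ?l = 1" .
  have "?l \<in> Uminus n" using dl cl BminusD[OF b] by (auto simp: Uminus_def Bminus_def SL_def)
  moreover have "?t \<in> Tdiag n" using dt ct by (auto simp: Tdiag_def SL_def diagonal_mat_def)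
  moreover have "b = ?l * ?t"
  proof (rule eq_matI)
    fix i j assume "i < dim_row (?l * ?t)" "j < dim_col (?l * ?t)"
    then have ij: "i < n + 1" "j < n + 1" by auto
    have "(\<Sum>k<n + 1. ?l $$ (i, k) * ?t $$ (k, j)) = (\<Sum>k<n + 1. if k = j then b $$ (i, j) else 0)"
      using ij BminusD(4)[OF b] by (intro sum.cong) auto
    also have "\<dots> = b $$ (i, j)" using ij by (simp del: sum.lessThan_Suc)
    finally show "b $$ (i, j) = (?l * ?t) $$ (i, j)" unfolding mult_entry[OF cl ct ij] by (rule sym)
  qed (use BminusD(1)[OF b] in auto)
  ultimately show ?thesis by blast
qed

lemma minus_part_eq:
  assumes b: "b \<in> Bminus n"
  shows "minus_part n b = mat (n + 1) (n + 1) (\<lambda>(i, j). b $$ (i, j) / b $$ (j, j))"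
proof -
  obtain l t where lt: "l \<in> Uminus n" "t \<in> Tdiag n" "b = l * t" using minus_zero_exists[OF b] by blast
  have "\<exists>!l. l \<in> Uminus n \<and> (\<exists>t\<in>Tdiag n. b = l * t)"
    using lt minus_zero_unique(2)[OF b] by blast
  from theI'[OF this] show ?thesis unfolding minus_part_def using minus_zero_unique(2)[OF b] by blast
qed

lemma zero_part_eq:
  assumes b: "b \<in> Bminus n"
  shows "zero_part n b = mat (n + 1) (n + 1) (\<lambda>(i, j). if i = j then b $$ (i, i) else 0)"
proof -
  obtain l t where lt: "l \<in> Uminus n" "t \<in> Tdiag n" "b = l * t" using minus_zero_exists[OF b] by blast
  have "\<exists>!t. t \<in> Tdiag n \<and> (\<exists>l\<in>Uminus n. b = l * t)"
    using lt minus_zero_unique(1)[OF b] by blast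
  from theI'[OF this] show ?thesis unfolding zero_part_def using minus_zero_unique(1)[OF b] by blast
qed

text \<open>
  The entry of \<open>b\<^sub>-\<close> in row \<open>r\<close> and column \<open>s\<close>, with rows and columns counted from 0.
\<close>

definition lcoef :: "complex mat \<Rightarrow> nat \<Rightarrow> nat \<Rightarrow> complex" where
  "lcoef b r s = b $$ (r, s) / b $$ (s, s)"

lemma epsilon_B_eq: "b \<in> Bminus n \<Longrightarrow> i \<in> {1..n} \<Longrightarrow> epsilon_B n i b = lcoef b i (i - 1)"
  by (auto simp: epsilon_B_def ent_def minus_part_eq lcoef_def)

lemma epsilon_B_int_eq:
  "b \<in> Bminus n \<Longrightarrow> 1 \<le> s \<Longrightarrow> s \<le> t \<Longrightarrow> t \<le> n \<Longrightarrow> epsilon_B_int n {s..t} b = lcoef b t (s - 1)"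
proof -
  assume b: "b \<in> Bminus n" and st: "1 \<le> s" "s \<le> t" "t \<le> n"
  have "Max {s..t} = t" "Min {s..t} = s" using st by (auto intro: Max_eqI Min_eqI)
  then show ?thesis using st by (auto simp: epsilon_B_int_def ent_def minus_part_eq[OF b] lcoef_def)
qed

lemma gamma_B_eq: "b \<in> Bminus n \<Longrightarrow> i \<in> {1..n} \<Longrightarrow> gamma_B n i b = b $$ (i - 1, i - 1) / b $$ (i, i)"
  by (auto simp: gamma_B_def ent_def zero_part_eq)

section \<open>The one-parameter subgroups of simple roots\<close>

lemma xgen_carrier [simp]: "xgen n i z \<in> carrier_mat (n + 1) (n + 1)"
  by (simp add: xgen_def)

text \<open>
  The simplifier writes \<open>n + 1\<close> as a successor.
\<close>

lemma xgen_carrier_Suc [simp]: "xgen n i z \<in> carrier_mat (Suc n) (Suc n)"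
  using xgen_carrier[of n i z] by simp

lemma xgen_dim [simp]: "dim_row (xgen n i z) = n + 1" "dim_col (xgen n i z) = n + 1"
  by (simp_all add: xgen_def)

lemma xgen_entry:
  "r < n + 1 \<Longrightarrow> s < n + 1 \<Longrightarrow>
   xgen n i z $$ (r, s) = (if r = s then 1 else 0) + (if r = i - 1 \<and> s = i then z else 0)"
  by (auto simp: xgen_def)

lemma xgen_Uplus: "i \<in> {1..n} \<Longrightarrow> xgen n i z \<in> Uplus n"
  by (rule UplusI) (auto simp: xgen_entry)

lemma xgen_zero [simp]: "xgen n i 0 = 1\<^sub>m (n + 1)"
  by (rule eq_matI) (auto simp: xgen_def)

lemma xgen_mult_left:
  assumes i: "i \<in> {1..n}" and A: "A \<in> carrier_mat (n + 1) (n + 1)" and rs: "r < n + 1" "s < n + 1"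
  shows "(xgen n i z * A) $$ (r, s) = A $$ (r, s) + (if r = i - 1 then z * A $$ (i, s) else 0)"
proof -
  have "(\<Sum>k<n + 1. xgen n i z $$ (r, k) * A $$ (k, s))
     = (\<Sum>k<n + 1. (if k = r then A $$ (r, s) else 0) + (if k = i then if r = i - 1 then z * A $$ (i, s) else 0 else 0))"
    using rs i by (intro sum.cong) (auto simp: xgen_entry algebra_simps)
  also have "\<dots> = A $$ (r, s) + (if r = i - 1 then z * A $$ (i, s) else 0)"
    unfolding sum.distrib using rs i by (auto simp del: sum.lessThan_Suc)
  finally show ?thesis using mult_entry[OF xgen_carrier A rs] by simp
qed

lemma xgen_mult_right:
  assumes i: "i \<in> {1..n}" and A: "A \<in> carrier_mat (n + 1) (n + 1)" and rs: "r < n + 1" "s < n + 1"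
  shows "(A * xgen n i z) $$ (r, s) = A $$ (r, s) + (if s = i then z * A $$ (r, i - 1) else 0)"
proof -
  have "(\<Sum>k<n + 1. A $$ (r, k) * xgen n i z $$ (k, s))
     = (\<Sum>k<n + 1. (if k = s then A $$ (r, s) else 0) + (if k = i - 1 then if s = i then z * A $$ (r, i - 1) else 0 else 0))"
    using rs i by (intro sum.cong) (auto simp: xgen_entry algebra_simps)
  also have "\<dots> = A $$ (r, s) + (if s = i then z * A $$ (r, i - 1) else 0)"
    unfolding sum.distrib using rs i by (auto simp del: sum.lessThan_Suc)
  finally show ?thesis using mult_entry[OF A xgen_carrier rs] by simp
qed

lemma xgen_mult_xgen:
  assumes "i \<in> {1..n}"
  shows "xgen n i z * xgen n i w = xgen n i (z + w)"
  using assms by (intro eq_matI) (auto simp: xgen_mult_left xgen_entry simp del: index_mult_mat(1))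

lemma xgen_commute:
  assumes "i \<in> {1..n}" "j \<in> {1..n}" "cartan_A i j = 0"
  shows "xgen n i z * xgen n j w = xgen n j w * xgen n i z"
  using assms by (intro eq_matI)
    (auto simp: xgen_mult_left xgen_entry cartan_A_def split: if_splits simp del: index_mult_mat(1))

text \<open>
  Both sides are the identity plus \<open>p + r\<close>, \<open>q\<close> and \<open>p q\<close> at the three positions above the
  diagonal in rows \<open>i\<close> to \<open>i + 2\<close>.
\<close>

lemma xgen_braid:
  assumes i: "i \<in> {1..n}" "i + 1 \<in> {1..n}" and eq: "p + r = w2" "q = w1 + w3" "p * q = w2 * w1"
  shows "xgen n i p * (xgen n (i + 1) q * xgen n i r) = xgen n (i + 1) w3 * (xgen n i w2 * xgen n (i + 1) w1)"
proof (rule eq_matI)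
  fix k l assume "k < dim_row (xgen n (i + 1) w3 * (xgen n i w2 * xgen n (i + 1) w1))"
    "l < dim_col (xgen n (i + 1) w3 * (xgen n i w2 * xgen n (i + 1) w1))"
  then have kl: "k < n + 1" "l < n + 1" by auto
  have c: "xgen n (i + 1) q * xgen n i r \<in> carrier_mat (n + 1) (n + 1)"
    "xgen n i w2 * xgen n (i + 1) w1 \<in> carrier_mat (n + 1) (n + 1)" by (auto intro: mult_carrier_mat xgen_carrier)
  show "(xgen n i p * (xgen n (i + 1) q * xgen n i r)) $$ (k, l) = (xgen n (i + 1) w3 * (xgen n i w2 * xgen n (i + 1) w1)) $$ (k, l)"
    unfolding xgen_mult_left[OF i(1) c(1) kl] xgen_mult_left[OF i(2) c(2) kl]
    using i kl eq
    by (simp add: xgen_mult_left xgen_entry del: index_mult_mat(1)) (auto simp: algebra_simps)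
qed auto

text \<open>
  Here \<open>a\<close>, \<open>d\<close>, \<open>m\<close> are the entries \<open>b\<^sub>2\<^sub>1\<close>, \<open>b\<^sub>3\<^sub>2\<close>, \<open>b\<^sub>3\<^sub>1\<close> of a lower unitriangular matrix of
  size 3, and \<open>d1\<close>, \<open>a2\<close> (for \<open>e\<^sub>1\<^sup>c e\<^sub>2\<^sup>c\<^sup>e e\<^sub>1\<^sup>e\<close>) and \<open>a1\<close>, \<open>d2\<close> (for \<open>e\<^sub>2\<^sup>e e\<^sub>1\<^sup>c\<^sup>e e\<^sub>2\<^sup>c\<close>) are the values of \<open>\<epsilon>\<^sub>1\<close>, \<open>\<epsilon>\<^sub>2\<close> met on
  the way.  The three equations are the hypotheses of \<open>xgen_braid\<close>.
\<close>

lemma braid_parameters: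
  fixes a d m c e :: complex
  assumes nz: "a \<noteq> 0" "d \<noteq> 0" "c \<noteq> 0" "e \<noteq> 0"
    and d1: "d1 = e * d - (e - 1) * m / a" "d1 \<noteq> 0"
    and a2: "a2 = a / e + (c * e - 1) * (m / e) / d1" "a2 \<noteq> 0"
    and a1: "a1 = a + (c - 1) * m / d" "a1 \<noteq> 0"
    and d2: "d2 = c * e * (d / c) - (c * e - 1) * m / a1" "d2 \<noteq> 0"
  shows "(c - 1) / a2 + (e - 1) / a = (c * e - 1) / a1"
    and "(c * e - 1) / d1 = (c - 1) / d + (e - 1) / d2"
    and "(c - 1) / a2 * ((c * e - 1) / d1) = (c * e - 1) / a1 * ((c - 1) / d)"
proof -
  \<comment> \<open>The common value of \<open>a2 * d1\<close> and \<open>a1 * d\<close>, in which all fractions can be expressed.\<close>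
  define K where "K = a * d + (c - 1) * m"
  have ad1: "a * d1 = e * (a * d) - (e - 1) * m" using nz by (simp add: d1 field_simps)
  have 1: "a1 * d = K" using nz by (simp add: a1 K_def field_simps)
  have "e * (a2 * d1) = a * d1 + (c * e - 1) * m" using nz d1(2) by (simp add: a2 field_simps)
  also have "\<dots> = e * K" unfolding ad1 K_def by (simp add: algebra_simps)
  finally have 2: "a2 * d1 = K" using nz by simp
  have K: "K \<noteq> 0" using 1 a1(2) nz by auto
  have 3: "a1 = K / d" "a2 = K / d1" using 1 2 nz d1(2) by (auto simp: field_simps)
  have "d2 * K = e * d * K - (c * e - 1) * m * d" using nz K by (simp add: d2 3 field_simps)
  also have "\<dots> = d * (a * d1)" unfolding ad1 K_def by (simp add: algebra_simps)
  finally have 4: "d2 = d * (a * d1) / K" using K by (simp add: field_simps)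
  \<comment> \<open>The numerator that the first two equations share.\<close>
  have key: "(c - 1) * (a * d1) + (e - 1) * K = (c * e - 1) * (a * d)"
    unfolding ad1 K_def by (simp add: algebra_simps)
  have "(c - 1) / a2 + (e - 1) / a = ((c - 1) * (a * d1) + (e - 1) * K) / (a * K)"
    unfolding 3 using nz K by (simp add: field_simps)
  also have "\<dots> = (c * e - 1) / a1" unfolding key 3 using nz by simp
  finally show "(c - 1) / a2 + (e - 1) / a = (c * e - 1) / a1" .
  have "(c - 1) / d + (e - 1) / d2 = ((c - 1) * (a * d1) + (e - 1) * K) / (d * (a * d1))"
    unfolding 4 using nz K d1(2) by (simp add: field_simps)
  also have "\<dots> = (c * e - 1) / d1" unfolding key using nz by simp
  finally show "(c * e - 1) / d1 = (c - 1) / d + (e - 1) / d2" by simp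
  show "(c - 1) / a2 * ((c * e - 1) / d1) = (c * e - 1) / a1 * ((c - 1) / d)"
    unfolding 3 using nz d1(2) by simp
qed

section \<open>Inverses of lower triangular matrices\<close>

lemma adj_Bminus:
  assumes b: "b \<in> Bminus n"
  shows "adj_mat b \<in> carrier_mat (n + 1) (n + 1)" "b * adj_mat b = 1\<^sub>m (n + 1)" "adj_mat b * b = 1\<^sub>m (n + 1)"
  using adj_mat[OF BminusD(1)[OF b]] BminusD(2)[OF b] by auto

lemma adj_unique:
  assumes b: "b \<in> Bminus n" and A: "A \<in> carrier_mat (n + 1) (n + 1)" and "A * b = 1\<^sub>m (n + 1)"
  shows "A = adj_mat b"
proof -
  have "A = A * (b * adj_mat b)" using A by (simp add: adj_Bminus(2)[OF b])
  also have "\<dots> = (A * b) * adj_mat b" using A BminusD(1)[OF b] adj_Bminus(1)[OF b] by (simp add: assoc_mult_mat)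
  finally show ?thesis using assms(3) adj_Bminus(1)[OF b] by simp
qed

text \<open>
  Going down from the last column, \<open>adj_mat b * b = 1\<close> forces the entries above the diagonal to vanish one
  column after the other.
\<close>

lemma adj_lower:
  assumes b: "b \<in> Bminus n" and ij: "i < j" "j < n + 1"
  shows "adj_mat b $$ (i, j) = 0"
  using ij
proof (induction "n - j" arbitrary: j rule: less_induct)
  case less
  note j = less.prems
  have "0 = (adj_mat b * b) $$ (i, j)" unfolding adj_Bminus(3)[OF b] using j by simp
  also have "\<dots> = (\<Sum>k<n + 1. adj_mat b $$ (i, k) * b $$ (k, j))"
    by (rule mult_entry[OF adj_Bminus(1)[OF b] BminusD(1)[OF b]]) (use j in auto)
  also have "\<dots> = (\<Sum>k<n + 1. if k = j then adj_mat b $$ (i, j) * b $$ (j, j) else 0)"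
  proof (intro sum.cong refl)
    fix k assume "k \<in> {..<n + 1}"
    then show "adj_mat b $$ (i, k) * b $$ (k, j) = (if k = j then adj_mat b $$ (i, j) * b $$ (j, j) else 0)"
      using less.hyps[of k] j BminusD(3)[OF b, of k j] by (cases k j rule: linorder_cases) auto
  qed
  also have "\<dots> = adj_mat b $$ (i, j) * b $$ (j, j)" using j by (simp del: sum.lessThan_Suc)
  finally show ?case using BminusD(4)[OF b j(2)] by simp
qed

text \<open>
  Membership of \<open>u b\<close> in \<open>b' U\<close> becomes a system of polynomial equations in the entries of \<open>b\<close>, \<open>b'\<close>
  and \<open>u\<close>; the inverse of \<open>b'\<close> is its adjugate as the determinant is 1.  So the condition is closed.
\<close>

lemma Bminus_Uplus_iff_adj:
  assumes b: "b \<in> Bminus n" and b': "b' \<in> Bminus n" and u: "u \<in> Uplus n"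
  shows "(\<exists>v\<in>Uplus n. u * b = b' * v) \<longleftrightarrow>
     (\<forall>i<n + 1. \<forall>j\<le>i. (adj_mat b' * (u * b)) $$ (i, j) = (if i = j then 1 else 0))"
proof
  note c = BminusD(1)[OF b] BminusD(1)[OF b'] UplusD(1)[OF u] adj_Bminus(1)[OF b']
  {
    assume "\<exists>v\<in>Uplus n. u * b = b' * v"
    then obtain v where v: "v \<in> Uplus n" "u * b = b' * v" by blast
    have "adj_mat b' * (u * b) = (adj_mat b' * b') * v"
      unfolding v(2) using c UplusD(1)[OF v(1)] by (simp add: assoc_mult_mat)
    then have "adj_mat b' * (u * b) = v" using UplusD(1)[OF v(1)] by (simp add: adj_Bminus(3)[OF b'])
    then show "\<forall>i<n + 1. \<forall>j\<le>i. (adj_mat b' * (u * b)) $$ (i, j) = (if i = j then 1 else 0)"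
      using UplusD(3,4)[OF v(1)] by auto
  next
    assume *: "\<forall>i<n + 1. \<forall>j\<le>i. (adj_mat b' * (u * b)) $$ (i, j) = (if i = j then 1 else 0)"
    have "adj_mat b' * (u * b) \<in> Uplus n" by (rule UplusI) (use c * in auto)
    moreover have "b' * (adj_mat b' * (u * b)) = (b' * adj_mat b') * (u * b)"
      using c by (simp add: assoc_mult_mat[of b' "n + 1" "n + 1" "adj_mat b'" "n + 1" "u * b" "n + 1"])
    then have "b' * (adj_mat b' * (u * b)) = u * b" using c by (simp add: adj_Bminus(2)[OF b'])
    ultimately show "\<exists>v\<in>Uplus n. u * b = b' * v" by metis
  }
qed

section \<open>The crystal operators on lower triangular matrices\<close>

text \<open>
  The change \<open>b \<mapsto> b'\<close> that \<open>e\<^sub>i\<^sup>c\<close> causes in the value of \<open>f\<close>.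
\<close>

definition crystal_step :: "nat \<Rightarrow> nat \<Rightarrow> complex \<Rightarrow> complex mat \<Rightarrow> complex mat \<Rightarrow> bool" where
  "crystal_step n i c b b' \<longleftrightarrow> b \<in> Bminus n \<and> b' \<in> Bminus n \<and> c \<noteq> 0 \<and> lcoef b i (i - 1) \<noteq> 0 \<and>
     (\<exists>u\<in>Uplus n. xgen n i ((c - 1) / lcoef b i (i - 1)) * b = b' * u)"

context
  fixes n i :: nat and c z w :: complex and b b' :: "complex mat"
  assumes i: "i \<in> {1..n}" and st: "crystal_step n i c b b'"
  defines "z \<equiv> (c - 1) / lcoef b i (i - 1)"
    and "w \<equiv> z * b $$ (i, i) / (c * b $$ (i - 1, i - 1))"
begin

private lemma
  shows b: "b \<in> Bminus n" and b': "b' \<in> Bminus n" and c: "c \<noteq> 0" and eps: "lcoef b i (i - 1) \<noteq> 0"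
  using st by (auto simp: crystal_step_def)

private lemma nz: "b $$ (i - 1, i - 1) \<noteq> 0" "b $$ (i, i) \<noteq> 0"
  using i BminusD(4)[OF b] by auto

private lemma zb: "z * b $$ (i, i - 1) = (c - 1) * b $$ (i - 1, i - 1)"
  using nz eps by (simp add: z_def lcoef_def)

private lemma zb': "b $$ (i - 1, i - 1) + z * b $$ (i, i - 1) = c * b $$ (i - 1, i - 1)"
  unfolding zb by (simp add: algebra_simps)

text \<open>
  The explicit matrix \<open>x\<^sub>i(z) b x\<^sub>i(-w)\<close> is lower triangular: \<open>w\<close> is chosen to kill its only doubtful
  entry, in row \<open>i\<close> and column \<open>i + 1\<close>.  By uniqueness of the factorization it is \<open>b'\<close>.
\<close>

lemma step_entry:
  assumes "r < n + 1" "s < n + 1"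
  shows "b' $$ (r, s) = b $$ (r, s) + (if r = i - 1 then z * b $$ (i, s) else 0)
     - (if s = i then w * (b $$ (r, i - 1) + (if r = i - 1 then z * b $$ (i, i - 1) else 0)) else 0)"
proof -
  let ?L = "\<lambda>r s. b $$ (r, s) + (if r = i - 1 then z * b $$ (i, s) else 0)"
  let ?B = "mat (n + 1) (n + 1) (\<lambda>(r, s). ?L r s - (if s = i then w * ?L r (i - 1) else 0))"
  obtain u where u: "u \<in> Uplus n" "xgen n i z * b = b' * u" using st by (auto simp: crystal_step_def z_def)
  note cb = BminusD(1)[OF b]
  have cB: "?B \<in> carrier_mat (n + 1) (n + 1)" by simp
  have eq: "?B * xgen n i w = xgen n i z * b"
  proof (rule eq_matI)
    fix r s assume "r < dim_row (xgen n i z * b)" "s < dim_col (xgen n i z * b)"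
    then have rs: "r < n + 1" "s < n + 1" using cb by auto
    then show "(?B * xgen n i w) $$ (r, s) = (xgen n i z * b) $$ (r, s)"
      unfolding xgen_mult_left[OF i cb rs] xgen_mult_right[OF i cB rs] using i by auto
  qed (use cb in auto)
  have "?B \<in> Bminus n"
    unfolding Bminus_def SL_def
  proof (intro CollectI conjI allI impI cB)
    have "det ?B * det (xgen n i w) = det (xgen n i z) * det b"
      using arg_cong[OF eq, of det] det_mult[OF cB xgen_carrier] det_mult[OF xgen_carrier cb] by simp
    then show "det ?B = 1" using BminusD(2)[OF b] UplusD(2)[OF xgen_Uplus[OF i]] by simp
    fix r s assume rs: "r < n + 1" "s < n + 1" "r < s"
    have "w * (c * b $$ (i - 1, i - 1)) = z * b $$ (i, i)" using nz c by (simp add: w_def)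
    then have "w * (b $$ (i - 1, i - 1) + z * b $$ (i, i - 1)) = z * b $$ (i, i)" unfolding zb' .
    then show "?B $$ (r, s) = 0"
      using rs i BminusD(3)[OF b, of r s] BminusD(3)[OF b, of i s] BminusD(3)[OF b, of r "i - 1"]
      by auto
  qed
  then have "?B = b'"
    by (rule Bminus_Uplus_unique[OF _ b' xgen_Uplus[OF i] u(1)]) (rule trans[OF eq u(2)])
  then show ?thesis using assms by auto
qed

lemma step_diag:
  assumes "r < n + 1"
  shows "b' $$ (r, r) = (if r = i - 1 then c * b $$ (r, r) else if r = i then b $$ (r, r) / c else b $$ (r, r))"
proof -
  have "b' $$ (i, i) = b $$ (i, i) - w * b $$ (i, i - 1)" using i by (subst step_entry) auto
  also have "w * b $$ (i, i - 1) = (z * b $$ (i, i - 1)) * b $$ (i, i) / (c * b $$ (i - 1, i - 1))" by (simp add: w_def)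
  also have "b $$ (i, i) - \<dots> = b $$ (i, i) / c" unfolding zb using nz c by (simp add: field_simps)
  finally have 1: "b' $$ (i, i) = b $$ (i, i) / c" .
  have "b' $$ (i - 1, i - 1) = b $$ (i - 1, i - 1) + z * b $$ (i, i - 1)" using i by (subst step_entry) auto
  then have 2: "b' $$ (i - 1, i - 1) = c * b $$ (i - 1, i - 1)" unfolding zb' .
  have "b' $$ (r, r) = b $$ (r, r)" if "r \<noteq> i - 1" "r \<noteq> i" using that assms by (subst step_entry) auto
  then show ?thesis using 1 2 by auto
qed

lemma step_lcoef:
  assumes "r < n + 1" "s < r"
  shows "lcoef b' r s = (if s = i - 1 then lcoef b r s / c
     else if s = i then c * lcoef b r s - z * lcoef b r (i - 1)
     else lcoef b r s + (if r = i - 1 then z * lcoef b i s else 0))"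
proof -
  have "lcoef b' r s = lcoef b r s / c" if s: "s = i - 1"
    using assms i c s by (simp add: lcoef_def step_diag) (auto simp: step_entry field_simps)
  moreover have "lcoef b' r s = c * lcoef b r s - z * lcoef b r (i - 1)" if s: "s = i"
  proof -
    have "b' $$ (r, i) = b $$ (r, i) - w * b $$ (r, i - 1)" using assms s by (subst step_entry) auto
    moreover have "b' $$ (i, i) = b $$ (i, i) / c" using i by (subst step_diag) auto
    ultimately have "lcoef b' r s = c * lcoef b r s - c * w * b $$ (r, i - 1) / b $$ (i, i)"
      unfolding lcoef_def s using c nz by (simp add: diff_divide_distrib left_diff_distrib right_diff_distrib mult_ac)
    also have "c * w * b $$ (r, i - 1) / b $$ (i, i) = z * lcoef b r (i - 1)"
      using c nz by (simp add: w_def lcoef_def)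
    finally show ?thesis .
  qed
  moreover have "lcoef b' r s = lcoef b r s + (if r = i - 1 then z * lcoef b i s else 0)" if "s \<noteq> i - 1" "s \<noteq> i"
    using assms that by (simp add: lcoef_def step_diag step_entry add_divide_distrib)
  ultimately show ?thesis by simp
qed

text \<open>
  The inverse of \<open>b'\<close> is \<open>x\<^sub>i(w) b\<^sup>-\<^sup>1 x\<^sub>i(-z)\<close>, which differs from \<open>b\<^sup>-\<^sup>1\<close> only in one row and one column.
\<close>

lemma step_adj:
  assumes "r < n + 1" "s < n + 1" "r \<noteq> i - 1" "s \<noteq> i"
  shows "adj_mat b' $$ (r, s) = adj_mat b $$ (r, s)"
proof -
  note cb = BminusD(1)[OF b] and cb' = BminusD(1)[OF b'] and ca = adj_Bminus(1)[OF b]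
  have bx: "b' * xgen n i w = xgen n i z * b"
  proof (rule eq_matI)
    fix r s assume "r < dim_row (xgen n i z * b)" "s < dim_col (xgen n i z * b)"
    then have rs: "r < n + 1" "s < n + 1" using cb by auto
    have "i - 1 < n + 1" using i by auto
    then show "(b' * xgen n i w) $$ (r, s) = (xgen n i z * b) $$ (r, s)"
      unfolding xgen_mult_left[OF i cb rs] xgen_mult_right[OF i cb' rs] using i rs by (auto simp: step_entry)
  qed (use cb cb' in auto)
  let ?x = "xgen n i" and ?N = "n + 1"
  have b'x: "b' = ?x z * (b * ?x (- w))"
  proof -
    have "b' = b' * (?x w * ?x (- w))" using cb' by (simp add: xgen_mult_xgen[OF i])
    also have "\<dots> = (b' * ?x w) * ?x (- w)" using cb' by (simp add: assoc_mult_mat[OF cb' xgen_carrier xgen_carrier])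
    also have "\<dots> = ?x z * (b * ?x (- w))" unfolding bx by (simp add: assoc_mult_mat[OF xgen_carrier cb xgen_carrier])
    finally show ?thesis .
  qed
  have cbx: "b * ?x (- w) \<in> carrier_mat ?N ?N" and cax: "adj_mat b * ?x (- z) \<in> carrier_mat ?N ?N"
    using cb ca by (auto intro: mult_carrier_mat xgen_carrier)
  let ?A = "?x w * (adj_mat b * ?x (- z))"
  have cA: "?A \<in> carrier_mat ?N ?N" using cax by (auto intro: mult_carrier_mat xgen_carrier)
  have "?x (- z) * b' = (?x (- z) * ?x z) * (b * ?x (- w))"
    unfolding b'x by (rule assoc_mult_mat[symmetric]) (use cbx in auto)
  also have "\<dots> = 1\<^sub>m ?N * (b * ?x (- w))" by (simp add: xgen_mult_xgen[OF i])
  also have "\<dots> = b * ?x (- w)" by (rule left_mult_one_mat[OF cbx])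
  finally have 1: "?x (- z) * b' = b * ?x (- w)" .
  have "?A * b' = ?x w * (adj_mat b * (?x (- z) * b'))"
    by (simp add: assoc_mult_mat[OF xgen_carrier cax cb'] assoc_mult_mat[OF ca xgen_carrier cb'])
  also have "\<dots> = ?x w * ((adj_mat b * b) * ?x (- w))"
    unfolding 1 by (simp add: assoc_mult_mat[OF ca cb xgen_carrier])
  also have "\<dots> = 1\<^sub>m ?N" by (simp add: adj_Bminus(3)[OF b] xgen_mult_xgen[OF i])
  finally have "?A = adj_mat b'" by (rule adj_unique[OF b' cA])
  moreover have "?A $$ (r, s) = adj_mat b $$ (r, s)"
    using assms by (simp add: xgen_mult_left[OF i cax] xgen_mult_right[OF i ca] del: index_mult_mat(1))
  ultimately show ?thesis by simp
qed

end

section \<open>Interval partitions and the inverse matrix\<close>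

definition interval_sum :: "(nat set \<Rightarrow> complex) \<Rightarrow> nat set \<Rightarrow> complex" where
  "interval_sum E J = (\<Sum>P\<in>interval_partitions J. (-1) ^ (card J - card P) * (\<Prod>K\<in>P. E K))"

lemma finite_interval_partitions: "finite J \<Longrightarrow> finite (interval_partitions J)"
  by (rule finite_subset[of _ "Pow (Pow J)"]) (auto simp: interval_partitions_def partition_on_def)

lemma partition_card_le:
  assumes "finite J" "partition_on J P"
  shows "card P \<le> card J"
proof -
  have P: "finite P" "\<Union>P = J" "{} \<notin> P" "disjoint P" using assms finite_elements by (auto simp: partition_on_def)
  have fin: "finite K" if "K \<in> P" for K using finite_subset[OF Union_upper[OF that]] P(2) assms(1) by simp
  have "card P = (\<Sum>K\<in>P. 1)" by simp
  also have "\<dots> \<le> (\<Sum>K\<in>P. card K)"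
    using P(3) fin by (intro sum_mono) (metis One_nat_def Suc_leI card_gt_0_iff)
  also have "\<dots> = card J" using card_Union_disjoint[of P] P fin by (auto simp: disjoint_def disjnt_def pairwise_def)
  finally show ?thesis .
qed

lemma interval_partitions_empty: "interval_partitions {} = {{}}"
  by (auto simp: interval_partitions_def partition_on_def)

text \<open>
  The block that contains \<open>s\<close> is an initial segment \<open>{s..k}\<close>, and the other blocks partition the rest.
\<close>

lemma interval_partitions_first:
  assumes st: "s \<le> t"
  shows "interval_partitions {s..t} = (\<Union>k\<in>{s..t}. insert {s..k} ` interval_partitions {k + 1..t})"
proof (intro equalityI subsetI)
  fix P assume "P \<in> interval_partitions {s..t}"
  then have P: "partition_on {s..t} P" and int: "\<forall>K\<in>P. \<exists>a b. a \<le> b \<and> K = {a..b}"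
    by (auto simp: interval_partitions_def)
  have "s \<in> \<Union>P" using P st by (auto simp: partition_on_def)
  then obtain K where K: "K \<in> P" "s \<in> K" by blast
  then obtain a k where ak: "a \<le> k" "K = {a..k}" using int by blast
  have sub: "K \<subseteq> {s..t}" using P K by (auto simp: partition_on_def)
  then have "a = s" using ak K by simp
  then have Ksk: "K = {s..k}" and k: "k \<in> {s..t}" using ak sub by auto
  have dis: "L \<inter> K = {}" if "L \<in> P - {K}" for L
    using P K that by (auto simp: partition_on_def disjoint_def)
  have "\<Union>(P - {K}) = {k + 1..t}"
  proof -
    have "\<Union>(P - {K}) = {s..t} - K" using P K dis by (auto simp: partition_on_def)
    then show ?thesis using Ksk k by auto
  qed
  then have "partition_on {k + 1..t} (P - {K})" using P by (auto simp: partition_on_def disjoint_def)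
  then have "P - {K} \<in> interval_partitions {k + 1..t}" using int by (auto simp: interval_partitions_def)
  moreover have "P = insert {s..k} (P - {K})" using K Ksk by auto
  ultimately show "P \<in> (\<Union>k\<in>{s..t}. insert {s..k} ` interval_partitions {k + 1..t})" using k by blast
next
  fix P assume "P \<in> (\<Union>k\<in>{s..t}. insert {s..k} ` interval_partitions {k + 1..t})"
  then obtain k Q where k: "k \<in> {s..t}" and Q: "Q \<in> interval_partitions {k + 1..t}" and P: "P = insert {s..k} Q"
    by blast
  have pQ: "partition_on {k + 1..t} Q" using Q by (simp add: interval_partitions_def)
  have "\<Union>P = {s..t}" using pQ k unfolding P by (auto simp: partition_on_def)
  moreover have "L \<inter> {s..k} = {}" if "L \<in> Q" for L
  proof -
    have "L \<subseteq> {k + 1..t}" using pQ that by (auto simp: partition_on_def)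
    then show ?thesis by fastforce
  qed
  ultimately have "partition_on {s..t} P" using pQ k unfolding P by (auto simp: partition_on_def disjoint_def)
  then show "P \<in> interval_partitions {s..t}" using Q k unfolding P by (auto simp: interval_partitions_def)
qed

lemma interval_sum_empty: "interval_sum E {} = 1"
  by (simp add: interval_sum_def interval_partitions_empty)

lemma interval_sum_first:
  assumes st: "s \<le> t"
  shows "interval_sum E {s..t} = (\<Sum>k\<in>{s..t}. (-1) ^ (k - s) * E {s..k} * interval_sum E {k + 1..t})"
proof -
  let ?w = "\<lambda>J P. (-1) ^ (card J - card P) * (\<Prod>K\<in>P. E K) :: complex"
  \<comment> \<open>A first block is disjoint from the blocks of the remainder, so it can be recovered from the partition.\<close>
  have new: "{s..k'} \<notin> Q" if "Q \<in> interval_partitions {k + 1..t}" "k \<in> {s..t}" "k' \<in> {s..t}" for Q k k'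
  proof
    assume "{s..k'} \<in> Q"
    then have "{s..k'} \<subseteq> \<Union>Q" by (rule Union_upper)
    also have "\<Union>Q = {k + 1..t}" using that(1) by (auto simp: interval_partitions_def partition_on_def)
    finally show False using that(2,3) by simp
  qed
  have "interval_sum E {s..t} = (\<Sum>k\<in>{s..t}. \<Sum>P\<in>insert {s..k} ` interval_partitions {k + 1..t}. ?w {s..t} P)"
    unfolding interval_sum_def interval_partitions_first[OF st]
  proof (rule sum.UNION_disjoint)
    show "\<forall>k\<in>{s..t}. \<forall>l\<in>{s..t}. k \<noteq> l \<longrightarrow>
      insert {s..k} ` interval_partitions {k + 1..t} \<inter> insert {s..l} ` interval_partitions {l + 1..t} = {}"
    proof (intro ballI impI equals0I)
      fix k l P assume kl: "k \<in> {s..t}" "l \<in> {s..t}" "k \<noteq> l"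
        and "P \<in> insert {s..k} ` interval_partitions {k + 1..t} \<inter> insert {s..l} ` interval_partitions {l + 1..t}"
      then obtain Q R where "Q \<in> interval_partitions {k + 1..t}" "insert {s..k} Q = insert {s..l} R" by blast
      then have "{s..l} = {s..k} \<or> {s..l} \<in> Q" by blast
      then show False using new[OF \<open>Q \<in> _\<close> kl(1,2)] kl by (auto simp: Icc_eq_Icc)
    qed
  qed (auto simp: finite_interval_partitions)
  also have "\<dots> = (\<Sum>k\<in>{s..t}. (-1) ^ (k - s) * E {s..k} * interval_sum E {k + 1..t})"
  proof (intro sum.cong refl)
    fix k assume k: "k \<in> {s..t}"
    have inj: "inj_on (insert {s..k}) (interval_partitions {k + 1..t})"
      using new[OF _ k k] by (intro inj_onI) (metis insert_ident)
    have "(\<Sum>P\<in>insert {s..k} ` interval_partitions {k + 1..t}. ?w {s..t} P)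
       = (\<Sum>Q\<in>interval_partitions {k + 1..t}. ?w {s..t} (insert {s..k} Q))"
      by (simp only: sum.reindex[OF inj] comp_def)
    also have "\<dots> = (\<Sum>Q\<in>interval_partitions {k + 1..t}. (-1) ^ (k - s) * E {s..k} * ?w {k + 1..t} Q)"
    proof (intro sum.cong refl)
      fix Q assume Q: "Q \<in> interval_partitions {k + 1..t}"
      then have p: "partition_on {k + 1..t} Q" by (simp add: interval_partitions_def)
      have fin: "finite Q" using finite_elements[OF _ p] by simp
      have le: "card Q \<le> t - k" using partition_card_le[OF _ p] by simp
      have "card {s..t} - card (insert {s..k} Q) = (k - s) + (card {k + 1..t} - card Q)"
      proof -
        have "card (insert {s..k} Q) = card Q + 1" using fin new[OF Q k k] by simp
        moreover have "s \<le> k" "k \<le> t" using k by auto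
        ultimately show ?thesis using le by simp
      qed
      then show "?w {s..t} (insert {s..k} Q) = (-1) ^ (k - s) * E {s..k} * ?w {k + 1..t} Q"
        using fin new[OF Q k k] by (simp add: power_add mult_ac)
    qed
    finally show "(\<Sum>P\<in>insert {s..k} ` interval_partitions {k + 1..t}. ?w {s..t} P)
       = (-1) ^ (k - s) * E {s..k} * interval_sum E {k + 1..t}"
      by (simp add: interval_sum_def sum_distrib_left)
  qed
  finally show ?thesis .
qed

lemma sum_lower_entries:
  assumes b: "b \<in> Bminus n" and s: "s \<le> t" "t \<le> n"
  shows "(\<Sum>k\<in>{s..t}. adj_mat b $$ (t, k) * b $$ (k, s)) = (if s = t then 1 else 0)"
proof -
  have "(\<Sum>k\<in>{s..t}. adj_mat b $$ (t, k) * b $$ (k, s)) = (\<Sum>k<n + 1. adj_mat b $$ (t, k) * b $$ (k, s))"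
    using s adj_lower[OF b, of t] BminusD(3)[OF b, of _ s] by (intro sum.mono_neutral_left) fastforce+
  also have "\<dots> = (adj_mat b * b) $$ (t, s)"
    by (rule mult_entry[OF adj_Bminus(1)[OF b] BminusD(1)[OF b], symmetric]) (use s in auto)
  finally show ?thesis unfolding adj_Bminus(3)[OF b] using s by auto
qed

text \<open>
  For \<open>l = b\<^sub>-\<close> and \<open>m = l\<^sup>-\<^sup>1\<close>, the equation \<open>m l = 1\<close> expresses \<open>m\<^sub>t\<^sub>s\<close> by the \<open>m\<^sub>t\<^sub>k\<close> with \<open>k > s\<close>.  Up to signs this is
  the recursion \<open>interval_sum_first\<close>.  The factor \<open>b\<^sub>t\<^sub>t\<close> appears because \<open>m\<close> is the diagonal part of \<open>b\<close> times
  \<open>b\<^sup>-\<^sup>1\<close>; the empty interval \<open>s = t + 1\<close> is admitted as the base case.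
\<close>

lemma interval_sum_adj:
  assumes b: "b \<in> Bminus n" and t: "t \<le> n" and s: "1 \<le> s" "s \<le> t + 1"
  shows "interval_sum (\<lambda>K. epsilon_B_int n K b) {s..t} = (-1) ^ (t + 1 - s) * (b $$ (t, t) * adj_mat b $$ (t, s - 1))"
  using s
proof (induction "t + 1 - s" arbitrary: s rule: less_induct)
  case less
  show ?case
  proof (cases "s = t + 1")
    case True
    then show ?thesis using sum_lower_entries[OF b order.refl t] by (simp add: interval_sum_empty mult.commute)
  next
    case False
    then have st: "s \<le> t" using less.prems by simp
    have nz: "b $$ (s - 1, s - 1) \<noteq> 0" using BminusD(4)[OF b, of "s - 1"] st t by simp
    have "interval_sum (\<lambda>K. epsilon_B_int n K b) {s..t}
       = (\<Sum>k\<in>{s..t}. (-1) ^ (k - s) * lcoef b k (s - 1) * ((-1) ^ (t - k) * (b $$ (t, t) * adj_mat b $$ (t, k))))"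
      unfolding interval_sum_first[OF st]
    proof (intro sum.cong refl)
      fix k assume k: "k \<in> {s..t}"
      have "interval_sum (\<lambda>K. epsilon_B_int n K b) {k + 1..t} = (-1) ^ (t - k) * (b $$ (t, t) * adj_mat b $$ (t, k))"
      proof -
        have "t + 1 - (k + 1) < t + 1 - s" "1 \<le> k + 1" "k + 1 \<le> t + 1" using k by auto
        from less.hyps[OF this] show ?thesis by simp
      qed
      moreover have "epsilon_B_int n {s..k} b = lcoef b k (s - 1)"
        using epsilon_B_int_eq[OF b less.prems(1)] k t by simp
      ultimately show "(-1) ^ (k - s) * epsilon_B_int n {s..k} b * interval_sum (\<lambda>K. epsilon_B_int n K b) {k + 1..t}
        = (-1) ^ (k - s) * lcoef b k (s - 1) * ((-1) ^ (t - k) * (b $$ (t, t) * adj_mat b $$ (t, k)))" by simp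
    qed
    also have "\<dots> = (\<Sum>k\<in>{s..t}. (-1) ^ (t - s) * b $$ (t, t) / b $$ (s - 1, s - 1) * (adj_mat b $$ (t, k) * b $$ (k, s - 1)))"
    proof (intro sum.cong refl)
      fix k assume k: "k \<in> {s..t}"
      then have "t - s = (k - s) + (t - k)" by simp
      then have "(-1) ^ (t - s) = (-1) ^ (k - s) * ((-1) ^ (t - k) :: complex)" by (metis power_add)
      then show "(-1) ^ (k - s) * lcoef b k (s - 1) * ((-1) ^ (t - k) * (b $$ (t, t) * adj_mat b $$ (t, k)))
        = (-1) ^ (t - s) * b $$ (t, t) / b $$ (s - 1, s - 1) * (adj_mat b $$ (t, k) * b $$ (k, s - 1))"
        by (simp add: lcoef_def)
    qed
    also have "\<dots> = (-1) ^ (t - s) * b $$ (t, t) / b $$ (s - 1, s - 1) * (\<Sum>k\<in>{s..t}. adj_mat b $$ (t, k) * b $$ (k, s - 1))"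
      by (simp add: sum_distrib_left)
    also have "(\<Sum>k\<in>{s..t}. adj_mat b $$ (t, k) * b $$ (k, s - 1)) = - (adj_mat b $$ (t, s - 1) * b $$ (s - 1, s - 1))"
    proof -
      have "{s - 1..t} = insert (s - 1) {s..t}" using less.prems st by auto
      then have "(\<Sum>k\<in>{s - 1..t}. adj_mat b $$ (t, k) * b $$ (k, s - 1))
         = adj_mat b $$ (t, s - 1) * b $$ (s - 1, s - 1) + (\<Sum>k\<in>{s..t}. adj_mat b $$ (t, k) * b $$ (k, s - 1))"
        using less.prems by simp
      moreover have "(\<Sum>k\<in>{s - 1..t}. adj_mat b $$ (t, k) * b $$ (k, s - 1)) = 0"
        using sum_lower_entries[OF b, of "s - 1" t] st t less.prems by simp
      ultimately show ?thesis by (simp add: add_eq_0_iff)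
    qed
    finally show ?thesis using nz st by (simp add: Suc_diff_le)
  qed
qed

definition epsilon_star_B :: "nat \<Rightarrow> nat set \<Rightarrow> complex mat \<Rightarrow> complex" where
  "epsilon_star_B n J b = interval_sum (\<lambda>K. epsilon_B_int n K b) J"

lemma epsilon_star_B_eq:
  "b \<in> Bminus n \<Longrightarrow> 1 \<le> s \<Longrightarrow> s \<le> t \<Longrightarrow> t \<le> n \<Longrightarrow>
   epsilon_star_B n {s..t} b = (-1) ^ (t + 1 - s) * (b $$ (t, t) * adj_mat b $$ (t, s - 1))"
  unfolding epsilon_star_B_def by (rule interval_sum_adj) auto

text \<open>
  The domains agree because the partition into the single block \<open>{s..t}\<close> already requires \<open>f\<close> to be defined.
\<close>

lemma induced_eps_star_eq:
  assumes "s \<le> t"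
  shows "induced_eps_star n f {s..t} x = map_option (epsilon_star_B n {s..t}) (f x)"
proof (cases "f x")
  case None
  have p: "{{s..t}} \<in> interval_partitions {s..t}"
    using assms by (auto simp: interval_partitions_def partition_on_def)
  have "x \<notin> dom (eps_prod (induced_eps_int n f) {{s..t}})"
    using None by (simp add: domIff eps_prod_def induced_eps_int_def)
  then show ?thesis using None p by (auto simp: induced_eps_star_def eps_alternating_sum_def)
next
  case (Some b)
  then have "eps_prod (induced_eps_int n f) P x = Some (\<Prod>K\<in>P. epsilon_B_int n K b)" for P
    by (auto simp: eps_prod_def induced_eps_int_def)
  then show ?thesis
    using Some by (auto simp: induced_eps_star_def eps_alternating_sum_def epsilon_star_B_def interval_sum_def dom_def)
qed

section \<open>The crystal operators on gamma, epsilon and epsilon star\<close>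

lemma step_epsilon_B_int:
  assumes i: "i \<in> {1..n}" and st: "crystal_step n i c b b'" and J: "1 \<le> s" "s \<le> t" "t \<le> n"
  shows "i = s \<Longrightarrow> epsilon_B_int n {s..t} b' = inverse c * epsilon_B_int n {s..t} b"
    and "i \<notin> {s - 1, s, t + 1} \<Longrightarrow> epsilon_B_int n {s..t} b' = epsilon_B_int n {s..t} b"
proof -
  have b: "b \<in> Bminus n" "b' \<in> Bminus n" using st by (auto simp: crystal_step_def)
  have st': "t < n + 1" "s - 1 < t" using J by auto
  note e = epsilon_B_int_eq[OF b(1) J] epsilon_B_int_eq[OF b(2) J] step_lcoef[OF i st st']
  show "i = s \<Longrightarrow> epsilon_B_int n {s..t} b' = inverse c * epsilon_B_int n {s..t} b"
    unfolding e by (simp add: field_simps)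
  show "i \<notin> {s - 1, s, t + 1} \<Longrightarrow> epsilon_B_int n {s..t} b' = epsilon_B_int n {s..t} b"
    unfolding e using i J by auto
qed

lemma step_epsilon_star_B:
  assumes i: "i \<in> {1..n}" and st: "crystal_step n i c b b'" and J: "1 \<le> s" "s \<le> t" "t \<le> n"
  shows "i = t \<Longrightarrow> epsilon_star_B n {s..t} b' = inverse c * epsilon_star_B n {s..t} b"
    and "i \<notin> {s - 1, t, t + 1} \<Longrightarrow> epsilon_star_B n {s..t} b' = epsilon_star_B n {s..t} b"
proof -
  have b: "b \<in> Bminus n" "b' \<in> Bminus n" using st by (auto simp: crystal_step_def)
  have st': "t < n + 1" "s - 1 < n + 1" using J by auto
  note e = epsilon_star_B_eq[OF b(1) J] epsilon_star_B_eq[OF b(2) J]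
  show "epsilon_star_B n {s..t} b' = inverse c * epsilon_star_B n {s..t} b" if "i = t"
  proof -
    have "t \<noteq> i - 1" "s - 1 \<noteq> i" using that J by auto
    then show ?thesis
      unfolding e step_adj[OF i st st' \<open>t \<noteq> i - 1\<close> \<open>s - 1 \<noteq> i\<close>] step_diag[OF i st st'(1)]
      using that by (simp add: field_simps)
  qed
  show "epsilon_star_B n {s..t} b' = epsilon_star_B n {s..t} b" if "i \<notin> {s - 1, t, t + 1}"
  proof -
    have "t \<noteq> i - 1" "s - 1 \<noteq> i" "t \<noteq> i" using that i by auto
    then show ?thesis
      unfolding e step_adj[OF i st st' \<open>t \<noteq> i - 1\<close> \<open>s - 1 \<noteq> i\<close>] step_diag[OF i st st'(1)] by simp
  qed
qed

lemma step_epsilon_B: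
  assumes i: "i \<in> {1..n}" and j: "j \<in> {1..n}" and st: "crystal_step n i c b b'"
  shows "i = j \<Longrightarrow> epsilon_B n j b' = inverse c * epsilon_B n j b"
    and "cartan_A i j = 0 \<Longrightarrow> epsilon_B n j b' = epsilon_B n j b"
proof -
  have b: "b \<in> Bminus n" "b' \<in> Bminus n" using st by (auto simp: crystal_step_def)
  have j': "j < n + 1" "j - 1 < j" using j by auto
  note e = epsilon_B_eq[OF b(1) j] epsilon_B_eq[OF b(2) j] step_lcoef[OF i st j']
  show "i = j \<Longrightarrow> epsilon_B n j b' = inverse c * epsilon_B n j b"
    unfolding e by (simp add: field_simps)
  show "cartan_A i j = 0 \<Longrightarrow> epsilon_B n j b' = epsilon_B n j b"
    unfolding e using i j by (auto simp: cartan_A_def split: if_splits)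
qed

lemma step_gamma_B:
  assumes i: "i \<in> {1..n}" and j: "j \<in> {1..n}" and st: "crystal_step n i c b b'"
  shows "gamma_B n j b' = c powi cartan_A i j * gamma_B n j b"
proof -
  have b: "b \<in> Bminus n" "b' \<in> Bminus n" and c: "c \<noteq> 0" using st by (auto simp: crystal_step_def)
  have j': "j - 1 < n + 1" "j < n + 1" using j by auto
  have nz: "b $$ (j, j) \<noteq> 0" using BminusD(4)[OF b(1) j'(2)] .
  note e = gamma_B_eq[OF b(1) j] gamma_B_eq[OF b(2) j] step_diag[OF i st j'(1)] step_diag[OF i st j'(2)]
  consider "i = j" | "i = j + 1" | "j = i + 1" | "i \<noteq> j" "i \<noteq> j + 1" "j \<noteq> i + 1" by blast
  then show ?thesis
  proof cases
    case 1
    then have "j \<noteq> i - 1" "c powi cartan_A i j = c * c" using j by (auto simp: cartan_A_def power2_eq_square)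
    then show ?thesis unfolding e using 1 c nz by simp
  next
    case 2
    then have "j = i - 1" "j - 1 \<noteq> i - 1" "j - 1 \<noteq> i" "c powi cartan_A i j = inverse c"
      using j by (auto simp: cartan_A_def)
    then show ?thesis unfolding e using c nz by (simp add: field_simps)
  next
    case 3
    then have "j \<noteq> i - 1" "j \<noteq> i" "j - 1 = i" "j - 1 \<noteq> i - 1" "c powi cartan_A i j = inverse c"
      using i by (auto simp: cartan_A_def)
    then show ?thesis unfolding e using c nz by (simp add: field_simps)
  next
    case 4
    then have "j \<noteq> i - 1" "j - 1 \<noteq> i - 1" "j - 1 \<noteq> i" "c powi cartan_A i j = 1"
      using i j by (auto simp: cartan_A_def)
    then show ?thesis unfolding e using 4 by simp
  qed
qed

text \<open>
  The action of two neighbouring operators on the rank two data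
  \<open>(\<epsilon>\<^sub>i, \<epsilon>\<^sub>i\<^sub>+\<^sub>1, \<epsilon>\<^bsub>[i,i+1]\<^esub>)\<close>, which is closed under both.
\<close>

lemma step_adjacent:
  assumes i: "i \<in> {1..n}" "i + 1 \<in> {1..n}"
  shows "crystal_step n i c b b' \<Longrightarrow> lcoef b' i (i - 1) = lcoef b i (i - 1) / c"
    and "crystal_step n i c b b' \<Longrightarrow> lcoef b' (i + 1) i =
       c * lcoef b (i + 1) i - (c - 1) * lcoef b (i + 1) (i - 1) / lcoef b i (i - 1)"
    and "crystal_step n i c b b' \<Longrightarrow> lcoef b' (i + 1) (i - 1) = lcoef b (i + 1) (i - 1) / c"
    and "crystal_step n (i + 1) c b b' \<Longrightarrow> lcoef b' (i + 1) i = lcoef b (i + 1) i / c"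
    and "crystal_step n (i + 1) c b b' \<Longrightarrow> lcoef b' i (i - 1) =
       lcoef b i (i - 1) + (c - 1) * lcoef b (i + 1) (i - 1) / lcoef b (i + 1) i"
    and "crystal_step n (i + 1) c b b' \<Longrightarrow> lcoef b' (i + 1) (i - 1) = lcoef b (i + 1) (i - 1)"
proof -
  have r: "i < n + 1" "i - 1 < i" "i + 1 < n + 1" "i < i + 1" "i - 1 < i + 1" using i by auto
  show "lcoef b' i (i - 1) = lcoef b i (i - 1) / c"
     "lcoef b' (i + 1) i = c * lcoef b (i + 1) i - (c - 1) * lcoef b (i + 1) (i - 1) / lcoef b i (i - 1)"
     "lcoef b' (i + 1) (i - 1) = lcoef b (i + 1) (i - 1) / c" if "crystal_step n i c b b'"
    using i(1) unfolding step_lcoef[OF i(1) that r(1,2)] step_lcoef[OF i(1) that r(3,4)] step_lcoef[OF i(1) that r(3,5)]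
    by auto
  show "lcoef b' (i + 1) i = lcoef b (i + 1) i / c"
    "lcoef b' i (i - 1) = lcoef b i (i - 1) + (c - 1) * lcoef b (i + 1) (i - 1) / lcoef b (i + 1) i"
    "lcoef b' (i + 1) (i - 1) = lcoef b (i + 1) (i - 1)" if "crystal_step n (i + 1) c b b'"
    using i(1) unfolding step_lcoef[OF i(2) that r(1,2)] step_lcoef[OF i(2) that r(3,4)] step_lcoef[OF i(2) that r(3,5)]
    by auto
qed

lemma braid_chain:
  assumes i: "i \<in> {1..n}" "i + 1 \<in> {1..n}"
    and L: "crystal_step n i e b b1" "crystal_step n (i + 1) (c * e) b1 b2" "lcoef b2 i (i - 1) \<noteq> 0"
    and R: "crystal_step n (i + 1) c b b1'" "crystal_step n i (c * e) b1' b2'" "lcoef b2' (i + 1) i \<noteq> 0"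
  shows "xgen n i ((c - 1) / lcoef b2 i (i - 1)) *
      (xgen n (i + 1) ((c * e - 1) / lcoef b1 (i + 1) i) * xgen n i ((e - 1) / lcoef b i (i - 1)))
    = xgen n (i + 1) ((e - 1) / lcoef b2' (i + 1) i) *
      (xgen n i ((c * e - 1) / lcoef b1' i (i - 1)) * xgen n (i + 1) ((c - 1) / lcoef b (i + 1) i))"
proof -
  have nz: "lcoef b i (i - 1) \<noteq> 0" "lcoef b (i + 1) i \<noteq> 0" "c \<noteq> 0" "e \<noteq> 0"
    and d1: "lcoef b1 (i + 1) i \<noteq> 0" and a1: "lcoef b1' i (i - 1) \<noteq> 0"
    using L(1,2) R(1,2) by (auto simp: crystal_step_def)
  note s = step_adjacent[OF i]
  note p = braid_parameters[OF nz, where m = "lcoef b (i + 1) (i - 1)", OF s(2)[OF L(1)] d1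
     s(5)[OF L(2), unfolded s(1)[OF L(1)] s(3)[OF L(1)]] L(3) s(5)[OF R(1)] a1
     s(2)[OF R(2), unfolded s(4)[OF R(1)] s(6)[OF R(1)]] R(3)]
  show ?thesis by (rule xgen_braid[OF i p])
qed

section \<open>Matrix-valued regular maps\<close>

definition mat_regular :: "(nat \<Rightarrow> 'a fspace) \<Rightarrow> 'a set \<Rightarrow> nat \<Rightarrow> ('a \<Rightarrow> complex mat) \<Rightarrow> bool" where
  "mat_regular Z W m A \<longleftrightarrow> openin (ind_top Z) W \<and> (\<forall>z\<in>W. A z \<in> carrier_mat m m) \<and>
     (\<forall>i<m. \<forall>j<m. regfun Z W (\<lambda>z. A z $$ (i, j)))"

context
  fixes Z :: "nat \<Rightarrow> 'a fspace"
  assumes Z: "ind_space Z"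
begin

lemma mat_regular_mult:
  assumes A: "mat_regular Z W m A" and B: "mat_regular Z W m B"
  shows "mat_regular Z W m (\<lambda>z. A z * B z)"
proof -
  have W: "openin (ind_top Z) W" using A by (simp add: mat_regular_def)
  have "regfun Z W (\<lambda>z. (A z * B z) $$ (i, j))" if ij: "i < m" "j < m" for i j
  proof (rule mor_on_cong[OF Z])
    show "regfun Z W (\<lambda>z. \<Sum>k<m. A z $$ (i, k) * B z $$ (k, j))"
      by (intro regfun_sum[OF Z W] regfun_mult[OF Z]) (use A B ij in \<open>auto simp: mat_regular_def\<close>)
    show "(\<Sum>k<m. A z $$ (i, k) * B z $$ (k, j)) = (A z * B z) $$ (i, j)" if "z \<in> W" for z
      by (rule mult_entry[symmetric]) (use A B ij that in \<open>auto simp: mat_regular_def\<close>)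
  qed
  then show ?thesis using A B unfolding mat_regular_def by (auto intro!: mult_carrier_mat)
qed

lemma mat_regular_det:
  assumes A: "mat_regular Z W m A"
  shows "regfun Z W (\<lambda>z. det (A z))"
proof (rule mor_on_cong[OF Z])
  have W: "openin (ind_top Z) W" using A by (simp add: mat_regular_def)
  show "regfun Z W (\<lambda>z. \<Sum>p\<in>{p. p permutes {0..<m}}. signof p * (\<Prod>i = 0..<m. A z $$ (i, p i)))"
    by (intro regfun_sum[OF Z W] regfun_mult[OF Z] regfun_prod[OF Z W] regfun_const[OF Z W])
      (use A in \<open>auto simp: mat_regular_def dest: permutes_in_image\<close>)
  show "(\<Sum>p\<in>{p. p permutes {0..<m}}. signof p * (\<Prod>i = 0..<m. A z $$ (i, p i))) = det (A z)" if "z \<in> W" for z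
    by (rule det_def'[symmetric]) (use A that in \<open>auto simp: mat_regular_def\<close>)
qed

text \<open>
  Cofactors are determinants, hence polynomials in the entries.
\<close>

lemma mat_regular_adj:
  assumes A: "mat_regular Z W m A"
  shows "mat_regular Z W m (\<lambda>z. adj_mat (A z))"
proof -
  have W: "openin (ind_top Z) W" using A by (simp add: mat_regular_def)
  have car: "A z \<in> carrier_mat m m" if "z \<in> W" for z using A that by (simp add: mat_regular_def)
  have "regfun Z W (\<lambda>z. adj_mat (A z) $$ (i, j))" if ij: "i < m" "j < m" for i j
  proof (rule mor_on_cong[OF Z])
    have "mat_regular Z W (m - 1) (\<lambda>z. mat_delete (A z) j i)"
      unfolding mat_regular_def
    proof (intro conjI ballI allI impI W)
      fix z assume "z \<in> W" then show "mat_delete (A z) j i \<in> carrier_mat (m - 1) (m - 1)"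
        by (intro mat_delete_carrier car)
    next
      fix k l assume kl: "k < m - 1" "l < m - 1"
      show "regfun Z W (\<lambda>z. mat_delete (A z) j i $$ (k, l))"
      proof (rule mor_on_cong[OF Z])
        show "regfun Z W (\<lambda>z. A z $$ (if k < j then k else Suc k, if l < i then l else Suc l))"
          using A kl by (auto simp: mat_regular_def)
        show "A z $$ (if k < j then k else Suc k, if l < i then l else Suc l) = mat_delete (A z) j i $$ (k, l)"
          if "z \<in> W" for z
          using car[OF that] kl by (auto simp: mat_delete_def)
      qed
    qed
    then show "regfun Z W (\<lambda>z. (-1) ^ (j + i) * det (mat_delete (A z) j i))"
      by (intro regfun_mult[OF Z] regfun_const[OF Z W] mat_regular_det)
    show "(-1) ^ (j + i) * det (mat_delete (A z) j i) = adj_mat (A z) $$ (i, j)" if "z \<in> W" for z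
      using car[OF that] ij by (auto simp: adj_mat_def cofactor_def)
  qed
  then show ?thesis using A adj_mat(1) unfolding mat_regular_def by blast
qed

lemma mor_mat_regular:
  assumes A: "mor_on Z W (\<lambda>_. coord_space S (mat_coords n)) A" and S: "S \<subseteq> carrier_mat (n + 1) (n + 1)"
  shows "mat_regular Z W (n + 1) A"
proof -
  have "regfun Z W (\<lambda>z. A z $$ (i, j))" if "i < n + 1" "j < n + 1" for i j
    using regfun_coord[OF Z A, of "\<lambda>M. M $$ (i, j)"] that by (auto simp: mat_coords_def)
  then show ?thesis using mor_on_open[OF A] mor_on_pts[OF A] S unfolding mat_regular_def by auto
qed

lemma mat_regular_mor:
  assumes A: "mat_regular Z W (n + 1) A" and S: "\<And>z. z \<in> W \<Longrightarrow> A z \<in> S"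
  shows "mor_on Z W (\<lambda>_. coord_space S (mat_coords n)) A"
proof (rule mor_on_into_coord_space[OF Z])
  show "openin (ind_top Z) W" using A by (simp add: mat_regular_def)
  show "regfun Z W (\<lambda>z. c (A z))" if "c \<in> mat_coords n" for c
    using that A unfolding mat_coords_def mat_regular_def by auto
qed (rule S)

lemma mor_U_mat_regular: "mor_on Z W (\<lambda>_. U_var n) g \<Longrightarrow> mat_regular Z W (n + 1) g"
  unfolding U_var_def by (rule mor_mat_regular) (auto dest: UplusD(1))

lemma mor_B_mat_regular: "mor_on Z W (\<lambda>_. Bminus_var n) g \<Longrightarrow> mat_regular Z W (n + 1) g"
  unfolding Bminus_var_def by (rule mor_mat_regular) (auto dest: BminusD(1))

lemma mor_U_mult:
  assumes g: "mor_on Z W (\<lambda>_. U_var n) g" and h: "mor_on Z W (\<lambda>_. U_var n) h"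
  shows "mor_on Z W (\<lambda>_. U_var n) (\<lambda>z. g z * h z)"
proof -
  have "mat_regular Z W (n + 1) (\<lambda>z. g z * h z)" by (intro mat_regular_mult mor_U_mat_regular g h)
  then show ?thesis unfolding U_var_def
    by (rule mat_regular_mor) (use mor_on_pts[OF g] mor_on_pts[OF h] in \<open>auto simp: U_var_def intro: mult_Uplus\<close>)
qed

lemma mor_Cx_regfun: "mor_on Z W (\<lambda>_. Cx_var) g \<Longrightarrow> regfun Z W g"
  unfolding Cx_var_def using regfun_coord[OF Z, of W "UNIV - {0}" "{\<lambda>z. z}" g "\<lambda>z. z"] by simp

lemma mor_Cx_mult:
  assumes g: "mor_on Z W (\<lambda>_. Cx_var) g" and h: "mor_on Z W (\<lambda>_. Cx_var) h"
  shows "mor_on Z W (\<lambda>_. Cx_var) (\<lambda>z. g z * h z)"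
  unfolding Cx_var_def
proof (rule mor_on_into_coord_space[OF Z mor_on_open[OF g]])
  show "regfun Z W (\<lambda>z. c (g z * h z))" if "c \<in> {\<lambda>z. z}" for c
    using that regfun_mult[OF Z mor_Cx_regfun[OF g] mor_Cx_regfun[OF h]] by simp
qed (use mor_on_pts[OF g] mor_on_pts[OF h] in auto)

text \<open>
  A morphism followed by a partial one: the preimage of the open domain is where the composite lives.
\<close>

lemma mor_on_partial:
  assumes Y: "ind_space Y" and \<phi>: "mor_on Z W Y \<phi>" and \<psi>: "mor_on Y (dom \<psi>) Y' (\<lambda>y. the (\<psi> y))"
  shows "mor_on Z {z \<in> W. \<phi> z \<in> dom \<psi>} Y' (\<lambda>z. the (\<psi> (\<phi> z)))"
proof -
  have "mor_on Z {z \<in> W. \<phi> z \<in> dom \<psi>} Y \<phi>"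
    by (rule mor_on_restrict[OF \<phi> mor_on_preimage[OF \<phi> mor_on_open[OF \<psi>]]]) auto
  from mor_on_comp[OF Z Y this \<psi>] show ?thesis by simp
qed

end

lemma openin_ind_pts: "openin (ind_top Z) (ind_pts Z)"
  using openin_topspace[of "ind_top Z"] by simp

lemma ind_space_U: "ind_space (\<lambda>_. U_var n)"
  unfolding U_var_def by (intro ind_space_const zariski_coord_space)

lemma pts_U [simp]: "pts (U_var n) = Uplus n"
  by (simp add: U_var_def)

lemma pts_B [simp]: "pts (Bminus_var n) = Bminus n"
  by (simp add: Bminus_var_def)

section \<open>Unipotent crystals\<close>

definition eps_at :: "('a \<rightharpoonup> complex mat) \<Rightarrow> nat \<Rightarrow> 'a \<Rightarrow> complex" where
  "eps_at f i x = lcoef (the (f x)) i (i - 1)"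

text \<open>
  The element of \<open>U\<close> by which \<open>e\<^sub>i\<^sup>c\<close> moves \<open>x\<close>, for \<open>p = (c, x)\<close>.
\<close>

definition e_shift :: "nat \<Rightarrow> ('a \<rightharpoonup> complex mat) \<Rightarrow> nat \<Rightarrow> complex \<times> 'a \<Rightarrow> complex mat" where
  "e_shift n f i p = xgen n i ((fst p - 1) / eps_at f i (snd p))"

text \<open>
  On \<open>W\<close>, the point \<open>y\<close> arises from \<open>x\<close> by the single group element \<open>g\<close>.  For a composite of crystal
  operators this makes points comparable through the group elements that produce them.
\<close>

definition tracks ::
  "nat \<Rightarrow> (nat \<Rightarrow> 'a fspace) \<Rightarrow> (complex mat \<times> 'a \<rightharpoonup> 'a) \<Rightarrow> (nat \<Rightarrow> 'z fspace) \<Rightarrow> 'z set \<Rightarrow>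
   ('z \<Rightarrow> 'a) \<Rightarrow> ('z \<Rightarrow> 'a) \<Rightarrow> ('z \<Rightarrow> complex mat) \<Rightarrow> bool" where
  "tracks n X \<alpha> Z W x y g \<longleftrightarrow>
     mor_on Z W X x \<and> mor_on Z W X y \<and> mor_on Z W (\<lambda>_. U_var n) g \<and> (\<forall>z\<in>W. \<alpha> (g z, x z) = Some (y z))"

context
  fixes n :: nat and X :: "nat \<Rightarrow> 'a fspace" and \<alpha> :: "complex mat \<times> 'a \<rightharpoonup> 'a" and f :: "'a \<rightharpoonup> complex mat"
  assumes uc: "unipotent_crystal n X \<alpha> f"
begin

lemma crystal_ind_variety: "ind_variety X"
  using uc by (simp add: unipotent_crystal_def U_variety_def)

lemma crystal_ind_space: "ind_space X"
  by (rule ind_variety_ind_space[OF crystal_ind_variety])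

lemma crystal_ind_space_U: "ind_space (ind_prod (\<lambda>_. U_var n) X)"
  by (rule ind_space_prod[OF ind_space_U crystal_ind_space])

lemma alpha_mor: "mor_on (ind_prod (\<lambda>_. U_var n) X) (dom \<alpha>) X (\<lambda>p. the (\<alpha> p))"
  using uc by (simp add: unipotent_crystal_def U_variety_def rational_action_def rat_map_mor_on)

lemma f_mor: "mor_on X (dom f) (\<lambda>_. Bminus_var n) (\<lambda>x. the (f x))"
  using uc by (simp add: unipotent_crystal_def U_morphism_def rat_map_mor_on)

lemma f_dense: "open_dense X (dom f)"
  using uc by (simp add: unipotent_crystal_def U_morphism_def rat_map_mor_on)

lemma alpha_pts: "(u, x) \<in> dom \<alpha> \<Longrightarrow> u \<in> Uplus n \<and> x \<in> ind_pts X"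
  using openin_subset[OF mor_on_open[OF alpha_mor]] by (auto simp: ind_pts_prod[OF ind_space_U crystal_ind_space])

lemma f_pts: "x \<in> dom f \<Longrightarrow> x \<in> ind_pts X"
  using openin_subset[OF mor_on_open[OF f_mor]] by auto

lemma f_Bminus: "f x = Some b \<Longrightarrow> b \<in> Bminus n"
  using mor_on_pts[OF f_mor, of x] by auto

text \<open>
  The unit acts as the identity on a dense open set by the axioms, and it is defined on all of \<open>X\<close>;
  separatedness does the rest.
\<close>

lemma alpha_one:
  assumes "x \<in> ind_pts X"
  shows "\<alpha> (1\<^sub>m (n + 1), x) = Some x"
proof -
  have d: "(1\<^sub>m (n + 1), x) \<in> dom \<alpha>" if "x \<in> ind_pts X" for x
    using uc that by (auto simp: unipotent_crystal_def U_variety_def)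
  have m: "mor_on X (ind_pts X) (ind_prod (\<lambda>_. U_var n) X) (\<lambda>x. (1\<^sub>m (n + 1), x))"
    by (intro mor_on_pair[OF crystal_ind_space ind_space_U crystal_ind_space] mor_on_const[OF crystal_ind_space] mor_on_id openin_ind_pts) (simp only: ind_pts_const pts_U one_Uplus)
  have m2: "mor_on X (ind_pts X) X (\<lambda>x. the (\<alpha> (1\<^sub>m (n + 1), x)))"
    by (rule mor_on_comp[OF crystal_ind_space crystal_ind_space_U m alpha_mor]) (rule d)
  obtain W where W: "open_dense X W" "\<forall>x\<in>W. \<alpha> (1\<^sub>m (n + 1), x) = Some x"
    using uc by (auto simp: unipotent_crystal_def U_variety_def rational_action_def rat_eq_def)
  have "the (\<alpha> (1\<^sub>m (n + 1), x)) = x"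
    by (rule mor_on_agree[OF crystal_ind_space crystal_ind_variety m2 mor_on_id[OF openin_ind_pts] W(1) _ assms]) (use W(2) in auto)
  then show ?thesis using d[OF assms] by auto
qed

text \<open>
  Both sides are morphisms on the open set of all \<open>(g, h, x)\<close> where they are defined, and agree on a dense
  subset of it.
\<close>

lemma alpha_mult:
  assumes h: "\<alpha> (h, x) = Some y" and g: "\<alpha> (g, y) = Some w" and gh: "\<alpha> (g * h, x) = Some w'"
  shows "w = w'"
proof -
  let ?Z = "ind_prod (\<lambda>_. U_var n) (ind_prod (\<lambda>_. U_var n) X)"
  note Zi = ind_space_prod[OF ind_space_U crystal_ind_space_U]
  let ?O = "ind_pts ?Z"
  have i0: "mor_on ?Z ?O ?Z (\<lambda>p. p)" by (rule mor_on_id[OF openin_ind_pts])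
  note m1 = mor_on_fst[OF Zi ind_space_U crystal_ind_space_U i0] and m2 = mor_on_snd[OF Zi ind_space_U crystal_ind_space_U i0]
  note m3 = mor_on_fst[OF Zi ind_space_U crystal_ind_space m2] and m4 = mor_on_snd[OF Zi ind_space_U crystal_ind_space m2]
  let ?O1 = "{p \<in> ?O. snd p \<in> dom \<alpha>}"
  have y: "mor_on ?Z ?O1 X (\<lambda>p. the (\<alpha> (snd p)))" by (rule mor_on_partial[OF Zi crystal_ind_space_U m2 alpha_mor])
  have gy: "mor_on ?Z ?O1 (ind_prod (\<lambda>_. U_var n) X) (\<lambda>p. (fst p, the (\<alpha> (snd p))))"
    by (rule mor_on_pair[OF Zi ind_space_U crystal_ind_space mor_on_restrict[OF m1 mor_on_open[OF y]] y]) auto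
  let ?O2 = "{p \<in> ?O1. (fst p, the (\<alpha> (snd p))) \<in> dom \<alpha>}"
  have w: "mor_on ?Z ?O2 X (\<lambda>p. the (\<alpha> (fst p, the (\<alpha> (snd p)))))" by (rule mor_on_partial[OF Zi crystal_ind_space_U gy alpha_mor])
  have ghx: "mor_on ?Z ?O (ind_prod (\<lambda>_. U_var n) X) (\<lambda>p. (fst p * fst (snd p), snd (snd p)))"
    by (rule mor_on_pair[OF Zi ind_space_U crystal_ind_space mor_U_mult[OF Zi m1 m3] m4])
  let ?O3 = "{p \<in> ?O. (fst p * fst (snd p), snd (snd p)) \<in> dom \<alpha>}"
  have w': "mor_on ?Z ?O3 X (\<lambda>p. the (\<alpha> (fst p * fst (snd p), snd (snd p))))"
    by (rule mor_on_partial[OF Zi crystal_ind_space_U ghx alpha_mor])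
  have o: "openin (ind_top ?Z) (?O2 \<inter> ?O3)" using mor_on_open[OF w] mor_on_open[OF w'] by blast
  obtain W where W: "open_dense ?Z W"
    "\<forall>p\<in>W. (\<lambda>(g, h, x). Option.bind (\<alpha> (h, x)) (\<lambda>y. \<alpha> (g, y))) p = (\<lambda>(g, h, x). \<alpha> (g * h, x)) p"
    using uc unfolding unipotent_crystal_def U_variety_def rational_action_def rat_eq_def by blast
  have pts: "(g, h, x) \<in> ?O"
    using alpha_pts[of h x] alpha_pts[of g y] h g by (auto simp: ind_pts_prod[OF ind_space_U crystal_ind_space_U] ind_pts_prod[OF ind_space_U crystal_ind_space])
  have "(\<lambda>p. the (\<alpha> (fst p, the (\<alpha> (snd p))))) (g, h, x) = (\<lambda>p. the (\<alpha> (fst p * fst (snd p), snd (snd p)))) (g, h, x)"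
  proof (rule mor_on_agree[OF Zi crystal_ind_variety mor_on_restrict[OF w o] mor_on_restrict[OF w' o] W(1)])
    fix p assume "p \<in> W" "p \<in> ?O2 \<inter> ?O3"
    then show "the (\<alpha> (fst p, the (\<alpha> (snd p)))) = the (\<alpha> (fst p * fst (snd p), snd (snd p)))"
      using W(2)[rule_format, of p] by (auto simp: case_prod_beta)
  qed (use pts h g gh in auto)
  then show ?thesis using h g gh by simp
qed

text \<open>
  The equation \<open>f(u x) = \<pi>\<^sup>-(u f(x))\<close> is known on a dense open set.  There it amounts to polynomial equations
  between regular functions, which persist on the open set where \<open>f(x)\<close>, \<open>u x\<close> and
  \<open>f(u x)\<close> are defined; in particular \<open>\<pi>\<^sup>-(u f(x))\<close> is defined there.
\<close>

lemma f_equivariant: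
  assumes u: "\<alpha> (u, x) = Some y" and x: "f x = Some b" and y: "f y = Some b'"
  shows "\<exists>v\<in>Uplus n. u * b = b' * v"
proof -
  let ?Z = "ind_prod (\<lambda>_. U_var n) X"
  have i0: "mor_on ?Z (dom \<alpha>) ?Z (\<lambda>p. p)" by (rule mor_on_id[OF mor_on_open[OF alpha_mor]])
  note m1 = mor_on_fst[OF crystal_ind_space_U ind_space_U crystal_ind_space i0] and m2 = mor_on_snd[OF crystal_ind_space_U ind_space_U crystal_ind_space i0]
  let ?O1 = "{p \<in> dom \<alpha>. snd p \<in> dom f}" and ?O2 = "{p \<in> dom \<alpha>. the (\<alpha> p) \<in> dom f}"
  have B: "mor_on ?Z ?O1 (\<lambda>_. Bminus_var n) (\<lambda>p. the (f (snd p)))" by (rule mor_on_partial[OF crystal_ind_space_U crystal_ind_space m2 f_mor])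
  have B': "mor_on ?Z ?O2 (\<lambda>_. Bminus_var n) (\<lambda>p. the (f (the (\<alpha> p))))" by (rule mor_on_partial[OF crystal_ind_space_U crystal_ind_space alpha_mor f_mor])
  let ?O = "?O1 \<inter> ?O2"
  have o: "openin (ind_top ?Z) ?O" using mor_on_open[OF B] mor_on_open[OF B'] by blast
  have m1': "mor_on ?Z ?O (\<lambda>_. U_var n) fst" by (rule mor_on_restrict[OF m1 o]) auto
  \<comment> \<open>Equivariance at \<open>p\<close> says that the matrix \<open>?M p\<close> is upper unitriangular.\<close>
  let ?M = "\<lambda>p. adj_mat (the (f (the (\<alpha> p)))) * (fst p * the (f (snd p)))"
  have M: "mat_regular ?Z ?O (n + 1) ?M"
    by (intro mat_regular_mult[OF crystal_ind_space_U] mat_regular_adj[OF crystal_ind_space_U] mor_B_mat_regular[OF crystal_ind_space_U] mor_U_mat_regular[OF crystal_ind_space_U]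
        mor_on_restrict[OF B o] mor_on_restrict[OF B' o] m1') auto
  have mem: "fst p \<in> Uplus n \<and> the (f (snd p)) \<in> Bminus n \<and> the (f (the (\<alpha> p))) \<in> Bminus n" if "p \<in> ?O" for p
    using that mor_on_pts[OF m1' that] mor_on_pts[OF B, of p] mor_on_pts[OF B', of p] by simp
  obtain W where W: "open_dense ?Z W" 
    "\<forall>p\<in>W. (\<lambda>(u, x). Option.bind (\<alpha> (u, x)) f) p = (\<lambda>(u, x). Option.bind (f x) (\<lambda>y. Bminus_action n (u, y))) p"
    using uc unfolding unipotent_crystal_def U_morphism_def rat_eq_def by blast
  have zero: "?M p $$ (i, j) - (if i = j then 1 else 0) = 0" if ij: "i < n + 1" "j \<le> i" and p: "p \<in> ?O" for i j p
  proof (rule regfun_agree[OF crystal_ind_space_U _ W(1) _ p])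
    show "regfun ?Z ?O (\<lambda>p. ?M p $$ (i, j) - (if i = j then 1 else 0))"
      using M ij by (intro regfun_diff[OF crystal_ind_space_U] regfun_const[OF crystal_ind_space_U o]) (auto simp: mat_regular_def)
    fix q assume q: "q \<in> W" "q \<in> ?O"
    obtain v y b b' where e: "q = (v, y)" "f y = Some b" "\<alpha> (v, y) \<noteq> None" "f (the (\<alpha> (v, y))) = Some b'"
      using q(2) by (cases q) auto
    have "pi_minus n (v * b) = Some b'"
      using W(2)[rule_format, OF q(1)] e by (auto simp: Bminus_action_def)
    then have "\<exists>w\<in>Uplus n. v * b = b' * w" using pi_minus_SomeD by blast
    then show "?M q $$ (i, j) - (if i = j then 1 else 0) = 0"
      using Bminus_Uplus_iff_adj[of b n b' v] mem[OF q(2)] e ij by auto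
  qed
  have p: "(u, x) \<in> ?O" using assms by auto
  have "\<forall>i<n + 1. \<forall>j\<le>i. (adj_mat b' * (u * b)) $$ (i, j) = (if i = j then 1 else 0)"
    using zero[OF _ _ p] assms by auto
  then show ?thesis using Bminus_Uplus_iff_adj[of b n b' u] mem[OF p] assms by auto
qed

lemma Bminus_regfun: "r < n + 1 \<Longrightarrow> s < n + 1 \<Longrightarrow> regfun X (dom f) (\<lambda>x. the (f x) $$ (r, s))"
  using mor_B_mat_regular[OF crystal_ind_space f_mor] by (auto simp: mat_regular_def)

lemma lcoef_regfun:
  assumes "r < n + 1" "s < n + 1"
  shows "regfun X (dom f) (\<lambda>x. lcoef (the (f x)) r s)"
proof -
  have "the (f x) $$ (s, s) \<noteq> 0" if "x \<in> dom f" for x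
    using that BminusD(4)[OF f_Bminus assms(2)] by auto
  then show ?thesis unfolding lcoef_def using assms by (intro regfun_divide[OF crystal_ind_space] Bminus_regfun)
qed

lemma eps_at_regfun: "i \<in> {1..n} \<Longrightarrow> regfun X (dom f) (eps_at f i)"
  unfolding eps_at_def[abs_def] by (rule lcoef_regfun) auto

lemma rat_fun_map_f:
  assumes "regfun X (dom f) (\<lambda>x. h' (the (f x)))" "\<And>b. b \<in> Bminus n \<Longrightarrow> h b = h' b"
  shows "rat_fun X (\<lambda>x. map_option h (f x))"
proof -
  have d: "dom (\<lambda>x. map_option h (f x)) = dom f" by auto
  have "regfun X (dom f) (\<lambda>x. the (map_option h (f x)))"
    by (rule mor_on_cong[OF crystal_ind_space assms(1)]) (use assms(2) f_Bminus in auto)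
  then show ?thesis unfolding rat_fun_def rat_map_mor_on d using f_dense by simp
qed

lemma induced_e_eq:
  assumes "i \<in> {1..n}"
  shows "induced_e n \<alpha> f i (c, x) = Some y \<longleftrightarrow>
    c \<noteq> 0 \<and> x \<in> dom f \<and> eps_at f i x \<noteq> 0 \<and> \<alpha> (e_shift n f i (c, x), x) = Some y"
proof (cases "f x")
  case (Some b)
  then have "epsilon_B n i b = eps_at f i x" using epsilon_B_eq[OF f_Bminus assms] by (simp add: eps_at_def)
  then show ?thesis using Some by (auto simp: induced_e_def induced_epsilon_def e_shift_def)
qed (auto simp: induced_e_def induced_epsilon_def)

lemma crystal_ind_space_Cx: "ind_space (ind_prod (\<lambda>_. Cx_var) X)"
  by (rule ind_space_prod[OF ind_space_Cx crystal_ind_space])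

text \<open>
  The domain is cut out in the open set where \<open>f\<close> is defined and \<open>\<epsilon>\<^sub>i\<close> does not vanish by the open domain
  of the action.
\<close>

lemma induced_e_mor:
  assumes i: "i \<in> {1..n}"
  shows "mor_on (ind_prod (\<lambda>_. Cx_var) X) (dom (induced_e n \<alpha> f i)) X (\<lambda>p. the (induced_e n \<alpha> f i p))"
    and "mor_on (ind_prod (\<lambda>_. Cx_var) X) (dom (induced_e n \<alpha> f i)) (\<lambda>_. U_var n) (e_shift n f i)"
proof -
  let ?Z = "ind_prod (\<lambda>_. Cx_var) X" and ?e = "induced_e n \<alpha> f i"
  have i0: "mor_on ?Z (ind_pts ?Z) ?Z (\<lambda>p. p)" by (rule mor_on_id[OF openin_ind_pts])
  note m1 = mor_on_fst[OF crystal_ind_space_Cx ind_space_Cx crystal_ind_space i0] and m2 = mor_on_snd[OF crystal_ind_space_Cx ind_space_Cx crystal_ind_space i0]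
  let ?R0 = "{p \<in> ind_pts ?Z. snd p \<in> dom f}"
  have o0: "openin (ind_top ?Z) ?R0" by (rule mor_on_preimage[OF m2 mor_on_open[OF f_mor]])
  have m20: "mor_on ?Z ?R0 X snd" by (rule mor_on_restrict[OF m2 o0]) auto
  have eps: "regfun ?Z ?R0 (\<lambda>p. eps_at f i (snd p))"
    by (rule mor_on_comp[OF crystal_ind_space_Cx crystal_ind_space m20 eps_at_regfun[OF i]]) auto
  \<comment> \<open>On \<open>?R\<close> the group element is defined; the condition \<open>c \<noteq> 0\<close> is part of being a point of the product.\<close>
  let ?R = "{p \<in> ?R0. eps_at f i (snd p) \<noteq> 0}"
  have o: "openin (ind_top ?Z) ?R" by (rule regfun_nonzero[OF crystal_ind_space_Cx eps])
  have eps': "regfun ?Z ?R (\<lambda>p. eps_at f i (snd p))" by (rule mor_on_restrict[OF eps o]) auto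
  have c: "regfun ?Z ?R fst" by (rule mor_Cx_regfun[OF crystal_ind_space_Cx mor_on_restrict[OF m1 o]]) auto
  have z: "regfun ?Z ?R (\<lambda>p. (fst p - 1) / eps_at f i (snd p))"
    by (intro regfun_divide[OF crystal_ind_space_Cx] regfun_diff[OF crystal_ind_space_Cx] c eps' regfun_const[OF crystal_ind_space_Cx o]) auto
  have "mat_regular ?Z ?R (n + 1) (e_shift n f i)"
    unfolding mat_regular_def
  proof (intro conjI ballI allI impI o)
    show "e_shift n f i p \<in> carrier_mat (n + 1) (n + 1)" for p by (simp only: e_shift_def xgen_carrier)
    fix r s assume rs: "r < n + 1" "s < n + 1"
    have "regfun ?Z ?R (\<lambda>p. (if r = s then 1 else 0) + (if r = i - 1 \<and> s = i then (fst p - 1) / eps_at f i (snd p) else 0))"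
    proof (rule regfun_add[OF crystal_ind_space_Cx regfun_const[OF crystal_ind_space_Cx o]])
      show "regfun ?Z ?R (\<lambda>p. if r = i - 1 \<and> s = i then (fst p - 1) / eps_at f i (snd p) else 0)"
      proof (cases "r = i - 1 \<and> s = i")
        case True then show ?thesis unfolding if_P[OF True] by (intro z)
      next
        case False then show ?thesis unfolding if_not_P[OF False] by (intro regfun_const[OF crystal_ind_space_Cx o])
      qed
    qed
    then show "regfun ?Z ?R (\<lambda>p. e_shift n f i p $$ (r, s))"
      by (rule mor_on_cong[OF crystal_ind_space_Cx]) (simp only: e_shift_def xgen_entry[OF rs])
  qed
  then have g: "mor_on ?Z ?R (\<lambda>_. U_var n) (e_shift n f i)"
    unfolding U_var_def by (rule mat_regular_mor[OF crystal_ind_space_Cx]) (simp add: e_shift_def xgen_Uplus[OF i])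
  have gx: "mor_on ?Z ?R (ind_prod (\<lambda>_. U_var n) X) (\<lambda>p. (e_shift n f i p, snd p))"
    by (rule mor_on_pair[OF crystal_ind_space_Cx ind_space_U crystal_ind_space g mor_on_restrict[OF m20 o]]) auto
  have d: "dom ?e = {p \<in> ?R. (e_shift n f i p, snd p) \<in> dom \<alpha>}" (is "_ = ?D")
  proof (rule Set.set_eqI)
    fix p :: "complex \<times> 'a"
    obtain c x where p: "p = (c, x)" by (cases p)
    have "(c, x) \<in> dom ?e \<longleftrightarrow> (\<exists>y. ?e (c, x) = Some y)" by auto
    also have "\<dots> \<longleftrightarrow> (c, x) \<in> ?D"
      unfolding induced_e_eq[OF i] using f_pts by (auto simp: ind_pts_prod[OF ind_space_Cx crystal_ind_space])
    finally show "p \<in> dom ?e \<longleftrightarrow> p \<in> ?D" unfolding p .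
  qed
  have m: "mor_on ?Z (dom ?e) X (\<lambda>p. the (\<alpha> (e_shift n f i p, snd p)))"
    unfolding d by (rule mor_on_partial[OF crystal_ind_space_Cx crystal_ind_space_U gx alpha_mor])
  show "mor_on ?Z (dom ?e) X (\<lambda>p. the (?e p))"
  proof (rule mor_on_cong[OF crystal_ind_space_Cx m])
    fix p assume "p \<in> dom ?e"
    then obtain c x y where p: "p = (c, x)" "?e (c, x) = Some y" by (cases p) auto
    then show "the (\<alpha> (e_shift n f i p, snd p)) = the (?e p)" using induced_e_eq[OF i, of c x y] by simp
  qed
  show "mor_on ?Z (dom ?e) (\<lambda>_. U_var n) (e_shift n f i)"
    by (rule mor_on_restrict[OF g mor_on_open[OF m]]) (use d in auto)
qed

lemma induced_e_dom:
  assumes "i \<in> {1..n}" "(c, x) \<in> dom (induced_e n \<alpha> f i)"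
  shows "c \<noteq> 0" "x \<in> dom f" "eps_at f i x \<noteq> 0"
    and "\<alpha> (e_shift n f i (c, x), x) = Some (the (induced_e n \<alpha> f i (c, x)))"
proof -
  obtain y where "induced_e n \<alpha> f i (c, x) = Some y" using assms(2) by auto
  then show "c \<noteq> 0" "x \<in> dom f" "eps_at f i x \<noteq> 0"
    "\<alpha> (e_shift n f i (c, x), x) = Some (the (induced_e n \<alpha> f i (c, x)))"
    using induced_e_eq[OF assms(1), of c x y] by auto
qed

lemma induced_e_step:
  assumes i: "i \<in> {1..n}" and d: "(c, x) \<in> dom (induced_e n \<alpha> f i)"
    and y: "the (induced_e n \<alpha> f i (c, x)) \<in> dom f"
  shows "crystal_step n i c (the (f x)) (the (f (the (induced_e n \<alpha> f i (c, x)))))"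
proof -
  note D = induced_e_dom[OF i d]
  obtain b b' where b: "f x = Some b" "f (the (induced_e n \<alpha> f i (c, x))) = Some b'" using D(2) y by auto
  have "\<exists>v\<in>Uplus n. e_shift n f i (c, x) * b = b' * v" by (rule f_equivariant[OF D(4) b])
  then show ?thesis
    using b D(1,3) f_Bminus[OF b(1)] f_Bminus[OF b(2)] by (simp add: crystal_step_def e_shift_def eps_at_def)
qed

lemma induced_e_one:
  assumes i: "i \<in> {1..n}" and "x \<in> dom f" "eps_at f i x \<noteq> 0"
  shows "induced_e n \<alpha> f i (1, x) = Some x" "e_shift n f i (1, x) = 1\<^sub>m (n + 1)"
proof -
  show e: "e_shift n f i (1, x) = 1\<^sub>m (n + 1)" by (simp add: e_shift_def)
  show "induced_e n \<alpha> f i (1, x) = Some x"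
    unfolding induced_e_eq[OF i] e using assms alpha_one[OF f_pts] by simp
qed

section \<open>Composites of crystal operators\<close>

lemma tracks_start:
  assumes Z: "ind_space Z" and x: "mor_on Z W X x"
  shows "tracks n X \<alpha> Z W x x (\<lambda>_. 1\<^sub>m (n + 1))"
  unfolding tracks_def
proof (intro conjI ballI x)
  show "mor_on Z W (\<lambda>_. U_var n) (\<lambda>_. 1\<^sub>m (n + 1))"
    by (rule mor_on_const[OF Z mor_on_open[OF x]]) (simp only: ind_pts_const pts_U one_Uplus)
qed (rule alpha_one[OF mor_on_pts[OF x]])

text \<open>
  The domain is shrunk to points at which the action of the accumulated group element is defined, so that
  \<open>alpha_mult\<close> applies.
\<close>

lemma tracks_step:
  assumes Z: "ind_space Z" and t: "tracks n X \<alpha> Z W x y g" and k: "mor_on Z W (\<lambda>_. Cx_var) k" and i: "i \<in> {1..n}"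
  shows "tracks n X \<alpha> Z
     {z \<in> W. (k z, y z) \<in> dom (induced_e n \<alpha> f i) \<and> (e_shift n f i (k z, y z) * g z, x z) \<in> dom \<alpha>}
     x (\<lambda>z. the (induced_e n \<alpha> f i (k z, y z))) (\<lambda>z. e_shift n f i (k z, y z) * g z)"
proof -
  let ?e = "induced_e n \<alpha> f i"
  have x: "mor_on Z W X x" and y: "mor_on Z W X y" and g: "mor_on Z W (\<lambda>_. U_var n) g"
    and a: "\<And>z. z \<in> W \<Longrightarrow> \<alpha> (g z, x z) = Some (y z)" using t by (auto simp: tracks_def)
  have ky: "mor_on Z W (ind_prod (\<lambda>_. Cx_var) X) (\<lambda>z. (k z, y z))" by (rule mor_on_pair[OF Z ind_space_Cx crystal_ind_space k y])
  let ?V = "{z \<in> W. (k z, y z) \<in> dom ?e}"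
  have e: "mor_on Z ?V X (\<lambda>z. the (?e (k z, y z)))" by (rule mor_on_partial[OF Z crystal_ind_space_Cx ky induced_e_mor(1)[OF i]])
  note V = mor_on_open[OF e]
  have s: "mor_on Z ?V (\<lambda>_. U_var n) (\<lambda>z. e_shift n f i (k z, y z))"
    by (rule mor_on_comp[OF Z crystal_ind_space_Cx mor_on_restrict[OF ky V] induced_e_mor(2)[OF i]]) auto
  have sg: "mor_on Z ?V (\<lambda>_. U_var n) (\<lambda>z. e_shift n f i (k z, y z) * g z)"
    by (rule mor_U_mult[OF Z s mor_on_restrict[OF g V]]) auto
  have sgx: "mor_on Z ?V (ind_prod (\<lambda>_. U_var n) X) (\<lambda>z. (e_shift n f i (k z, y z) * g z, x z))"
    by (rule mor_on_pair[OF Z ind_space_U crystal_ind_space sg mor_on_restrict[OF x V]]) auto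
  let ?V' = "{z \<in> ?V. (e_shift n f i (k z, y z) * g z, x z) \<in> dom \<alpha>}"
  have V': "openin (ind_top Z) ?V'" by (rule mor_on_preimage[OF sgx mor_on_open[OF alpha_mor]])
  have "\<alpha> (e_shift n f i (k z, y z) * g z, x z) = Some (the (?e (k z, y z)))" if "z \<in> ?V'" for z
  proof -
    from that have "(e_shift n f i (k z, y z) * g z, x z) \<in> dom \<alpha>" by simp
    from domD[OF this] obtain w where w: "\<alpha> (e_shift n f i (k z, y z) * g z, x z) = Some w" ..
    have "the (?e (k z, y z)) = w"
      by (rule alpha_mult[OF a induced_e_dom(4)[OF i] w]) (use that in auto)
    then show ?thesis using w by simp
  qed
  then have "tracks n X \<alpha> Z ?V' x (\<lambda>z. the (?e (k z, y z))) (\<lambda>z. e_shift n f i (k z, y z) * g z)"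
    unfolding tracks_def
    by (intro conjI ballI mor_on_restrict[OF x V'] mor_on_restrict[OF e V'] mor_on_restrict[OF sg V']) auto
  moreover have "?V' = {z \<in> W. (k z, y z) \<in> dom ?e \<and> (e_shift n f i (k z, y z) * g z, x z) \<in> dom \<alpha>}" by auto
  ultimately show ?thesis by simp
qed

end

text \<open>
  A composite of crystal operators is a list of pairs of an index and a parameter, where the parameter may
  depend on the point \<open>z\<close> of an ambient space; the head of the list is applied last.  Besides the resulting point
  and the accumulated group element, the set is recorded on which all intermediate results are defined.
\<close>

primrec path_point :: "nat \<Rightarrow> (complex mat \<times> 'a \<rightharpoonup> 'a) \<Rightarrow> ('a \<rightharpoonup> complex mat) \<Rightarrow> ('z \<Rightarrow> 'a) \<Rightarrow>
   (nat \<times> ('z \<Rightarrow> complex)) list \<Rightarrow> 'z \<Rightarrow> 'a" where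
  "path_point n \<alpha> f x [] = x"
| "path_point n \<alpha> f x (q # ps) = (\<lambda>z. the (induced_e n \<alpha> f (fst q) (snd q z, path_point n \<alpha> f x ps z)))"

primrec path_elem :: "nat \<Rightarrow> (complex mat \<times> 'a \<rightharpoonup> 'a) \<Rightarrow> ('a \<rightharpoonup> complex mat) \<Rightarrow> ('z \<Rightarrow> 'a) \<Rightarrow>
   (nat \<times> ('z \<Rightarrow> complex)) list \<Rightarrow> 'z \<Rightarrow> complex mat" where
  "path_elem n \<alpha> f x [] = (\<lambda>_. 1\<^sub>m (n + 1))"
| "path_elem n \<alpha> f x (q # ps) = (\<lambda>z. e_shift n f (fst q) (snd q z, path_point n \<alpha> f x ps z) * path_elem n \<alpha> f x ps z)"

primrec path_dom :: "nat \<Rightarrow> (complex mat \<times> 'a \<rightharpoonup> 'a) \<Rightarrow> ('a \<rightharpoonup> complex mat) \<Rightarrow> 'z set \<Rightarrow> ('z \<Rightarrow> 'a) \<Rightarrow>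
   (nat \<times> ('z \<Rightarrow> complex)) list \<Rightarrow> 'z set" where
  "path_dom n \<alpha> f W x [] = W"
| "path_dom n \<alpha> f W x (q # ps) = {z \<in> path_dom n \<alpha> f W x ps.
     (snd q z, path_point n \<alpha> f x ps z) \<in> dom (induced_e n \<alpha> f (fst q)) \<and>
     (path_elem n \<alpha> f x (q # ps) z, x z) \<in> dom \<alpha>}"

lemma tracks_open: "tracks n X \<alpha> Z W x y g \<Longrightarrow> openin (ind_top Z) W"
  using mor_on_open by (auto simp: tracks_def)

lemma tracks_unique:
  "tracks n X \<alpha> Z W x y g \<Longrightarrow> tracks n X \<alpha> Z W' x y' g' \<Longrightarrow> z \<in> W \<Longrightarrow> z \<in> W' \<Longrightarrow> g z = g' z \<Longrightarrow> y z = y' z"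
  unfolding tracks_def by (metis option.inject)

context
  fixes n :: nat and X :: "nat \<Rightarrow> 'a fspace" and \<alpha> :: "complex mat \<times> 'a \<rightharpoonup> 'a" and f :: "'a \<rightharpoonup> complex mat"
  assumes uc: "unipotent_crystal n X \<alpha> f"
    and nz: "\<And>i. i \<in> {1..n} \<Longrightarrow> rat_nonzero X (induced_epsilon n f i)"
begin

private abbreviation (input) "e \<equiv> induced_e n \<alpha> f"
private abbreviation (input) "sh \<equiv> e_shift n f"
private abbreviation (input) "CX \<equiv> ind_prod (\<lambda>_. Cx_var) X"
private abbreviation (input) "CCX \<equiv> ind_prod (\<lambda>_. Cx_var) CX"
private abbreviation (input) "D \<equiv> {x \<in> dom f. \<forall>i\<in>{1..n}. eps_at f i x \<noteq> 0}"

private lemmas Xi = crystal_ind_space[OF uc] and CXi = crystal_ind_space_Cx[OF uc]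

lemma generic_dense: "open_dense X D"
proof -
  have 1: "open_dense X {x \<in> dom f. eps_at f i x \<noteq> 0}" if i: "i \<in> {1..n}" for i
    unfolding open_dense_iff
  proof (intro conjI allI impI regfun_nonzero[OF Xi eps_at_regfun[OF uc i]])
    fix V assume "openin (ind_top X) V \<and> V \<noteq> {}"
    then obtain x r where x: "x \<in> V" "induced_epsilon n f i x = Some r" "r \<noteq> 0"
      using nz[OF i] unfolding rat_nonzero_def by blast
    then obtain b where b: "f x = Some b" "r = epsilon_B n i b" by (auto simp: induced_epsilon_def)
    then have "eps_at f i x = r" using epsilon_B_eq[OF f_Bminus[OF uc b(1)] i] by (simp add: eps_at_def)
    then have "x \<in> V \<inter> {x \<in> dom f. eps_at f i x \<noteq> 0}" using x b by auto
    then show "V \<inter> {x \<in> dom f. eps_at f i x \<noteq> 0} \<noteq> {}" by blast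
  qed
  have "open_dense X {x \<in> dom f. \<forall>i\<in>I. eps_at f i x \<noteq> 0}" if "I \<subseteq> {1..n}" for I
    using finite_subset[OF that finite_atLeastAtMost] that
  proof (induction I rule: finite_induct)
    case empty then show ?case using f_dense[OF uc] by simp
  next
    case (insert i I)
    have "{x \<in> dom f. \<forall>j\<in>insert i I. eps_at f j x \<noteq> 0}
       = {x \<in> dom f. eps_at f i x \<noteq> 0} \<inter> {x \<in> dom f. \<forall>j\<in>I. eps_at f j x \<noteq> 0}" by auto
    then show ?case using open_dense_Int[OF 1 insert.IH] insert.prems by auto
  qed
  then show ?thesis by blast
qed

private lemma rat_eq_CX:
  assumes W: "openin (ind_top CX) W" and "\<And>x. x \<in> D \<Longrightarrow> (1, x) \<in> W"
    and "\<And>c x. (c, x) \<in> W \<Longrightarrow> \<exists>v. \<phi> (c, x) = Some v \<and> \<psi> (c, x) = Some v"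
  shows "rat_eq CX \<phi> \<psi>"
  unfolding rat_eq_def
proof (intro exI[of _ W] conjI)
  show "open_dense CX W" by (rule open_dense_Cx_prod[OF Xi W generic_dense]) (rule assms(2))
  have "z \<in> dom \<phi> \<inter> dom \<psi> \<and> \<phi> z = \<psi> z" if "z \<in> W" for z
    using assms(3)[of "fst z" "snd z"] that by auto
  then show "W \<subseteq> dom \<phi> \<inter> dom \<psi>" "\<forall>x\<in>W. \<phi> x = \<psi> x" by blast+
qed

private lemma rat_eq_CCX:
  assumes W: "openin (ind_top CCX) W" and one: "\<And>x. x \<in> D \<Longrightarrow> (1, 1, x) \<in> W"
    and eq: "\<And>c d x. (c, d, x) \<in> W \<Longrightarrow> \<exists>v. \<phi> (c, d, x) = Some v \<and> \<psi> (c, d, x) = Some v"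
  shows "rat_eq CCX \<phi> \<psi>"
  unfolding rat_eq_def
proof (intro exI[of _ W] conjI)
  have "openin (ind_top CX) {p. (1, p) \<in> W}" by (rule openin_slice_right[OF ind_space_Cx CXi W]) simp
  then have "open_dense CX {p. (1, p) \<in> W}"
    by (rule open_dense_Cx_prod[OF Xi _ generic_dense]) (use one in simp)
  then show "open_dense CCX W" by (rule open_dense_Cx_prod[OF CXi W]) simp
  have "z \<in> dom \<phi> \<inter> dom \<psi> \<and> \<phi> z = \<psi> z" if "z \<in> W" for z
    using eq[of "fst z" "fst (snd z)" "snd (snd z)"] that by auto
  then show "W \<subseteq> dom \<phi> \<inter> dom \<psi>" "\<forall>x\<in>W. \<phi> x = \<psi> x" by blast+
qed

private lemma at_one:
  assumes "x \<in> D" "i \<in> {1..n}"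
  shows "e i (1, x) = Some x" "sh i (1, x) = 1\<^sub>m (Suc n)" "\<alpha> (1\<^sub>m (Suc n), x) = Some x"
    "x \<in> ind_pts X"
  using induced_e_one[OF uc assms(2), of x] alpha_one[OF uc f_pts[OF uc], of x] f_pts[OF uc, of x] assms by auto

text \<open>
  For a function \<open>h\<close> on \<open>B\<^sup>-\<close>, an identity for crystal steps yields an identity of rational functions.
\<close>

lemma one_step:
  assumes i: "i \<in> {1..n}" and h: "\<And>c b b'. crystal_step n i c b b' \<Longrightarrow> h b' = k c (h b)"
  shows "rat_eq CX (\<lambda>(c, x). Option.bind (e i (c, x)) (\<lambda>x. map_option h (f x)))
     (\<lambda>(c, x). map_option (k c) (map_option h (f x)))"
proof (rule rat_eq_CX)
  show "openin (ind_top CX) {p \<in> dom (e i). the (e i p) \<in> dom f}"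
    by (rule mor_on_preimage[OF induced_e_mor(1)[OF uc i] mor_on_open[OF f_mor[OF uc]]])
  show "(1, x) \<in> {p \<in> dom (e i). the (e i p) \<in> dom f}" if "x \<in> D" for x
    using at_one(1)[OF that i] that by auto
  fix c x assume p: "(c, x) \<in> {p \<in> dom (e i). the (e i p) \<in> dom f}"
  then have d: "(c, x) \<in> dom (e i)" and y: "the (e i (c, x)) \<in> dom f" by simp_all
  note s = h[OF induced_e_step[OF uc i d y]]
  obtain y b b' where *: "e i (c, x) = Some y" "f x = Some b" "f y = Some b'"
    using d y induced_e_dom(2)[OF uc i d] by auto
  then show "\<exists>v. (\<lambda>(c, x). Option.bind (e i (c, x)) (\<lambda>x. map_option h (f x))) (c, x) = Some v \<and>
     (\<lambda>(c, x). map_option (k c) (map_option h (f x))) (c, x) = Some v"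
    using s by simp
qed

lemma one_step_invariant:
  assumes i: "i \<in> {1..n}" and h: "\<And>c b b'. crystal_step n i c b b' \<Longrightarrow> h b' = h b"
  shows "rat_eq CX (\<lambda>(c, x). Option.bind (e i (c, x)) (\<lambda>x. map_option h (f x))) (\<lambda>(c, x). map_option h (f x))"
  using one_step[OF i, of h "\<lambda>_ r. r"] h by (simp add: option.map_comp comp_def)

private lemma CCX_mor:
  shows "mor_on CCX (ind_pts CCX) (\<lambda>_. Cx_var) fst"
    and "mor_on CCX (ind_pts CCX) (\<lambda>_. Cx_var) (\<lambda>p. fst (snd p))"
    and "mor_on CCX (ind_pts CCX) X (\<lambda>p. snd (snd p))"
proof -
  note Zi = ind_space_prod[OF ind_space_Cx CXi]
  have i0: "mor_on CCX (ind_pts CCX) CCX (\<lambda>p. p)" by (rule mor_on_id[OF openin_ind_pts])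
  show "mor_on CCX (ind_pts CCX) (\<lambda>_. Cx_var) fst" by (rule mor_on_fst[OF Zi ind_space_Cx CXi i0])
  note m2 = mor_on_snd[OF Zi ind_space_Cx CXi i0]
  show "mor_on CCX (ind_pts CCX) (\<lambda>_. Cx_var) (\<lambda>p. fst (snd p))" by (rule mor_on_fst[OF Zi ind_space_Cx Xi m2])
  show "mor_on CCX (ind_pts CCX) X (\<lambda>p. snd (snd p))" by (rule mor_on_snd[OF Zi ind_space_Cx Xi m2])
qed

private lemma CCX_pts: "x \<in> D \<Longrightarrow> (1, 1, x) \<in> ind_pts CCX"
  using f_pts[OF uc] by (simp add: ind_pts_prod[OF ind_space_Cx CXi] ind_pts_prod[OF ind_space_Cx Xi])

private lemmas CCXi = ind_space_prod[OF ind_space_Cx CXi]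

private abbreviation (input) "pdom \<equiv> path_dom n \<alpha> f (ind_pts CCX) (\<lambda>p. snd (snd p))"
private abbreviation (input) "ppoint \<equiv> path_point n \<alpha> f (\<lambda>p. snd (snd p))"
private abbreviation (input) "pelem \<equiv> path_elem n \<alpha> f (\<lambda>p. snd (snd p))"

private lemma tracks_path:
  assumes "\<And>i k. (i, k) \<in> set ps \<Longrightarrow> i \<in> {1..n} \<and> mor_on CCX (ind_pts CCX) (\<lambda>_. Cx_var) k"
  shows "tracks n X \<alpha> CCX (pdom ps) (\<lambda>p. snd (snd p))
     (ppoint ps) (pelem ps)"
  using assms
proof (induction ps)
  case Nil
  show ?case using tracks_start[OF uc CCXi CCX_mor(3)] by simp
next
  case (Cons q ps)
  obtain i k where q: "q = (i, k)" by (cases q)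
  let ?W = "pdom ps"
  have t: "tracks n X \<alpha> CCX ?W (\<lambda>p. snd (snd p))
     (ppoint ps) (pelem ps)"
    by (rule Cons.IH, rule Cons.prems, simp)
  have ik: "i \<in> {1..n}" "mor_on CCX (ind_pts CCX) (\<lambda>_. Cx_var) k" using Cons.prems[of i k] by (simp_all add: q)
  have k: "mor_on CCX ?W (\<lambda>_. Cx_var) k"
    by (rule mor_on_restrict[OF ik(2) tracks_open[OF t]]) (use openin_subset[OF tracks_open[OF t]] in simp)
  show ?case using tracks_step[OF uc CCXi t k ik(1)] by (simp add: q)
qed

private lemma path_at_one:
  assumes x: "x \<in> D" and "\<And>i k. (i, k) \<in> set ps \<Longrightarrow> i \<in> {1..n} \<and> k (1, 1, x) = 1"
  shows "(1, 1, x) \<in> pdom ps \<and>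
    ppoint ps (1, 1, x) = x \<and>
    pelem ps (1, 1, x) = 1\<^sub>m (Suc n)"
  using assms(2)
proof (induction ps)
  case Nil
  then show ?case using CCX_pts[OF x] by simp
next
  case (Cons q ps)
  obtain i k where q: "q = (i, k)" by (cases q)
  have ik: "i \<in> {1..n}" "k (1, 1, x) = 1" using Cons.prems[of i k] by (simp_all add: q)
  have "(1, 1, x) \<in> pdom ps \<and>
    ppoint ps (1, 1, x) = x \<and>
    pelem ps (1, 1, x) = 1\<^sub>m (Suc n)"
    by (rule Cons.IH, rule Cons.prems, simp)
  then show ?case using at_one[OF x ik(1)] ik(2) by (simp add: q domIff)
qed

text \<open>
  Two composites of crystal operators agree as rational maps if the accumulated group elements do.  At \<open>c = d = 1\<close>
  all parameters are 1 and nothing moves, so the composites are defined there; this gives density.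
\<close>

private lemma rat_eq_paths:
  assumes ps: "\<And>i k. (i, k) \<in> set ps \<union> set qs \<Longrightarrow> i \<in> {1..n} \<and>
      k \<in> {fst, \<lambda>p. fst (snd p), \<lambda>p. fst p * fst (snd p)}"
    and eq: "\<And>c d x. (c, d, x) \<in> pdom ps \<Longrightarrow>
       (c, d, x) \<in> pdom qs \<Longrightarrow>
       pelem ps (c, d, x) = pelem qs (c, d, x)"
    and \<phi>: "\<And>c d x. (c, d, x) \<in> pdom ps \<Longrightarrow>
       \<phi> (c, d, x) = Some (ppoint ps (c, d, x))"
    and \<psi>: "\<And>c d x. (c, d, x) \<in> pdom qs \<Longrightarrow>
       \<psi> (c, d, x) = Some (ppoint qs (c, d, x))"
  shows "rat_eq CCX \<phi> \<psi>"
proof -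
  have k: "mor_on CCX (ind_pts CCX) (\<lambda>_. Cx_var) k \<and> k (1, 1, x) = 1"
    if "k \<in> {fst, \<lambda>p. fst (snd p), \<lambda>p. fst p * fst (snd p)}" for k x
    using that CCX_mor(1,2) mor_Cx_mult[OF CCXi CCX_mor(1,2)] by auto
  have tp: "tracks n X \<alpha> CCX (pdom rs) (\<lambda>p. snd (snd p))
     (ppoint rs) (pelem rs)"
    if "set rs \<subseteq> set ps \<union> set qs" for rs
    by (rule tracks_path) (use that ps k in blast)
  note t = tp[of ps, OF Un_upper1] tp[of qs, OF Un_upper2]
  show ?thesis
  proof (rule rat_eq_CCX)
    show "openin (ind_top CCX) (pdom ps \<inter>
        pdom qs)"
      by (intro openin_Int tracks_open[OF t(1)] tracks_open[OF t(2)])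
    fix x assume x: "x \<in> D"
    have "(1, 1, x) \<in> pdom rs"
      if "set rs \<subseteq> set ps \<union> set qs" for rs
      by (rule path_at_one[OF x, THEN conjunct1]) (use that ps k in blast)
    then show "(1, 1, x) \<in> pdom ps \<inter>
        pdom qs" by blast
  next
    fix c d x assume p: "(c, d, x) \<in> pdom ps \<inter>
        pdom qs"
    then have "ppoint ps (c, d, x) = ppoint qs (c, d, x)"
      using tracks_unique[OF t] eq by blast
    then show "\<exists>v. \<phi> (c, d, x) = Some v \<and> \<psi> (c, d, x) = Some v" using \<phi> \<psi> p by auto
  qed
qed

private lemma step_data:
  assumes i: "i \<in> {1..n}" and d: "(c, x) \<in> dom (e i)"
  shows "sh i (c, x) = xgen n i ((c - 1) / lcoef (the (f x)) i (i - 1))"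
    "c \<noteq> 0" "lcoef (the (f x)) i (i - 1) \<noteq> 0" "x \<in> dom f"
    "the (e i (c, x)) \<in> dom f \<Longrightarrow> crystal_step n i c (the (f x)) (the (f (the (e i (c, x)))))"
  using induced_e_dom[OF uc i d] induced_e_step[OF uc i d] by (simp_all add: e_shift_def eps_at_def)

private lemma sh_one: "sh i p * 1\<^sub>m (Suc n) = sh i p"
  unfolding e_shift_def by (rule right_mult_one_mat[OF xgen_carrier_Suc])

text \<open>
  After \<open>e\<^sub>i\<^sup>d\<close> the value of \<open>\<epsilon>\<^sub>i\<close> is divided by \<open>d\<close>, and
  \<open>d (c - 1) / \<epsilon>\<^sub>i + (d - 1) / \<epsilon>\<^sub>i = (c d - 1) / \<epsilon>\<^sub>i\<close>.
\<close>

lemma action_law: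
  assumes i: "i \<in> {1..n}"
  shows "rat_eq CCX (\<lambda>(c, d, x). Option.bind (e i (d, x)) (\<lambda>y. e i (c, y))) (\<lambda>(c, d, x). e i (c * d, x))"
proof (rule rat_eq_paths[where ps = "[(i, fst), (i, \<lambda>p. fst (snd p))]" and qs = "[(i, \<lambda>p. fst p * fst (snd p))]"], goal_cases)
  case (1 j k) then show ?case using i by auto
next
  case (2 c d x)
  then have *: "(d, x) \<in> dom (e i)" "(c, the (e i (d, x))) \<in> dom (e i)" "(c * d, x) \<in> dom (e i)" by simp_all
  let ?y = "the (e i (d, x))"
  note y = step_data[OF i *(1)] and w = step_data[OF i *(2)] and s = step_data(1)[OF i *(3)]
  have l: "lcoef (the (f ?y)) i (i - 1) = lcoef (the (f x)) i (i - 1) / d"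
    using step_lcoef[OF i y(5)[OF w(4)], of i "i - 1"] i by simp
  have "(c - 1) / (lcoef (the (f x)) i (i - 1) / d) + (d - 1) / lcoef (the (f x)) i (i - 1)
     = (c * d - 1) / lcoef (the (f x)) i (i - 1)" using y(2,3) by (simp add: field_simps)
  then have "sh i (c, ?y) * sh i (d, x) = sh i (c * d, x)" unfolding y(1) w(1) s l xgen_mult_xgen[OF i] by simp
  then show ?case by (simp add: sh_one)
next
  case (3 c d x)
  then show ?case by auto
next
  case (4 c d x)
  then show ?case by auto
qed

text \<open>
  Neither operator changes the parameter of the other, and the root subgroups commute.
\<close>

lemma commute_law:
  assumes i: "i \<in> {1..n}" and j: "j \<in> {1..n}" and ij: "cartan_A i j = 0"
  shows "rat_eq CCX (\<lambda>(c, d, x). Option.bind (e j (d, x)) (\<lambda>y. e i (c, y)))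
    (\<lambda>(c, d, x). Option.bind (e i (c, x)) (\<lambda>y. e j (d, y)))"
proof (rule rat_eq_paths[where ps = "[(i, fst), (j, \<lambda>p. fst (snd p))]" and qs = "[(j, \<lambda>p. fst (snd p)), (i, fst)]"], goal_cases)
  case (1 l k) then show ?case using i j by auto
next
  case (2 c d x)
  then have *: "(d, x) \<in> dom (e j)" "(c, the (e j (d, x))) \<in> dom (e i)" 
    "(c, x) \<in> dom (e i)" "(d, the (e i (c, x))) \<in> dom (e j)" by simp_all
  have ji: "cartan_A j i = 0" using ij by (auto simp: cartan_A_def split: if_splits)
  let ?y = "the (e j (d, x))" and ?y' = "the (e i (c, x))"
  note y = step_data[OF j *(1)] and w = step_data[OF i *(2)]
  note y' = step_data[OF i *(3)] and w' = step_data[OF j *(4)]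
  have inv: "lcoef b' l (l - 1) = lcoef b l (l - 1)"
    if "crystal_step n m u b b'" "cartan_A m l = 0" "m \<in> {1..n}" "l \<in> {1..n}" for b b' l m u
    using step_epsilon_B(2)[OF that(3,4,1,2)] that(1) epsilon_B_eq[OF _ that(4)] by (simp add: crystal_step_def)
  have "sh i (c, ?y) * sh j (d, x) = sh j (d, ?y') * sh i (c, x)"
    unfolding y(1) w(1) y'(1) w'(1) inv[OF y(5)[OF w(4)] ji j i] inv[OF y'(5)[OF w'(4)] ij i j]
    by (rule xgen_commute[OF i j ij])
  then show ?case by (simp add: sh_one)
next
  case (3 c d x)
  then show ?case by auto
next
  case (4 c d x)
  then show ?case by auto
qed

private lemma braid_elements:
  assumes i: "i \<in> {1..n}" "i + 1 \<in> {1..n}"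
    and L: "(d, x) \<in> dom (e i)" "(c * d, the (e i (d, x))) \<in> dom (e (i + 1))"
      "(c, the (e (i + 1) (c * d, the (e i (d, x))))) \<in> dom (e i)"
    and R: "(c, x) \<in> dom (e (i + 1))" "(c * d, the (e (i + 1) (c, x))) \<in> dom (e i)"
      "(d, the (e i (c * d, the (e (i + 1) (c, x))))) \<in> dom (e (i + 1))"
  shows "sh i (c, the (e (i + 1) (c * d, the (e i (d, x))))) * (sh (i + 1) (c * d, the (e i (d, x))) * sh i (d, x))
    = sh (i + 1) (d, the (e i (c * d, the (e (i + 1) (c, x))))) * (sh i (c * d, the (e (i + 1) (c, x))) * sh (i + 1) (c, x))"
proof -
  note y = step_data[OF i(1) L(1)] and w = step_data[OF i(2) L(2), unfolded add_diff_cancel_right']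
    and v = step_data[OF i(1) L(3)]
  note y' = step_data[OF i(2) R(1), unfolded add_diff_cancel_right'] and w' = step_data[OF i(1) R(2)]
    and v' = step_data[OF i(2) R(3), unfolded add_diff_cancel_right']
  show ?thesis
    unfolding y(1) w(1) v(1) y'(1) w'(1) v'(1)
    by (rule braid_chain[OF i y(5)[OF w(4)] w(5)[OF v(4)] v(3) y'(5)[OF w'(4)] w'(5)[OF v'(4)] v'(3)])
qed

text \<open>
  The relation for \<open>(i, j)\<close> is the one for \<open>(j, i)\<close> with sides and parameters \<open>c\<close>, \<open>d\<close> exchanged, so \<open>j = i + 1\<close>
  may be assumed.
\<close>

lemma braid_law:
  assumes i: "i \<in> {1..n}" and j: "j \<in> {1..n}" and ij: "cartan_A i j = -1"
  shows "rat_eq CCX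
    (\<lambda>(c, d, x). Option.bind (e i (d, x)) (\<lambda>y. Option.bind (e j (c * d, y)) (\<lambda>z. e i (c, z))))
    (\<lambda>(c, d, x). Option.bind (e j (c, x)) (\<lambda>y. Option.bind (e i (c * d, y)) (\<lambda>z. e j (d, z))))"
proof (rule rat_eq_paths[where ps = "[(i, fst), (j, \<lambda>p. fst p * fst (snd p)), (i, \<lambda>p. fst (snd p))]"
      and qs = "[(j, \<lambda>p. fst (snd p)), (i, \<lambda>p. fst p * fst (snd p)), (j, fst)]"], goal_cases)
  case (1 l k) then show ?case using i j by auto
next
  case (2 c d x)
  then have *: "(d, x) \<in> dom (e i)" "(c * d, the (e i (d, x))) \<in> dom (e j)"
      "(c, the (e j (c * d, the (e i (d, x))))) \<in> dom (e i)"
      "(c, x) \<in> dom (e j)" "(c * d, the (e j (c, x))) \<in> dom (e i)"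
      "(d, the (e i (c * d, the (e j (c, x))))) \<in> dom (e j)" by simp_all
  consider "j = i + 1" | "i = j + 1" using ij by (auto simp: cartan_A_def split: if_splits)
  then have "sh i (c, the (e j (c * d, the (e i (d, x))))) * (sh j (c * d, the (e i (d, x))) * sh i (d, x))
    = sh j (d, the (e i (c * d, the (e j (c, x))))) * (sh i (c * d, the (e j (c, x))) * sh j (c, x))"
  proof cases
    case 1
    show ?thesis unfolding 1 by (rule braid_elements[OF i j[unfolded 1] *[unfolded 1]])
  next
    case 2
    have cd: "c * d = d * c" by simp
    show ?thesis unfolding cd unfolding 2
      by (rule braid_elements[OF j i[unfolded 2] *(4-6,1-3)[unfolded cd, unfolded 2], symmetric])
  qed
  then show ?case by (simp add: sh_one)
next
  case (3 c d x)
  then show ?case by auto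
next
  case (4 c d x)
  then show ?case by auto
qed

private lemma induced_e_rational_action:
  assumes i: "i \<in> {1..n}"
  shows "rational_action Cx_var (*) 1 X (e i)" "open_dense X {x. (1, x) \<in> dom (e i)}"
proof -
  have one: "(1, x) \<in> dom (e i)" if "x \<in> D" for x using at_one(1)[OF that i] by auto
  note m = induced_e_mor(1)[OF uc i]
  have "open_dense CX (dom (e i))" by (rule open_dense_Cx_prod[OF Xi mor_on_open[OF m] generic_dense one])
  moreover have "rat_eq X (\<lambda>x. e i (1, x)) Some"
    unfolding rat_eq_def
    by (rule exI[of _ D], intro conjI generic_dense) (use at_one(1)[OF _ i] in auto)
  ultimately show "rational_action Cx_var (*) 1 X (e i)"
    unfolding rational_action_def rat_map_mor_on using m action_law[OF i] by blast
  have "openin (ind_top X) {x. (1, x) \<in> dom (e i)}"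
    by (rule openin_slice_right[OF ind_space_Cx Xi mor_on_open[OF m]]) simp
  then show "open_dense X {x. (1, x) \<in> dom (e i)}"
    by (rule open_dense_superset[OF generic_dense]) (use one in auto)
qed

private lemma induced_maps:
  "induced_gamma n f i = (\<lambda>x. map_option (gamma_B n i) (f x))"
  "induced_epsilon n f i = (\<lambda>x. map_option (epsilon_B n i) (f x))"
  "induced_eps_int n f J = (\<lambda>x. map_option (epsilon_B_int n J) (f x))"
  by (auto simp: fun_eq_iff induced_gamma_def induced_epsilon_def induced_eps_int_def)

lemma induced_geometric_crystal:
  "geometric_crystal n X e (induced_gamma n f) (induced_epsilon n f)"
  unfolding geometric_crystal_def
proof (intro conjI ballI impI)
  show "ind_variety X" by (rule crystal_ind_variety[OF uc])
next
  fix i assume i: "i \<in> {1..n}"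
  have d: "i < n + 1" "i - 1 < n + 1" using i by auto
  have "b $$ (i, i) \<noteq> 0" if "b \<in> Bminus n" for b using BminusD(4)[OF that d(1)] .
  then have "regfun X (dom f) (\<lambda>x. the (f x) $$ (i - 1, i - 1) / the (f x) $$ (i, i))"
    using f_Bminus[OF uc] by (intro regfun_divide[OF Xi] Bminus_regfun[OF uc] d) auto
  then show "rat_fun X (induced_gamma n f i)"
    unfolding induced_maps by (rule rat_fun_map_f[OF uc]) (rule gamma_B_eq[OF _ i])
  show "rat_fun X (induced_epsilon n f i)"
    unfolding induced_maps by (rule rat_fun_map_f[OF uc lcoef_regfun[OF uc d] epsilon_B_eq[OF _ i]])
  show "rational_action Cx_var (*) 1 X (e i)" "open_dense X {x. (1, x) \<in> dom (e i)}"
    by (rule induced_e_rational_action[OF i])+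
  show "rat_eq CX (\<lambda>(c, x). Option.bind (e i (c, x)) (induced_epsilon n f i))
      (\<lambda>(c, x). map_option (\<lambda>r. inverse c * r) (induced_epsilon n f i x))"
    unfolding induced_maps by (rule one_step[OF i], rule step_epsilon_B(1)[OF i i _ refl])
  fix j assume j: "j \<in> {1..n}"
  show "rat_eq CX (\<lambda>(c, x). Option.bind (e i (c, x)) (induced_gamma n f j))
      (\<lambda>(c, x). map_option (\<lambda>r. c powi cartan_A i j * r) (induced_gamma n f j x))"
    unfolding induced_maps by (rule one_step[OF i], rule step_gamma_B[OF i j])
next
  fix i j assume i: "i \<in> {1..n}" and j: "j \<in> {1..n}" and ij: "cartan_A i j = 0"
  show "rat_eq CCX (\<lambda>(c, d, x). Option.bind (e j (d, x)) (\<lambda>y. e i (c, y)))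
     (\<lambda>(c, d, x). Option.bind (e i (c, x)) (\<lambda>y. e j (d, y)))"
    by (rule commute_law[OF i j ij])
  have ji: "cartan_A j i = 0" using ij by (auto simp: cartan_A_def split: if_splits)
  show "rat_eq CX (\<lambda>(c, x). Option.bind (e j (c, x)) (induced_epsilon n f i)) (\<lambda>(c, x). induced_epsilon n f i x)"
    unfolding induced_maps by (rule one_step_invariant[OF j], rule step_epsilon_B(2)[OF j i _ ji])
next
  fix i j assume i: "i \<in> {1..n}" and j: "j \<in> {1..n}" and ij: "cartan_A i j = -1"
  show "rat_eq CCX (\<lambda>(c, d, x). Option.bind (e i (d, x)) (\<lambda>y. Option.bind (e j (c * d, y)) (\<lambda>z. e i (c, z))))
    (\<lambda>(c, d, x). Option.bind (e j (c, x)) (\<lambda>y. Option.bind (e i (c * d, y)) (\<lambda>z. e j (d, z))))"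
    by (rule braid_law[OF i j ij])
qed

lemma induced_epsilon_system:
  "epsilon_system n X e (induced_epsilon n f) (induced_eps_int n f) (induced_eps_star n f)"
  unfolding epsilon_system_def
proof (intro conjI ballI impI allI)
  fix i assume i: "i \<in> {1..n}"
  have "epsilon_B_int n {i} b = epsilon_B n i b" for b by (simp add: epsilon_B_int_def epsilon_B_def)
  then show "rat_eq X (induced_eps_int n f {i}) (induced_epsilon n f i)"
    unfolding rat_eq_def induced_maps using f_dense[OF uc] by (intro exI[of _ "dom f"]) auto
next
  fix s t assume "1 \<le> s \<and> s \<le> t \<and> t \<le> n"
  then have J: "1 \<le> s" "s \<le> t" "t \<le> n" by auto
  have star: "induced_eps_star n f {s..t} = (\<lambda>x. map_option (epsilon_star_B n {s..t}) (f x))"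
    by (rule ext) (rule induced_eps_star_eq[OF J(2)])
  have d: "t < n + 1" "s - 1 < n + 1" using J by auto
  show "rat_fun X (induced_eps_int n f {s..t})"
    unfolding induced_maps by (rule rat_fun_map_f[OF uc lcoef_regfun[OF uc d] epsilon_B_int_eq[OF _ J]])
  have "mat_regular X (dom f) (n + 1) (\<lambda>x. adj_mat (the (f x)))"
    by (intro mat_regular_adj[OF Xi] mor_B_mat_regular[OF Xi] f_mor[OF uc])
  then have "regfun X (dom f) (\<lambda>x. (-1) ^ (t + 1 - s) * (the (f x) $$ (t, t) * adj_mat (the (f x)) $$ (t, s - 1)))"
    using d mor_on_open[OF f_mor[OF uc]]
    by (intro regfun_mult[OF Xi] regfun_const[OF Xi] Bminus_regfun[OF uc]) (auto simp: mat_regular_def)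
  then show "rat_fun X (induced_eps_star n f {s..t})"
    unfolding star by (rule rat_fun_map_f[OF uc]) (rule epsilon_star_B_eq[OF _ J])
  have "dom (induced_eps_star n f {s..t}) = dom f" unfolding star by auto
  then show "rat_eq X (induced_eps_star n f {s..t}) (eps_alternating_sum (induced_eps_int n f) {s..t})"
    unfolding rat_eq_def induced_eps_star_def using f_dense[OF uc] by (intro exI[of _ "dom f"]) auto
  fix i assume i: "i \<in> {1..n}"
  show "rat_eq CX (\<lambda>(c, x). Option.bind (e i (c, x)) (induced_eps_int n f {s..t}))
      (\<lambda>(c, x). map_option (\<lambda>r. inverse c * r) (induced_eps_int n f {s..t} x))" if "i = s"
    unfolding induced_maps by (rule one_step[OF i], rule step_epsilon_B_int(1)[OF i _ J that])
  show "rat_eq CX (\<lambda>(c, x). Option.bind (e i (c, x)) (induced_eps_int n f {s..t}))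
      (\<lambda>(c, x). induced_eps_int n f {s..t} x)" if "i \<notin> {s - 1, s, t + 1}"
    unfolding induced_maps by (rule one_step_invariant[OF i], rule step_epsilon_B_int(2)[OF i _ J that])
  show "rat_eq CX (\<lambda>(c, x). Option.bind (e i (c, x)) (induced_eps_star n f {s..t}))
      (\<lambda>(c, x). map_option (\<lambda>r. inverse c * r) (induced_eps_star n f {s..t} x))" if "i = t"
    unfolding star by (rule one_step[OF i], rule step_epsilon_star_B(1)[OF i _ J that])
  show "rat_eq CX (\<lambda>(c, x). Option.bind (e i (c, x)) (induced_eps_star n f {s..t}))
      (\<lambda>(c, x). induced_eps_star n f {s..t} x)" if "i \<notin> {s - 1, t, t + 1}"
    unfolding star by (rule one_step_invariant[OF i], rule step_epsilon_star_B(2)[OF i _ J that])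
qed

end

theorem theorem6p2:
  fixes n :: nat
    and X :: "nat \<Rightarrow> 'a fspace"
    and \<alpha> :: "complex mat \<times> 'a \<rightharpoonup> 'a"
    and f :: "'a \<rightharpoonup> complex mat"
  assumes "n \<ge> 1"
    and "unipotent_crystal n X \<alpha> f"
    and "\<And>i. i \<in> {1..n} \<Longrightarrow> rat_nonzero X (induced_epsilon n f i)"
  shows "epsilon_system n X (induced_e n \<alpha> f) (induced_epsilon n f)
           (induced_eps_int n f) (induced_eps_star n f)
       \<and> eps_geometric_crystal n X (induced_e n \<alpha> f) (induced_gamma n f) (induced_epsilon n f)"
  using induced_geometric_crystal[OF assms(2,3)] induced_epsilon_system[OF assms(2,3)]
  unfolding eps_geometric_crystal_def by blast

end
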